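(* Suppose $F:\mathcal W_{[0,1]}\to\mathbb R$ is a $C^n$ class function. Then: (i) $F$ has a Taylor polynomial $P_n(f):=\sum_{m=0}^n\frac1{m!}d^mF(0;f,f,\dots,f)$. The remainder is $$R_n(f):=F(f)-P_n(f)=\frac{d^{n+1}F(c_ff;f,\dots,f)}{(n+1)!}$$ for some $c_f\in[0,1]$. (ii) From $F$ one can uniquely define scalars $a_H$ for all $H\in\mathcal H_{\le n}$, such that for all $f\in\bigcup_{\sigma\in S_{[0,1]}}\sigma(\mathcal W_{\bf p})$, $$\frac1{m!}d^mF(0;f,f,\dots,f)=\sum_{H\in\mathcal H_m}a_H\,t(H,f)$$ for all integers $0\le m\le n$. If in addition the higher derivatives $\frac1{m!}d^mF(0;f,f,\dots,f)$ are continuous (in $f$) in the $L^1$ topology, then this equation holds for all $f\in\mathcal W_{[0,1]}$ and all integers $0\le m\le n$.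
   Context: $\mathcal W$ is the vector space of bounded symmetric measurable functions $f:[0,1]^2\to\mathbb R$, and $\mathcal W_{[0,1]}\subset\mathcal W$ the set of those with values in $[0,1]$ (graphons). The cut norm is $\|f\|_{\rm cut}=\sup_{S,T\subset[0,1]}\left|\int_{S\times T}f\right|$ over measurable $S,T$. $S_{[0,1]}$ is the group of invertible Lebesgue measure-preserving maps of $[0,1]$, $f^\sigma(x,y)=f(\sigma(x),\sigma(y))$, $\delta_\Box(f,g)=\inf_{\psi\in S_{[0,1]}}\|f-g^\psi\|_{\rm cut}$; write $f\sim g$ if $\delta_\Box(f,g)=0$. A class function is a function $F$ with $F(f)=F(g)$ whenever $f\sim g$. For $\sigma\in S_{[0,1]}$, $\sigma(\mathcal W_{\bf p})=\{f^\sigma:f\in\mathcal W_{\bf p}\}$. For $f\in\mathcal W_{[0,1]}$, $\operatorname{Adm}(f)=\{g\in\mathcal W:f+\epsilon g\in\mathcal W_{[0,1]}\text{ for all sufficiently small }\epsilon\in[0,1)\}$. G\^ateaux derivatives: $dF(f;g)=\lim_{\lambda\to0,\ f+\lambda g\in\mathcal W_{[0,1]}}\frac1\lambda(F(f+\lambda g)-F(f))$ and $d^nF(f;g_1,\dots,g_n)=\lim_{\lambda\to0,\ f+\lambda g_n\in\mathcal W_{[0,1]}}\frac1\lambda(d^{n-1}F(f+\lambda g_n;g_1,\dots,g_{n-1})-d^{n-1}F(f;g_1,\dots,g_{n-1}))$; the $m=0$ term $d^0F(0)$ is $F(0)$. For an integer $n\ge0$, $F$ is $C^n$ if for every $f\in\mathcal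 W_{[0,1]}$, every $m\in\mathbb N$ and all $g_1,\dots,g_m\in\operatorname{Adm}(f)$, the function $(\lambda_1,\dots,\lambda_m)\mapsto F(f+\lambda_1g_1+\dots+\lambda_mg_m)$, defined on a convex subset of $\mathbb R^m$ containing $0$, has a $C^n$ extension to all of $\mathbb R^m$. For $1\le a<b\le p$, $e^p_{(a,b)}$ is the indicator function of $\left(\frac{a-1}p,\frac ap\right]\times\left(\frac{b-1}p,\frac bp\right]$ plus the indicator function of $\left(\frac{b-1}p,\frac bp\right]\times\left(\frac{a-1}p,\frac ap\right]$; $\mathcal W_p=\mathcal W_{[0,1]}\cap\operatorname{span}_{\mathbb R}\{e^p_{(a,b)}:1\le a<b\le p\}$ and $\mathcal W_{\bf p}=\bigcup_{p\ge1}\mathcal W_p$. Multigraphs are finite, undirected, without loops, possibly with multiple edges; an edge $e$ has endpoints $\{e_s,e_t\}$. $\mathcal H_m$ is the set of isomorphism classes of multigraphs with $m$ edges and no isolated vertices; $\mathcal H_{\le n}=\bigcup_{m\le n}\mathcal H_m$. $t(H,f)=\int_{[0,1]^{V(H)}}\prod_{e\in E(H)}f(x_{e_s},x_{e_t})\prod_idx_i$, with $t(H,f)\equiv1$ if $H$ has no edges.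
   Formalization: The remainder formula in (i) is proved for those f for which d^{n+1}F(cf;f,…,f) exists for all 0<c<1; for a merely C^n class function it can fail, e.g. n=0, F(f)=|t(K_2,f)−1/2|, f=1. *)

theory Defs
  imports "HOL-Analysis.Analysis" "HOL-Library.Multiset"
begin

section \<open>Kernels and graphons\<close>

abbreviation unit_square :: "(real \<times> real) set" where
  "unit_square \<equiv> {0..1} \<times> {0..1}"

text \<open>A function on the unit square is represented by the total function that vanishes
  outside it, so that equality of HOL functions is equality on the square.
  Measurable means Lebesgue measurable throughout.\<close>

type_synonym kernel = "real \<times> real \<Rightarrow> real"

definition kernels :: "kernel set" where
  "kernels = {f. f \<in> borel_measurable (lebesgue_on unit_square)
     \<and> (\<exists>B. \<forall>z. \<bar>f z\<bar> \<le> B)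
     \<and> (\<forall>x y. f (x, y) = f (y, x))
     \<and> (\<forall>z. z \<notin> unit_square \<longrightarrow> f z = 0)}"

definition graphons :: "kernel set" where
  "graphons = {f \<in> kernels. \<forall>z\<in>unit_square. 0 \<le> f z \<and> f z \<le> 1}"

definition cut_norm :: "kernel \<Rightarrow> real" where
  "cut_norm f =
     (SUP (S, T) \<in> {S \<in> sets lebesgue. S \<subseteq> {0..1}} \<times> {T \<in> sets lebesgue. T \<subseteq> {0..1}}.
        \<bar>LINT z|lebesgue_on (S \<times> T). f z\<bar>)"

definition mp_group :: "(real \<Rightarrow> real) set" where
  "mp_group = {\<sigma>. bij_betw \<sigma> {0..1} {0..1}
     \<and> \<sigma> \<in> lebesgue_on {0..1} \<rightarrow>\<^sub>M lebesgue_on {0..1}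
     \<and> inv_into {0..1} \<sigma> \<in> lebesgue_on {0..1} \<rightarrow>\<^sub>M lebesgue_on {0..1}
     \<and> distr (lebesgue_on {0..1}) (lebesgue_on {0..1}) \<sigma> = lebesgue_on {0..1}}"

definition relabel :: "kernel \<Rightarrow> (real \<Rightarrow> real) \<Rightarrow> kernel" where
  "relabel f \<sigma> = (\<lambda>(x, y). if (x, y) \<in> unit_square then f (\<sigma> x, \<sigma> y) else 0)"

definition cut_dist :: "kernel \<Rightarrow> kernel \<Rightarrow> real" where
  "cut_dist f g = (INF \<psi>\<in>mp_group. cut_norm (\<lambda>z. f z - relabel g \<psi> z))"

definition class_function :: "(kernel \<Rightarrow> real) \<Rightarrow> bool" where
  "class_function F \<longleftrightarrow>
     (\<forall>f\<in>graphons. \<forall>g\<in>graphons. cut_dist f g = 0 \<longrightarrow> F f = F g)"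

definition L1_dist :: "kernel \<Rightarrow> kernel \<Rightarrow> real" where
  "L1_dist f g = (LINT z|lebesgue_on unit_square. \<bar>f z - g z\<bar>)"

definition L1_continuous :: "(kernel \<Rightarrow> real) \<Rightarrow> bool" where
  "L1_continuous \<Phi> \<longleftrightarrow>
     (\<forall>f\<in>graphons. \<forall>\<epsilon>>0. \<exists>\<delta>>0. \<forall>g\<in>graphons. L1_dist f g < \<delta> \<longrightarrow> \<bar>\<Phi> g - \<Phi> f\<bar> < \<epsilon>)"

section \<open>Step graphons\<close>

definition edge_kernel :: "nat \<Rightarrow> nat \<Rightarrow> nat \<Rightarrow> kernel" where
  "edge_kernel p a b = (\<lambda>z.
     indicator ({(real a - 1) / real p <.. real a / real p} \<times> {(real b - 1) / real p <.. real b / real p}) z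
   + indicator ({(real b - 1) / real p <.. real b / real p} \<times> {(real a - 1) / real p <.. real a / real p}) z)"

definition step_graphons :: "nat \<Rightarrow> kernel set" where
  "step_graphons p = graphons \<inter>
     {\<lambda>z. \<Sum>(a, b)\<in>{(a, b). 1 \<le> a \<and> a < b \<and> b \<le> p}. c (a, b) * edge_kernel p a b z
       | c :: nat \<times> nat \<Rightarrow> real. True}"

definition all_step_graphons :: "kernel set" where
  "all_step_graphons = (\<Union>p\<in>{1..}. step_graphons p)"

definition step_graphon_orbits :: "kernel set" where
  "step_graphon_orbits = (\<Union>\<sigma>\<in>mp_group. (\<lambda>f. relabel f \<sigma>) ` all_step_graphons)"

section \<open>Gateaux derivatives\<close>

text \<open>The directions \<open>g\<^sub>1, \<dots>, g\<^sub>n\<close> are given as \<open>g 0, \<dots>, g (n - 1)\<close>; the last one is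
  differentiated last. Since \<open>gateaux\<close> has an unspecified value where a limit does
  not exist, \<open>gateaux_exists F n g f\<close> says that all the limits entering
  \<open>gateaux F n g f\<close> exist and are taken at a limit point of the admissible \<open>\<lambda>\<close>.\<close>

definition admissible_steps :: "kernel \<Rightarrow> kernel \<Rightarrow> real set" where
  "admissible_steps f g = {l. (\<lambda>z. f z + l * g z) \<in> graphons}"

primrec gateaux :: "(kernel \<Rightarrow> real) \<Rightarrow> nat \<Rightarrow> (nat \<Rightarrow> kernel) \<Rightarrow> kernel \<Rightarrow> real" where
  "gateaux F 0 g f = F f"
| "gateaux F (Suc n) g f =
     Lim (at 0 within admissible_steps f (g n))
       (\<lambda>l. (gateaux F n g (\<lambda>z. f z + l * g n z) - gateaux F n g f) / l)"

primrec gateaux_exists :: "(kernel \<Rightarrow> real) \<Rightarrow> nat \<Rightarrow> (nat \<Rightarrow> kernel) \<Rightarrow> kernel \<Rightarrow> bool" where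
  "gateaux_exists F 0 g f \<longleftrightarrow> f \<in> graphons"
| "gateaux_exists F (Suc n) g f \<longleftrightarrow>
     0 islimpt admissible_steps f (g n)
   \<and> gateaux_exists F n g f
   \<and> (\<forall>\<^sub>F l in at 0 within admissible_steps f (g n).
        gateaux_exists F n g (\<lambda>z. f z + l * g n z))
   \<and> (\<exists>D. ((\<lambda>l. (gateaux F n g (\<lambda>z. f z + l * g n z) - gateaux F n g f) / l) \<longlongrightarrow> D)
        (at 0 within admissible_steps f (g n)))"

section \<open>Functions of class \<open>C\<^sup>n\<close>\<close>

definition Adm :: "kernel \<Rightarrow> kernel set" where
  "Adm f = {g \<in> kernels. \<exists>\<epsilon>0>0. \<forall>\<epsilon>. 0 \<le> \<epsilon> \<and> \<epsilon> < 1 \<and> \<epsilon> < \<epsilon>0 \<longrightarrow> (\<lambda>z. f z + \<epsilon> * g z) \<in> graphons}"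

text \<open>The dimension is quantified inside the definition of \<open>C\<^sup>n\<close>, so \<open>\<real>\<^sup>m\<close> is the set
  of sequences supported on the first \<open>m\<close> coordinates; the product topology restricts to
  the Euclidean topology on it.\<close>

definition Rn :: "nat \<Rightarrow> (nat \<Rightarrow> real) set" where
  "Rn m = {x. \<forall>i\<ge>m. x i = 0}"

primrec Ck_on_Rn :: "nat \<Rightarrow> nat \<Rightarrow> ((nat \<Rightarrow> real) \<Rightarrow> real) \<Rightarrow> bool" where
  "Ck_on_Rn m 0 G \<longleftrightarrow> continuous_on (Rn m) G"
| "Ck_on_Rn m (Suc k) G \<longleftrightarrow> continuous_on (Rn m) G
     \<and> (\<forall>i<m. \<exists>G'. (\<forall>x\<in>Rn m. ((\<lambda>t. G (x(i := t))) has_real_derivative G' x) (at (x i)))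
                   \<and> Ck_on_Rn m k G')"

definition Cn_function :: "nat \<Rightarrow> (kernel \<Rightarrow> real) \<Rightarrow> bool" where
  "Cn_function n F \<longleftrightarrow>
     (\<forall>f\<in>graphons. \<forall>m g. (\<forall>i<m. g i \<in> Adm f) \<longrightarrow>
        (\<exists>G. Ck_on_Rn m n G
           \<and> (\<forall>l\<in>Rn m. (\<lambda>z. f z + (\<Sum>i<m. l i * g i z)) \<in> graphons \<longrightarrow>
                G l = F (\<lambda>z. f z + (\<Sum>i<m. l i * g i z)))))"

definition taylor_term :: "(kernel \<Rightarrow> real) \<Rightarrow> nat \<Rightarrow> kernel \<Rightarrow> real" where
  "taylor_term F m f = gateaux F m (\<lambda>_. f) (\<lambda>_. 0) / fact m"

definition taylor_poly :: "(kernel \<Rightarrow> real) \<Rightarrow> nat \<Rightarrow> kernel \<Rightarrow> real" where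
  "taylor_poly F n f = (\<Sum>m\<le>n. taylor_term F m f)"

section \<open>Multigraphs and homomorphism densities\<close>

text \<open>A multigraph is a finite set of vertices with a multiset of two-element edges.
  Vertices are natural numbers, which covers all finite multigraphs up to isomorphism.\<close>

type_synonym multigraph = "nat set \<times> nat set multiset"

definition multigraphs :: "multigraph set" where
  "multigraphs = {(V, E). finite V \<and> (\<forall>e\<in>#E. e \<subseteq> V \<and> card e = 2)}"

definition multigraph_iso :: "(multigraph \<times> multigraph) set" where
  "multigraph_iso = {((V, E), (V', E')). (V, E) \<in> multigraphs \<and> (V', E') \<in> multigraphs
     \<and> (\<exists>\<phi>. bij_betw \<phi> V V' \<and> E' = image_mset (\<lambda>e. \<phi> ` e) E)}"

definition iso_classes :: "nat \<Rightarrow> multigraph set set" where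
  "iso_classes m =
     {(V, E) \<in> multigraphs. size E = m \<and> (\<forall>v\<in>V. \<exists>e\<in>#E. v \<in> e)} // multigraph_iso"

definition iso_classes_upto :: "nat \<Rightarrow> multigraph set set" where
  "iso_classes_upto n = (\<Union>m\<le>n. iso_classes m)"

text \<open>As \<open>f\<close> is symmetric, the order of the endpoints of an edge is immaterial. The
  completion is needed because a Lebesgue measurable \<open>f\<close> need not be measurable with
  respect to the product \<open>\<sigma>\<close>-algebra.\<close>

definition hom_density_rep :: "multigraph \<Rightarrow> kernel \<Rightarrow> real" where
  "hom_density_rep H f =
     (LINT x|completion (\<Pi>\<^sub>M v\<in>fst H. lebesgue_on {0..1}). (\<Prod>e\<in>#snd H. f (x (Min e), x (Max e))))"

definition hom_density :: "multigraph set \<Rightarrow> kernel \<Rightarrow> real" where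
  "hom_density H f = hom_density_rep (SOME G. G \<in> H) f"

definition hom_expansion_on ::
  "(kernel \<Rightarrow> real) \<Rightarrow> nat \<Rightarrow> (multigraph set \<Rightarrow> real) \<Rightarrow> kernel set \<Rightarrow> bool" where
  "hom_expansion_on F n a X \<longleftrightarrow>
     (\<forall>f\<in>X. \<forall>m\<le>n. taylor_term F m f = (\<Sum>H\<in>iso_classes m. a H * hom_density H f))"

end

theory Submission
  imports Defs
begin

text \<open>Along a ray \<open>t \<mapsto> t f\<close> the functional has a \<open>C\<^sup>n\<close> extension, so part (i) is the
  one-variable Taylor theorem. For part (ii), on the step graphons with \<open>p\<close> blocks the Taylor term of
  degree \<open>m\<close> is a homogeneous polynomial in the edge weights. Permuting the blocks is a
  measure-preserving relabelling, so its coefficient at an edge multiset depends only on the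
  isomorphism class of that multigraph. The coefficient of \<open>t(H, \<cdot>)\<close> at an edge multiset \<open>\<alpha>\<close> is,
  up to scaling, the number of vertex maps carrying \<open>H\<close> onto \<open>\<alpha>\<close>; this vanishes unless \<open>\<alpha> \<cong> H\<close> or
  \<open>\<alpha>\<close> has fewer vertices than \<open>H\<close>. For \<open>p \<ge> 2m\<close> every class occurs among the edge multisets and this
  triangularity gives a unique expansion; uniqueness makes the coefficients independent of \<open>p\<close>.
  Every graphon is an almost everywhere limit of graphons continuous on the square, and each of those
  is one of step graphons; homomorphism densities pass to such limits by dominated convergence.\<close>

section \<open>Derivatives along rays\<close>

text \<open>\<open>Cn_function\<close> promises, for each finite family of directions separately,
  some extension of class C^n; extensions for different families are unrelated, and away from the
  graphons an extension carries no information about \<open>F\<close>. What gets used is its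
  derivatives at 0 along rays \<open>l * f\<close> inside the graphons, which \<open>F\<close>
  determines. Hence coefficients obtained for different numbers of blocks cannot be read off one
  polynomial and have to be compared through uniqueness on a shared partition.

  Smoothness stops at order \<open>n\<close>, so the derivative of order \<open>n + 1\<close> in the
  remainder is available only by hypothesis, at interior points of the ray; the one-variable theorem
  is therefore proved with the last derivative on the open interval and continuity at its ends.

  The bound \<open>2 * m\<close> is the largest number of vertices that m edges can cover. Step
  graphons vanish on the diagonal blocks, which matches the absence of loops: a vertex map that
  collapses an edge contributes nothing. The price is that step approximations fail in general on
  the diagonal, so the limits are taken off a null set.\<close>

text \<open>\<open>Ck_on_Rn\<close> asks for derivative functions anew at every level. Here they are
  all chosen at once, indexed by words that record the order of differentiation.\<close>

lemma Ck_partials: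
  assumes "Ck_on_Rn N n G"
  shows "\<exists>D. D [] = G
    \<and> (\<forall>w. set w \<subseteq> {..<N} \<and> length w \<le> n \<longrightarrow> continuous_on (Rn N) (D w))
    \<and> (\<forall>w i. set w \<subseteq> {..<N} \<and> length w < n \<and> i < N \<longrightarrow>
        (\<forall>x\<in>Rn N. ((\<lambda>t. D w (x(i := t))) has_real_derivative D (w @ [i]) x) (at (x i))))"
  using assms
proof (induction n arbitrary: G)
  case 0
  show ?case by (rule exI[of _ "\<lambda>_. G"]) (use 0 in auto)
next
  case (Suc n)
  have cont: "continuous_on (Rn N) G"
    and "\<forall>i<N. \<exists>G'. (\<forall>x\<in>Rn N. ((\<lambda>t. G (x(i := t))) has_real_derivative G' x) (at (x i)))
                   \<and> Ck_on_Rn N n G'" using Suc.prems by auto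
  then obtain G' where G': "\<And>i x. i < N \<Longrightarrow> x \<in> Rn N \<Longrightarrow>
      ((\<lambda>t. G (x(i := t))) has_real_derivative G' i x) (at (x i))"
     and G'C: "\<And>i. i < N \<Longrightarrow> Ck_on_Rn N n (G' i)" by metis
  define Q where "Q i D \<longleftrightarrow> D [] = G' i
    \<and> (\<forall>w. set w \<subseteq> {..<N} \<and> length w \<le> n \<longrightarrow> continuous_on (Rn N) (D w))
    \<and> (\<forall>w j. set w \<subseteq> {..<N} \<and> length w < n \<and> j < N \<longrightarrow>
        (\<forall>x\<in>Rn N. ((\<lambda>t. D w (x(j := t))) has_real_derivative D (w @ [j]) x) (at (x j))))" for i D
  have "\<forall>i. \<exists>D. i < N \<longrightarrow> Q i D"
    using Suc.IH[OF G'C] unfolding Q_def by blast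
  from choice[OF this] obtain D where Q: "\<And>i. i < N \<Longrightarrow> Q i (D i)" by blast
  have D: "\<And>i. i < N \<Longrightarrow> D i [] = G' i"
      "\<And>i w. i < N \<Longrightarrow> set w \<subseteq> {..<N} \<Longrightarrow> length w \<le> n \<Longrightarrow> continuous_on (Rn N) (D i w)"
      "\<And>i w j x. i < N \<Longrightarrow> set w \<subseteq> {..<N} \<Longrightarrow> length w < n \<Longrightarrow> j < N \<Longrightarrow> x \<in> Rn N \<Longrightarrow>
        ((\<lambda>t. D i w (x(j := t))) has_real_derivative D i (w @ [j]) x) (at (x j))"
    using Q unfolding Q_def by blast+
  \<comment> \<open>\<open>Ck_on_Rn\<close> peels off the first differentiation, so a nonempty word
    is handed to the family chosen for its first letter; letters appended at the end are then
    covered by the induction hypothesis.\<close>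
  define E where "E w = (case w of [] \<Rightarrow> G | i # w' \<Rightarrow> D i w')" for w
  show ?case
  proof (intro exI[of _ E] conjI allI impI ballI)
    show "E [] = G" by (simp add: E_def)
    fix w assume "set w \<subseteq> {..<N} \<and> length w \<le> Suc n"
    then show "continuous_on (Rn N) (E w)"
      by (cases w) (auto simp: E_def cont D(2))
  next
    fix w i x assume "set w \<subseteq> {..<N} \<and> length w < Suc n \<and> i < N" "x \<in> Rn N"
    then show "((\<lambda>t. E w (x(i := t))) has_real_derivative E (w @ [i]) x) (at (x i))"
      by (cases w) (auto simp: E_def G' D(1) intro: D(3))
  qed
qed

text \<open>The function type carries the product topology, in which convergence is
  coordinatewise.\<close>

lemma tendsto_funI:
  fixes z :: "'a \<Rightarrow> nat \<Rightarrow> real"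
  assumes "\<And>j. ((\<lambda>h. z h j) \<longlongrightarrow> x j) A"
  shows "(z \<longlongrightarrow> x) A"
  unfolding limitin_canonical_iff[symmetric] euclidean_product_topology[symmetric]
    limitin_componentwise
  using assms by simp

text \<open>The increment is telescoped coordinate by coordinate and the mean value theorem is
  applied to each summand.\<close>
lemma directional_derivative:
  assumes G': "\<And>i x. i < N \<Longrightarrow> x \<in> Rn N \<Longrightarrow>
      ((\<lambda>t. G (x(i := t))) has_real_derivative G' i x) (at (x i))"
    and cont: "\<And>i. i < N \<Longrightarrow> continuous_on (Rn N) (G' i)"
    and x: "x \<in> Rn N" and c: "c \<in> Rn N"
  shows "((\<lambda>h. (G (\<lambda>j. x j + h * c j) - G x) / h) \<longlongrightarrow> (\<Sum>i<N. c i * G' i x)) (at 0)"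
proof -
  \<comment> \<open>Only the first \<open>k\<close> coordinates have moved, so \<open>y h 0\<close>
    is \<open>x\<close> and \<open>y h N\<close> is the endpoint \<open>x + h * c\<close>.\<close>
  define y where "y h k = (\<lambda>j. x j + (if j < k then h * c j else 0))" for h and k :: nat
  have yR: "y h k \<in> Rn N" for h k using x c by (auto simp: y_def Rn_def)
  have step: "((\<lambda>h. (G (y h (Suc k)) - G (y h k)) / h) \<longlongrightarrow> c k * G' k x) (at 0)" if k: "k < N" for k
  proof -
    have "\<forall>h. \<exists>\<theta>. \<bar>\<theta>\<bar> \<le> \<bar>h * c k\<bar> \<and>
        G (y h (Suc k)) - G (y h k) = h * c k * G' k ((y h k)(k := x k + \<theta>))"
    proof
      fix h
      define g where "g t = G ((y h k)(k := x k + t))" for t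
      have eq: "y h (Suc k) = (y h k)(k := x k + h * c k)" "y h k = (y h k)(k := x k + 0)"
        by (auto simp: y_def fun_eq_iff)
      have der: "(g has_real_derivative G' k ((y h k)(k := x k + t))) (at t)" for t
      proof -
        have "(y h k)(k := x k + t) \<in> Rn N" using yR[of h k] k by (auto simp: Rn_def)
        from G'[OF k this]
        have "((\<lambda>s. G ((y h k)(k := s))) has_real_derivative G' k ((y h k)(k := x k + t))) (at (t + x k))"
          by (simp add: add.commute)
        then have "((\<lambda>s. G ((y h k)(k := s + x k))) has_real_derivative G' k ((y h k)(k := x k + t))) (at t)"
          by (simp only: DERIV_shift)
        moreover have "(\<lambda>s. G ((y h k)(k := s + x k))) = g"
          by (simp add: g_def fun_eq_iff add.commute)
        ultimately show ?thesis by simp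
      qed
      consider "h * c k = 0" | "h * c k > 0" | "h * c k < 0" by linarith
      then show "\<exists>\<theta>. \<bar>\<theta>\<bar> \<le> \<bar>h * c k\<bar> \<and>
        G (y h (Suc k)) - G (y h k) = h * c k * G' k ((y h k)(k := x k + \<theta>))"
      proof cases
        case 1
        then show ?thesis using eq by (intro exI[of _ 0]) auto
      next
        case 2
        from MVT2[OF this der] obtain z where "0 < z" "z < h * c k"
          "g (h * c k) - g 0 = (h * c k - 0) * G' k ((y h k)(k := x k + z))" by blast
        with eq show ?thesis by (intro exI[of _ z]) (auto simp: g_def)
      next
        case 3
        from MVT2[OF this der] obtain z where "h * c k < z" "z < 0"
          "g 0 - g (h * c k) = (0 - h * c k) * G' k ((y h k)(k := x k + z))" by blast
        with eq show ?thesis by (intro exI[of _ z]) (auto simp: g_def)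
      qed
    qed
    from choice[OF this] obtain \<theta> where th: "\<And>h. \<bar>\<theta> h\<bar> \<le> \<bar>h * c k\<bar>"
      "\<And>h. G (y h (Suc k)) - G (y h k) = h * c k * G' k ((y h k)(k := x k + \<theta> h))" by blast
    have th0: "(\<theta> \<longlongrightarrow> 0) (at 0)"
    proof (rule Lim_null_comparison)
      show "\<forall>\<^sub>F h in at 0. norm (\<theta> h) \<le> \<bar>h * c k\<bar>" using th(1) by auto
      show "((\<lambda>h. \<bar>h * c k\<bar>) \<longlongrightarrow> 0) (at 0)" by (auto intro!: tendsto_eq_intros)
    qed
    \<comment> \<open>The intermediate point converges in each coordinate: those below
      \<open>k\<close> move by \<open>h * c j\<close>, coordinate \<open>k\<close> by at most the
      absolute value of \<open>h * c k\<close>, the others stay.\<close>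
    have "((\<lambda>h. (y h k)(k := x k + \<theta> h)) \<longlongrightarrow> x) (at 0)"
    proof (rule tendsto_funI)
      fix j show "((\<lambda>h. ((y h k)(k := x k + \<theta> h)) j) \<longlongrightarrow> x j) (at 0)"
        by (cases "j = k"; cases "j < k") (auto simp: y_def intro!: tendsto_eq_intros th0)
    qed
    then have "((\<lambda>h. G' k ((y h k)(k := x k + \<theta> h))) \<longlongrightarrow> G' k x) (at 0)"
      by (rule continuous_on_tendsto_compose[OF cont[OF k] _ x])
         (use yR k in \<open>auto simp: Rn_def\<close>)
    then have "((\<lambda>h. c k * G' k ((y h k)(k := x k + \<theta> h))) \<longlongrightarrow> c k * G' k x) (at 0)"
      by (intro tendsto_intros)
    moreover have "\<forall>\<^sub>F h in at 0. c k * G' k ((y h k)(k := x k + \<theta> h))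
        = (G (y h (Suc k)) - G (y h k)) / h"
      by (auto simp: eventually_at th(2) intro!: exI[of _ 1])
    ultimately show ?thesis by (rule Lim_transform_eventually)
  qed
  have "((\<lambda>h. \<Sum>k<N. (G (y h (Suc k)) - G (y h k)) / h) \<longlongrightarrow> (\<Sum>k<N. c k * G' k x)) (at 0)"
    by (intro tendsto_sum step) auto
  moreover have "(\<Sum>k<N. (G (y h (Suc k)) - G (y h k)) / h)
      = (G (\<lambda>j. x j + h * c j) - G x) / h" for h
  proof -
    have "(\<Sum>k<N. (G (y h (Suc k)) - G (y h k)) / h) = (G (y h N) - G (y h 0)) / h"
      by (simp add: sum_lessThan_telescope[of "\<lambda>k. G (y h k)", symmetric] sum_divide_distrib)
    moreover have "y h N = (\<lambda>j. x j + h * c j)" "y h 0 = x"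
      using c by (auto simp: y_def fun_eq_iff Rn_def)
    ultimately show ?thesis by simp
  qed
  ultimately show ?thesis by simp
qed

lemma derivative_along_ray:
  assumes G': "\<And>i x. i < N \<Longrightarrow> x \<in> Rn N \<Longrightarrow>
      ((\<lambda>t. G (x(i := t))) has_real_derivative G' i x) (at (x i))"
    and cont: "\<And>i. i < N \<Longrightarrow> continuous_on (Rn N) (G' i)"
    and c: "c \<in> Rn N"
  shows "((\<lambda>t. G (\<lambda>j. t * c j)) has_real_derivative (\<Sum>i<N. c i * G' i (\<lambda>j. t * c j))) (at t)"
proof -
  have "(\<lambda>j. t * c j) \<in> Rn N" using c by (auto simp: Rn_def)
  from directional_derivative[OF G' cont this c]
  show ?thesis by (simp add: DERIV_def algebra_simps)
qed

text \<open>Ordered words instead of multi-indices: each mixed partial has its own term, so the k-th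
  derivative along a ray is a plain sum with coefficients
  \<open>prod_list (map c w)\<close>.\<close>

definition words :: "nat \<Rightarrow> nat \<Rightarrow> nat list set" where
  "words N k = {w. set w \<subseteq> {..<N} \<and> length w = k}"

lemma finite_words: "finite (words N k)"
  unfolding words_def by (rule finite_lists_length_eq) simp

lemma sum_words_Suc:
  "(\<Sum>w\<in>words N (Suc k). h w) = (\<Sum>w\<in>words N k. \<Sum>i<N. h (w @ [i]))"
proof -
  have "(\<Sum>w\<in>words N k. \<Sum>i<N. h (w @ [i])) = (\<Sum>(w, i)\<in>words N k \<times> {..<N}. h (w @ [i]))"
    by (rule sum.cartesian_product)
  also have "\<dots> = (\<Sum>w\<in>words N (Suc k). h w)"
  proof (rule sum.reindex_bij_witness[of _ "\<lambda>w. (butlast w, last w)" "\<lambda>(w, i). w @ [i]"])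
    fix w assume w: "w \<in> words N (Suc k)"
    then have "w \<noteq> []" by (auto simp: words_def)
    then show "(case (butlast w, last w) of (w, i) \<Rightarrow> w @ [i]) = w" by simp
    have "last w \<in> set w" using \<open>w \<noteq> []\<close> by simp
    then show "(butlast w, last w) \<in> words N k \<times> {..<N}"
      using w by (auto simp: words_def dest: in_set_butlastD)
  qed (auto simp: words_def)
  finally show ?thesis ..
qed

text \<open>The order of the quantifiers is the point: the numbers \<open>d\<close>, the mixed
  partials at the origin, are the same for all \<open>c\<close>. Thus the derivatives at 0 along
  rays are homogeneous polynomials in the direction.\<close>

lemma Ck_along_rays:
  assumes "Ck_on_Rn N n G"
  shows "\<exists>d. \<forall>c\<in>Rn N. \<exists>\<psi>. (\<forall>t. \<psi> 0 t = G (\<lambda>j. t * c j))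
     \<and> (\<forall>k<n. \<forall>t. (\<psi> k has_real_derivative \<psi> (Suc k) t) (at t))
     \<and> (\<forall>k\<le>n. continuous_on UNIV (\<psi> k))
     \<and> (\<forall>k\<le>n. \<psi> k 0 = (\<Sum>w\<in>words N k. prod_list (map c w) * d w))"
proof -
  obtain D where D: "D [] = G"
     "\<And>w. set w \<subseteq> {..<N} \<Longrightarrow> length w \<le> n \<Longrightarrow> continuous_on (Rn N) (D w)"
     "\<And>w i x. set w \<subseteq> {..<N} \<Longrightarrow> length w < n \<Longrightarrow> i < N \<Longrightarrow> x \<in> Rn N \<Longrightarrow>
        ((\<lambda>t. D w (x(i := t))) has_real_derivative D (w @ [i]) x) (at (x i))"
    using Ck_partials[OF assms] by blast
  show ?thesis
  proof (intro exI[of _ "\<lambda>w. D w (\<lambda>_. 0)"] ballI)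
    fix c assume c: "c \<in> Rn N"
    define \<psi> where "\<psi> k t = (\<Sum>w\<in>words N k. prod_list (map c w) * D w (\<lambda>j. t * c j))" for k t
    have der: "(\<psi> k has_real_derivative \<psi> (Suc k) t) (at t)" if "k < n" for k t
    proof -
      have "(\<psi> k has_real_derivative
         (\<Sum>w\<in>words N k. prod_list (map c w) * (\<Sum>i<N. c i * D (w @ [i]) (\<lambda>j. t * c j)))) (at t)"
        unfolding \<psi>_def
        by (intro DERIV_sum DERIV_cmult derivative_along_ray D c)
           (use that in \<open>auto simp: words_def\<close>)
      moreover have "(\<Sum>w\<in>words N k. prod_list (map c w) * (\<Sum>i<N. c i * D (w @ [i]) (\<lambda>j. t * c j)))
          = \<psi> (Suc k) t"
        unfolding \<psi>_def sum_words_Suc by (simp add: sum_distrib_left mult.assoc)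
      ultimately show ?thesis by simp
    qed
    have cont: "continuous_on UNIV (\<psi> k)" if "k \<le> n" for k
    proof -
      have "continuous_on UNIV (\<lambda>t. D w (\<lambda>j. t * c j))" if w: "w \<in> words N k" for w
      proof (rule continuous_on_compose2[OF D(2)])
        show "continuous_on UNIV (\<lambda>t j. t * c j)"
          by (intro continuous_on_coordinatewise_then_product continuous_intros)
      qed (use w \<open>k \<le> n\<close> c in \<open>auto simp: words_def Rn_def\<close>)
      then show ?thesis unfolding \<psi>_def by (intro continuous_intros)
    qed
    have w0: "words N 0 = {[]}" by (auto simp: words_def)
    show "\<exists>\<psi>. (\<forall>t. \<psi> 0 t = G (\<lambda>j. t * c j))
     \<and> (\<forall>k<n. \<forall>t. (\<psi> k has_real_derivative \<psi> (Suc k) t) (at t))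
     \<and> (\<forall>k\<le>n. continuous_on UNIV (\<psi> k))
     \<and> (\<forall>k\<le>n. \<psi> k 0 = (\<Sum>w\<in>words N k. prod_list (map c w) * D w (\<lambda>_. 0)))"
      by (rule exI[of _ \<psi>]) (use der cont in \<open>auto simp: \<psi>_def w0 D(1)\<close>)
  qed
qed

section \<open>Taylor's theorem with Lagrange remainder on the unit interval\<close>

text \<open>Each zero to the right of 0, paired with the zero at 0 of the same derivative, yields by
  Rolle a zero of the next derivative strictly between; the chain starts at 1.\<close>

lemma Rolle_iterated:
  assumes "\<And>k t. k < n \<Longrightarrow> (u k has_real_derivative u (Suc k) t) (at t)"
    and "\<And>k. k \<le> n \<Longrightarrow> u k 0 = 0" and "u 0 1 = 0"
  shows "\<exists>t\<in>{0<..1}. u n t = (0::real)"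
  using assms
proof (induction n)
  case 0
  then show ?case by (intro bexI[of _ 1]) auto
next
  case (Suc n)
  then obtain t where t: "t \<in> {0<..1}" "u n t = 0" by auto
  \<comment> \<open>The vanishing of the derivative appears as an equality of linear maps;
    evaluation at 1 turns it into an equation of numbers.\<close>
  have "\<exists>z>0. z < t \<and> (\<lambda>h. u (Suc n) z * h) = (\<lambda>v. 0)"
  proof (rule Rolle_deriv[where f = "u n"])
    show "continuous_on {0..t} (u n)"
      using Suc.prems(1)[of n] by (intro DERIV_continuous_on[where D = "u (Suc n)"])
        (auto intro: has_field_derivative_at_within)
    fix x show "(u n has_derivative (*) (u (Suc n) x)) (at x)"
      using Suc.prems(1)[of n x] by (simp add: has_field_derivative_def)
  qed (use t Suc.prems(2)[of n] in auto)
  then obtain z where "0 < z" "z < t" "u (Suc n) z = 0" by (metis mult.right_neutral)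
  then show ?case using t by (intro bexI[of _ z]) auto
qed

text \<open>Subtract the polynomial of degree \<open>n + 1\<close> that matches the derivatives at 0
  up to order \<open>n\<close> and the value at 1. Iterated Rolle gives a positive zero of the n-th
  derivative of the difference; one further Rolle step uses the last derivative only at interior
  points.\<close>

lemma Taylor_Lagrange_unit:
  assumes der: "\<And>k t. k < n \<Longrightarrow> (\<psi> k has_real_derivative \<psi> (Suc k) t) (at t)"
    and cont: "continuous_on {0..1} (\<psi> n)"
    and last: "\<And>t. 0 < t \<Longrightarrow> t < 1 \<Longrightarrow> (\<psi> n has_real_derivative E t) (at t)"
  shows "\<exists>c. 0 < c \<and> c < 1 \<and> \<psi> 0 1 - (\<Sum>m\<le>n. \<psi> m 0 / fact m) = E c / fact (n + 1)"
proof -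
  define R where "R = \<psi> 0 1 - (\<Sum>m\<le>n. \<psi> m 0 / fact m)"
  \<comment> \<open>The top coefficient is the remainder itself: this makes the polynomial agree
    with \<open>\<psi> 0\<close> at 1.\<close>
  define a where "a m = (if m \<le> n then \<psi> m 0 / fact m else R)" for m
  define p where "p = (\<Sum>m\<le>n + 1. monom (a m) m)"
  have coeff_p: "coeff p i = (if i \<le> n + 1 then a i else 0)" for i
    unfolding p_def coeff_sum by auto
  have coeff0: "poly ((pderiv ^^ k) p) 0 = fact k * a k" if "k \<le> n + 1" for k
    using that by (simp add: poly_0_coeff_0 coeff_higher_pderiv coeff_p pochhammer_fact)
  have "(pderiv ^^ (n + 1)) p = [:fact (n + 1) * R:]"
    by (rule poly_eqI)
       (auto simp: coeff_higher_pderiv coeff_p coeff_pCons a_def pochhammer_fact split: nat.splits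
             simp del: funpow.simps)
  then have top: "pderiv ((pderiv ^^ n) p) = [:fact (n + 1) * R:]" by simp
  define u where "u k t = \<psi> k t - poly ((pderiv ^^ k) p) t" for k t
  have "poly p 1 = \<psi> 0 1"
    by (simp add: p_def poly_sum poly_monom a_def R_def)
  then have "\<exists>t\<in>{0<..1}. u n t = 0"
    by (intro Rolle_iterated)
       (auto simp: u_def coeff0 a_def intro!: derivative_eq_intros der poly_DERIV)
  then obtain t where t: "0 < t" "t \<le> 1" "u n t = 0" by auto
  have "\<exists>z>0. z < t \<and> (\<lambda>h. (E z - fact (n + 1) * R) * h) = (\<lambda>v. 0)"
  proof (rule Rolle_deriv[where f = "u n"])
    show "continuous_on {0..t} (u n)" unfolding u_def
      using t by (intro continuous_intros continuous_on_subset[OF cont]) auto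
    show "u n 0 = u n t" using t by (simp add: u_def coeff0 a_def)
    fix x assume "0 < x" "x < t"
    then have "(u n has_real_derivative E x - fact (n + 1) * R) (at x)"
      unfolding u_def using t
      by (auto intro!: derivative_eq_intros last poly_DERIV[THEN DERIV_cong] simp: top)
    then show "(u n has_derivative (*) (E x - fact (n + 1) * R)) (at x)"
      by (simp add: has_field_derivative_def)
  qed (use t in auto)
  then obtain z where z: "0 < z" "z < t" and eq: "(\<lambda>h. (E z - fact (n + 1) * R) * h) = (\<lambda>v. 0)" by blast
  from fun_cong[OF eq, of 1] have "E z = fact (n + 1) * R" by simp
  then show ?thesis using z t by (intro exI[of _ z]) (simp add: R_def[symmetric])
qed

section \<open>Rays of graphons and Gateaux derivatives along them\<close>

lemma zero_graphon: "(\<lambda>_. 0) \<in> graphons"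
  by (auto simp: graphons_def kernels_def)

lemma graphon_bounds:
  assumes "f \<in> graphons" shows "0 \<le> f z" "f z \<le> 1"
proof -
  have "0 \<le> f z \<and> f z \<le> 1"
  proof (cases "z \<in> unit_square")
    case True
    then show ?thesis using assms by (auto simp: graphons_def)
  next
    case False
    then have "f z = 0" using assms unfolding graphons_def kernels_def by blast
    then show ?thesis by simp
  qed
  then show "0 \<le> f z" "f z \<le> 1" by auto
qed

lemma scaled_kernel:
  assumes "f \<in> kernels" shows "(\<lambda>z. c * f z) \<in> kernels"
proof -
  from assms obtain B where "\<And>z. \<bar>f z\<bar> \<le> B" by (auto simp: kernels_def)
  then have "\<forall>z. \<bar>c * f z\<bar> \<le> \<bar>c\<bar> * B" by (simp add: abs_mult mult_left_mono)
  then show ?thesis using assms unfolding kernels_def by auto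
qed

lemma scaled_graphon:
  assumes "f \<in> graphons" "0 \<le> c" "c \<le> 1"
  shows "(\<lambda>z. c * f z) \<in> graphons"
  using assms graphon_bounds[OF assms(1)] scaled_kernel[of f c]
  by (auto simp: graphons_def mult_le_one)

text \<open>The domain over which the limits in \<open>gateaux\<close> run when point and direction
  are multiples of \<open>f\<close>. It can be larger than the unit interval; for
  \<open>f = 0\<close> it is the whole line.\<close>

definition ray :: "kernel \<Rightarrow> real set" where
  "ray f = {l. (\<lambda>z. l * f z) \<in> graphons}"

lemma ray_unit: "f \<in> graphons \<Longrightarrow> {0..1} \<subseteq> ray f"
  by (auto simp: ray_def scaled_graphon)

lemma admissible_steps_ray: "admissible_steps (\<lambda>z. c * f z) f = {l. c + l \<in> ray f}"
  by (simp add: admissible_steps_def ray_def algebra_simps)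

lemma ray_convex:
  assumes "f \<in> kernels" "a \<in> ray f" "b \<in> ray f" "0 \<le> t" "t \<le> 1"
  shows "(1 - t) * a + t * b \<in> ray f"
proof -
  have "0 \<le> ((1 - t) * a + t * b) * f z \<and> ((1 - t) * a + t * b) * f z \<le> 1" for z
  proof -
    have *: "0 \<le> a * f z" "a * f z \<le> 1" "0 \<le> b * f z" "b * f z \<le> 1"
      using assms(2,3) graphon_bounds[of "\<lambda>z. a * f z" z] graphon_bounds[of "\<lambda>z. b * f z" z]
      by (auto simp: ray_def)
    have "(1 - t) * (a * f z) + t * (b * f z) \<le> 1"
      using * assms(4,5) by (intro convex_bound_le) auto
    moreover have "0 \<le> (1 - t) * (a * f z) + t * (b * f z)" using * assms(4,5) by simp
    ultimately show ?thesis by (simp add: algebra_simps)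
  qed
  then show ?thesis using scaled_kernel[OF assms(1)] by (simp add: ray_def graphons_def)
qed

text \<open>The ray is convex and has a second point, so a short move towards that point stays
  inside it. Without a limit point the restricted limit in \<open>gateaux\<close> would not
  determine a value.\<close>

lemma ray_islimpt:
  assumes "f \<in> graphons" "c \<in> ray f"
  shows "0 islimpt {l. c + l \<in> ray f}"
proof -
  have f: "f \<in> kernels" using assms by (simp add: graphons_def)
  \<comment> \<open>A point of the ray different from \<open>c\<close>.\<close>
  define b :: real where "b = (if c = 0 then 1 else 0)"
  have b: "b \<in> ray f" "b - c \<noteq> 0" using ray_unit[OF assms(1)] by (auto simp: b_def)
  show ?thesis unfolding islimpt_approachable
  proof (intro allI impI)
    fix e :: real assume "0 < e"
    define t where "t = min 1 (e / (2 * \<bar>b - c\<bar>))"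
    have t: "0 < t" "t \<le> 1" using b \<open>0 < e\<close> by (auto simp: t_def)
    have "t * \<bar>b - c\<bar> \<le> e / (2 * \<bar>b - c\<bar>) * \<bar>b - c\<bar>"
      by (intro mult_right_mono) (auto simp: t_def)
    then have "\<bar>t * (b - c)\<bar> < e" using b t \<open>0 < e\<close> by (simp add: abs_mult)
    moreover have "c + t * (b - c) \<in> ray f"
      using ray_convex[OF f assms(2) b(1), of t] t by (simp add: algebra_simps)
    ultimately show "\<exists>x'\<in>{l. c + l \<in> ray f}. x' \<noteq> 0 \<and> dist x' 0 < e"
      using b t by (intro bexI[of _ "t * (b - c)"]) auto
  qed
qed

text \<open>The two-sided derivatives of \<open>\<psi>\<close> restrict to limits within the ray,
  and these are unique because 0 is a limit point. All \<open>c\<close> in the ray are treated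
  together since the difference quotient at \<open>c\<close> involves neighbouring points.\<close>

lemma gateaux_along_ray:
  assumes f: "f \<in> graphons"
    and \<psi>0: "\<And>l. l \<in> ray f \<Longrightarrow> \<psi> 0 l = F (\<lambda>z. l * f z)"
    and der: "\<And>k t. k < n \<Longrightarrow> (\<psi> k has_real_derivative \<psi> (Suc k) t) (at t)"
  shows "m \<le> n \<Longrightarrow> c \<in> ray f \<Longrightarrow> gateaux_exists F m (\<lambda>_. f) (\<lambda>z. c * f z)
      \<and> gateaux F m (\<lambda>_. f) (\<lambda>z. c * f z) = \<psi> m c"
proof (induction m arbitrary: c)
  case 0
  then show ?case using \<psi>0 by (simp add: ray_def)
next
  case (Suc m)
  let ?A = "{l. c + l \<in> ray f}"
  have shift: "(\<lambda>z. c * f z + l * f z) = (\<lambda>z. (c + l) * f z)" for l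
    by (simp add: algebra_simps)
  have IH: "gateaux_exists F m (\<lambda>_. f) (\<lambda>z. b * f z)"
      "gateaux F m (\<lambda>_. f) (\<lambda>z. b * f z) = \<psi> m b" if "b \<in> ray f" for b
    using Suc.IH[OF _ that] Suc.prems by auto
  have lim: "0 islimpt ?A" by (rule ray_islimpt[OF f Suc.prems(2)])
  have "((\<lambda>l. (\<psi> m (c + l) - \<psi> m c) / l) \<longlongrightarrow> \<psi> (Suc m) c) (at 0)"
    using der[of m c] Suc.prems by (simp add: DERIV_def)
  then have "((\<lambda>l. (\<psi> m (c + l) - \<psi> m c) / l) \<longlongrightarrow> \<psi> (Suc m) c) (at 0 within ?A)"
    by (rule tendsto_within_subset) simp
  moreover have "\<forall>\<^sub>F l in at 0 within ?A. (\<psi> m (c + l) - \<psi> m c) / l =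
      (gateaux F m (\<lambda>_. f) (\<lambda>z. (c + l) * f z) - gateaux F m (\<lambda>_. f) (\<lambda>z. c * f z)) / l"
    using Suc.prems(2) by (auto simp: eventually_at_filter IH)
  ultimately have D: "((\<lambda>l. (gateaux F m (\<lambda>_. f) (\<lambda>z. (c + l) * f z)
      - gateaux F m (\<lambda>_. f) (\<lambda>z. c * f z)) / l) \<longlongrightarrow> \<psi> (Suc m) c) (at 0 within ?A)"
    by (rule Lim_transform_eventually)
  have "\<forall>\<^sub>F l in at 0 within ?A. gateaux_exists F m (\<lambda>_. f) (\<lambda>z. (c + l) * f z)"
    by (auto simp: eventually_at_filter IH)
  moreover have "\<not> trivial_limit (at 0 within ?A)" using lim by (simp add: trivial_limit_within)
  ultimately show ?case
    using D lim IH(1)[OF Suc.prems(2)] tendsto_Lim[OF _ D]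
    by (auto simp: shift admissible_steps_ray)
qed

text \<open>One order beyond the smoothness of the extension. At interior \<open>c\<close> the ray
  contains a neighbourhood of \<open>c\<close>, so the limit assumed to exist is an ordinary
  two-sided derivative.\<close>

lemma gateaux_Suc_ray_derivative:
  assumes f: "f \<in> graphons"
    and \<psi>: "\<And>l. l \<in> ray f \<Longrightarrow> gateaux F n (\<lambda>_. f) (\<lambda>z. l * f z) = \<psi> l"
    and ex: "gateaux_exists F (Suc n) (\<lambda>_. f) (\<lambda>z. c * f z)" and c: "0 < c" "c < 1"
  shows "(\<psi> has_real_derivative gateaux F (Suc n) (\<lambda>_. f) (\<lambda>z. c * f z)) (at c)"
proof -
  let ?A = "{l. c + l \<in> ray f}"
  have shift: "(\<lambda>z. c * f z + l * f z) = (\<lambda>z. (c + l) * f z)" for l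
    by (simp add: algebra_simps)
  have "{-c<..<1-c} \<subseteq> ?A" using ray_unit[OF f] by auto
  then have "0 \<in> interior ?A" using c by (intro interiorI[of "{-c<..<1-c}"]) auto
  then have at: "at 0 within ?A = at 0" by (rule at_within_interior)
  have cr: "c \<in> ray f" using c ray_unit[OF f] by auto
  have ev: "\<forall>\<^sub>F l in at 0. c + l \<in> ray f"
    unfolding at[symmetric] by (auto simp: eventually_at_filter)
  obtain D where D: "((\<lambda>l. (gateaux F n (\<lambda>_. f) (\<lambda>z. (c + l) * f z)
      - gateaux F n (\<lambda>_. f) (\<lambda>z. c * f z)) / l) \<longlongrightarrow> D) (at 0)"
    using ex by (auto simp: shift admissible_steps_ray at)
  then have "gateaux F (Suc n) (\<lambda>_. f) (\<lambda>z. c * f z) = D"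
    by (auto simp: shift admissible_steps_ray at intro!: tendsto_Lim)
  moreover have "((\<lambda>l. (\<psi> (c + l) - \<psi> c) / l) \<longlongrightarrow> D) (at 0)"
    by (rule Lim_transform_eventually[OF D]) (use ev in eventually_elim, simp add: \<psi> cr)
  ultimately show ?thesis by (simp add: DERIV_def)
qed

lemma graphon_in_Adm_zero: "f \<in> graphons \<Longrightarrow> f \<in> Adm (\<lambda>_. 0)"
  using scaled_graphon[of f] unfolding Adm_def
  by (simp, intro conjI exI[of _ 1]) (auto simp: graphons_def)

text \<open>The C^n property is used at the base point 0, where every graphon is an admissible
  direction. The numbers \<open>d\<close> serve all combinations \<open>c\<close> at once, while
  agreement with \<open>F\<close> is claimed only on the ray of a combination that is a
  graphon.\<close>

lemma Cn_along_rays: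
  assumes F: "Cn_function n F" and g: "\<And>i. i < N \<Longrightarrow> g i \<in> graphons"
  shows "\<exists>d. \<forall>c\<in>Rn N. (\<lambda>z. \<Sum>i<N. c i * g i z) \<in> graphons \<longrightarrow>
     (\<exists>\<psi>. (\<forall>l\<in>ray (\<lambda>z. \<Sum>i<N. c i * g i z). \<psi> 0 l = F (\<lambda>z. l * (\<Sum>i<N. c i * g i z)))
       \<and> (\<forall>k<n. \<forall>t. (\<psi> k has_real_derivative \<psi> (Suc k) t) (at t))
       \<and> (\<forall>k\<le>n. continuous_on UNIV (\<psi> k))
       \<and> (\<forall>k\<le>n. \<psi> k 0 = (\<Sum>w\<in>words N k. prod_list (map c w) * d w)))"
proof -
  have "\<forall>i<N. g i \<in> Adm (\<lambda>_. 0)" using g graphon_in_Adm_zero by auto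
  then obtain G where G: "Ck_on_Rn N n G"
    and GF: "\<And>l. l \<in> Rn N \<Longrightarrow> (\<lambda>z. 0 + (\<Sum>i<N. l i * g i z)) \<in> graphons \<Longrightarrow>
                G l = F (\<lambda>z. 0 + (\<Sum>i<N. l i * g i z))"
  proof -
    have "\<exists>G. Ck_on_Rn N n G
           \<and> (\<forall>l\<in>Rn N. (\<lambda>z. 0 + (\<Sum>i<N. l i * g i z)) \<in> graphons \<longrightarrow>
                G l = F (\<lambda>z. 0 + (\<Sum>i<N. l i * g i z)))"
      using F[unfolded Cn_function_def, rule_format, OF zero_graphon, of N g]
        \<open>\<forall>i<N. g i \<in> Adm (\<lambda>_. 0)\<close> by blast
    then show ?thesis using that by blast
  qed
  from Ck_along_rays[OF G] obtain d where d: "\<forall>c\<in>Rn N. \<exists>\<psi>. (\<forall>t. \<psi> 0 t = G (\<lambda>j. t * c j))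
     \<and> (\<forall>k<n. \<forall>t. (\<psi> k has_real_derivative \<psi> (Suc k) t) (at t))
     \<and> (\<forall>k\<le>n. continuous_on UNIV (\<psi> k))
     \<and> (\<forall>k\<le>n. \<psi> k 0 = (\<Sum>w\<in>words N k. prod_list (map c w) * d w))" by blast
  have K: "G (\<lambda>j. l * c j) = F (\<lambda>z. l * (\<Sum>i<N. c i * g i z))"
    if "c \<in> Rn N" "l \<in> ray (\<lambda>z. \<Sum>i<N. c i * g i z)" for c l
    using GF[of "\<lambda>j. l * c j"] that by (auto simp: ray_def Rn_def sum_distrib_left mult.assoc)
  show ?thesis
  proof (intro exI[of _ d] ballI impI)
    fix c assume c: "c \<in> Rn N"
    with d obtain \<psi> where \<psi>: "\<forall>t. \<psi> 0 t = G (\<lambda>j. t * c j)"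
      "\<forall>k<n. \<forall>t. (\<psi> k has_real_derivative \<psi> (Suc k) t) (at t)"
      "\<forall>k\<le>n. continuous_on UNIV (\<psi> k)"
      "\<forall>k\<le>n. \<psi> k 0 = (\<Sum>w\<in>words N k. prod_list (map c w) * d w)" by blast
    show "\<exists>\<psi>. (\<forall>l\<in>ray (\<lambda>z. \<Sum>i<N. c i * g i z). \<psi> 0 l = F (\<lambda>z. l * (\<Sum>i<N. c i * g i z)))
       \<and> (\<forall>k<n. \<forall>t. (\<psi> k has_real_derivative \<psi> (Suc k) t) (at t))
       \<and> (\<forall>k\<le>n. continuous_on UNIV (\<psi> k))
       \<and> (\<forall>k\<le>n. \<psi> k 0 = (\<Sum>w\<in>words N k. prod_list (map c w) * d w))"
      using \<psi> K[OF c] by (intro exI[of _ \<psi>]) auto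
  qed
qed

text \<open>The case of a single direction taken with weight 1.\<close>

lemma ray_extension:
  assumes "Cn_function n F" "f \<in> graphons"
  shows "\<exists>\<psi>. (\<forall>l\<in>ray f. \<psi> 0 l = F (\<lambda>z. l * f z))
       \<and> (\<forall>k<n. \<forall>t. (\<psi> k has_real_derivative \<psi> (Suc k) t) (at t))
       \<and> continuous_on UNIV (\<psi> n)"
proof -
  define c :: "nat \<Rightarrow> real" where "c i = (if i = 0 then 1 else 0)" for i
  have c: "c \<in> Rn 1" and sum: "(\<Sum>i<1. c i * (\<lambda>_. f) i z) = f z" for z
    by (auto simp: Rn_def c_def lessThan_Suc)
  from Cn_along_rays[OF assms(1), of 1 "\<lambda>_. f"] assms(2) obtain d where
    d: "\<forall>c\<in>Rn 1. (\<lambda>z. \<Sum>i<1. c i * (\<lambda>_. f) i z) \<in> graphons \<longrightarrow>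
     (\<exists>\<psi>. (\<forall>l\<in>ray (\<lambda>z. \<Sum>i<1. c i * (\<lambda>_. f) i z). \<psi> 0 l = F (\<lambda>z. l * (\<Sum>i<1. c i * (\<lambda>_. f) i z)))
       \<and> (\<forall>k<n. \<forall>t. (\<psi> k has_real_derivative \<psi> (Suc k) t) (at t))
       \<and> (\<forall>k\<le>n. continuous_on UNIV (\<psi> k))
       \<and> (\<forall>k\<le>n. \<psi> k 0 = (\<Sum>w\<in>words 1 k. prod_list (map c w) * d w)))" by blast
  from bspec[OF d c, unfolded sum] assms(2) show ?thesis by blast
qed

lemma gateaux_exists_at_zero:
  assumes "Cn_function n F" "f \<in> graphons" "m \<le> n"
  shows "gateaux_exists F m (\<lambda>_. f) (\<lambda>_. 0)"
proof -
  obtain \<psi> where "\<forall>l\<in>ray f. \<psi> 0 l = F (\<lambda>z. l * f z)"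
      "\<forall>k<n. \<forall>t. (\<psi> k has_real_derivative \<psi> (Suc k) t) (at t)"
    using ray_extension[OF assms(1,2)] by blast
  moreover have "0 \<in> ray f" using ray_unit[OF assms(2)] by auto
  ultimately show ?thesis using gateaux_along_ray[OF assms(2), of \<psi> F n m 0] assms(3) by simp
qed

text \<open>Any sufficiently differentiable function that agrees with \<open>F\<close> along the ray
  computes the Taylor terms. This allows one and the same \<open>\<psi>\<close> to serve two
  different graphons.\<close>

lemma taylor_term_ray:
  assumes "f \<in> graphons" "\<And>l. l \<in> ray f \<Longrightarrow> \<psi> 0 l = F (\<lambda>z. l * f z)"
    "\<And>k t. k < n \<Longrightarrow> (\<psi> k has_real_derivative \<psi> (Suc k) t) (at t)" "m \<le> n"
  shows "taylor_term F m f = \<psi> m 0 / fact m"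
proof -
  have "0 \<in> ray f" using ray_unit[OF assms(1)] by auto
  then show ?thesis using gateaux_along_ray[of f \<psi> F n m 0] assms by (simp add: taylor_term_def)
qed

text \<open>Taylor-Lagrange for \<open>\<psi>\<close>, whose derivatives up to order
  \<open>n\<close> come from the extension and whose derivative of order \<open>n + 1\<close> comes
  from the existence hypothesis on the open ray.\<close>

lemma taylor_remainder:
  assumes F: "Cn_function n F" and f: "f \<in> graphons"
    and ex: "\<forall>c\<in>{0<..<1}. gateaux_exists F (n + 1) (\<lambda>_. f) (\<lambda>z. c * f z)"
  shows "\<exists>c\<in>{0..1}. gateaux_exists F (n + 1) (\<lambda>_. f) (\<lambda>z. c * f z)
              \<and> F f - taylor_poly F n f
                  = gateaux F (n + 1) (\<lambda>_. f) (\<lambda>z. c * f z) / fact (n + 1)"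
proof -
  obtain \<psi> where \<psi>: "\<And>l. l \<in> ray f \<Longrightarrow> \<psi> 0 l = F (\<lambda>z. l * f z)"
      "\<And>k t. k < n \<Longrightarrow> (\<psi> k has_real_derivative \<psi> (Suc k) t) (at t)"
      "continuous_on UNIV (\<psi> n)"
    using ray_extension[OF F f] by blast
  have "\<exists>c. 0 < c \<and> c < 1 \<and> \<psi> 0 1 - (\<Sum>m\<le>n. \<psi> m 0 / fact m)
      = gateaux F (n + 1) (\<lambda>_. f) (\<lambda>z. c * f z) / fact (n + 1)"
  proof (rule Taylor_Lagrange_unit)
    show "continuous_on {0..1} (\<psi> n)" using \<psi>(3) continuous_on_subset by blast
    fix t :: real assume "0 < t" "t < 1"
    then show "(\<psi> n has_real_derivative gateaux F (n + 1) (\<lambda>_. f) (\<lambda>z. t * f z)) (at t)"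
      using gateaux_Suc_ray_derivative[OF f, of F n "\<psi> n" t] gateaux_along_ray[OF f \<psi>(1,2)] ex
      by auto
  qed (use \<psi> in auto)
  moreover have "\<psi> 0 1 = F f" using \<psi>(1)[OF ray_unit[OF f, THEN subsetD, of 1]] by simp
  moreover have "taylor_poly F n f = (\<Sum>m\<le>n. \<psi> m 0 / fact m)"
    unfolding taylor_poly_def by (intro sum.cong taylor_term_ray[OF f \<psi>(1,2)]) auto
  ultimately show ?thesis using ex by force
qed

section \<open>Homomorphism counts of multigraphs\<close>

lemma polyfun_zero_on_unit:
  fixes a :: "nat \<Rightarrow> real"
  assumes "\<And>t. 0 \<le> t \<Longrightarrow> t \<le> 1 \<Longrightarrow> (\<Sum>i\<le>d. a i * t ^ i) = 0" and "i \<le> d"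
  shows "a i = 0"
proof (rule ccontr)
  assume "a i \<noteq> 0"
  then have "finite {t. (\<Sum>i\<le>d. a i * t ^ i) = 0}"
    using assms(2) polyfun_finite_roots[of a d] by blast
  moreover have "{0..1} \<subseteq> {t. (\<Sum>i\<le>d. a i * t ^ i) = 0}" using assms(1) by auto
  ultimately have "finite {0..1::real}" by (rule rev_finite_subset)
  then show False using infinite_Icc[of "0::real" 1] by simp
qed

text \<open>Induction on the variables: with the others fixed, the sum is a polynomial in the
  variable \<open>s\<close> that vanishes on an interval, so each of its coefficients vanishes, and
  such a coefficient is a sum of the same kind over fewer variables. Values in the unit interval are
  the only ones at hand, since weights must give graphons.\<close>

lemma monomials_independent:
  fixes k :: "'a multiset \<Rightarrow> real"
  assumes "finite S" "finite X" "\<And>\<alpha>. \<alpha> \<in> X \<Longrightarrow> set_mset \<alpha> \<subseteq> S"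
    and "\<And>C. (\<And>e. 0 \<le> C e \<and> C e \<le> 1) \<Longrightarrow> (\<Sum>\<alpha>\<in>X. k \<alpha> * (\<Prod>e\<in>#\<alpha>. C e)) = 0"
    and "\<alpha> \<in> X"
  shows "k \<alpha> = 0"
  using assms
proof (induction S arbitrary: X k \<alpha> rule: finite_induct)
  case empty
  then have "X = {{#}}" "\<alpha> = {#}" by (auto simp: subset_eq)
  then show ?case using empty.prems(3)[of "\<lambda>_. 0"] by simp
next
  case (insert s S)
  define j where "j = count \<alpha> s"
  define r where "r \<beta> = filter_mset (\<lambda>e. e \<noteq> s) \<beta>" for \<beta> :: "'a multiset"
  have split: "\<beta> = r \<beta> + replicate_mset (count \<beta> s) s" for \<beta>
    by (rule multiset_eqI) (auto simp: r_def)
  define Xj where "Xj i = {\<beta> \<in> X. count \<beta> s = i}" for i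
  have inj: "inj_on r (Xj j)" by (rule inj_onI) (metis (mono_tags, lifting) split Xj_def mem_Collect_eq)
  have "k (r \<alpha> + replicate_mset j s) = 0"
  proof (rule insert.IH[where X = "r ` Xj j" and k = "\<lambda>\<beta>. k (\<beta> + replicate_mset j s)"])
    show "finite (r ` Xj j)" using insert.prems(1) by (simp add: Xj_def)
    show "r \<alpha> \<in> r ` Xj j" using insert.prems(4) by (auto simp: Xj_def j_def)
    show "set_mset \<beta> \<subseteq> S" if "\<beta> \<in> r ` Xj j" for \<beta>
      using that insert.prems(2) by (fastforce simp: Xj_def r_def)
    fix C :: "'a \<Rightarrow> real" assume C: "\<And>e. 0 \<le> C e \<and> C e \<le> 1"
    define b where "b i = (\<Sum>\<beta>\<in>Xj i. k \<beta> * (\<Prod>e\<in>#r \<beta>. C e))" for i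
    \<comment> \<open>A bound for the degree in \<open>s\<close>.\<close>
    define d where "d = Max (insert 0 ((\<lambda>\<beta>. count \<beta> s) ` X))"
    have d: "count \<beta> s \<le> d" if "\<beta> \<in> X" for \<beta>
      unfolding d_def using that insert.prems(1) by (intro Max_ge) auto
    have "(\<Sum>i\<le>d. b i * t ^ i) = 0" if t: "0 \<le> t" "t \<le> 1" for t
    proof -
      have prod: "(\<Prod>e\<in>#\<beta>. (C(s := t)) e) = (\<Prod>e\<in>#r \<beta>. C e) * t ^ count \<beta> s" for \<beta>
      proof -
        have "(\<Prod>e\<in>#\<beta>. (C(s := t)) e) = (\<Prod>e\<in>#r \<beta> + replicate_mset (count \<beta> s) s. (C(s := t)) e)"
          using split by metis
        also have "\<dots> = (\<Prod>e\<in>#r \<beta>. (C(s := t)) e) * t ^ count \<beta> s" by simp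
        also have "image_mset (C(s := t)) (r \<beta>) = image_mset C (r \<beta>)"
          by (rule image_mset_cong) (auto simp: r_def)
        finally show ?thesis .
      qed
      have "(\<Sum>i\<le>d. b i * t ^ i) = (\<Sum>i\<le>d. \<Sum>\<beta>\<in>Xj i. k \<beta> * ((\<Prod>e\<in>#r \<beta>. C e) * t ^ count \<beta> s))"
        unfolding b_def sum_distrib_right by (intro sum.cong refl) (auto simp: Xj_def)
      also have "\<dots> = (\<Sum>\<beta>\<in>X. k \<beta> * (\<Prod>e\<in>#\<beta>. (C(s := t)) e))"
        unfolding Xj_def prod by (rule sum.group) (use insert.prems(1) d in auto)
      also have "\<dots> = 0" using C t by (intro insert.prems(3)) auto
      finally show ?thesis .
    qed
    \<comment> \<open>\<open>b j\<close> is the coefficient of the j-th power of \<open>s\<close>;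
      after \<open>s\<close> is stripped off, it is the sum to which the induction hypothesis
      applies.\<close>
    then have "b j = 0"
      by (rule polyfun_zero_on_unit) (use d[OF insert.prems(4)] in \<open>auto simp: j_def\<close>)
    moreover have "(\<Sum>\<beta>\<in>r ` Xj j. k (\<beta> + replicate_mset j s) * (\<Prod>e\<in>#\<beta>. C e)) = b j"
      unfolding b_def sum.reindex[OF inj] using split
      by (intro sum.cong refl) (auto simp: Xj_def split[symmetric])
    ultimately show "(\<Sum>\<beta>\<in>r ` Xj j. k (\<beta> + replicate_mset j s) * (\<Prod>e\<in>#\<beta>. C e)) = 0" by simp
  qed
  then show ?case unfolding j_def split[symmetric] .
qed

text \<open>Take \<open>z\<close> with least \<open>v\<close>: a nonzero off-diagonal entry
  \<open>T z y\<close> would need a smaller value.\<close>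

lemma triangular_minimal:
  fixes T :: "'a \<Rightarrow> 'a \<Rightarrow> real" and v :: "'a \<Rightarrow> nat"
  assumes "finite X" "X \<noteq> {}"
    and "\<And>x y. x \<in> X \<Longrightarrow> y \<in> X \<Longrightarrow> x \<noteq> y \<Longrightarrow> T x y \<noteq> 0 \<Longrightarrow> v y < v x"
  shows "\<exists>z\<in>X. \<forall>y\<in>X - {z}. T z y = 0"
proof -
  obtain z where "z \<in> X" "\<And>y. y \<in> X \<Longrightarrow> v z \<le> v y"
    using assms(1,2) by (metis arg_min_if_finite(1) arg_min_least)
  then show ?thesis using assms(3) by (metis Diff_iff insertI1 leD)
qed

text \<open>The unknown at a minimal \<open>z\<close> enters only the equation at \<open>z\<close>.
  Solve the others without it, then use it to satisfy that last equation.\<close>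

lemma triangular_solvable:
  fixes T :: "'a \<Rightarrow> 'a \<Rightarrow> real" and v :: "'a \<Rightarrow> nat"
  assumes "finite X" "\<And>x. x \<in> X \<Longrightarrow> T x x \<noteq> 0"
    and "\<And>x y. x \<in> X \<Longrightarrow> y \<in> X \<Longrightarrow> x \<noteq> y \<Longrightarrow> T x y \<noteq> 0 \<Longrightarrow> v y < v x"
  shows "\<exists>a. \<forall>y\<in>X. (\<Sum>x\<in>X. a x * T x y) = q y"
  using assms
proof (induction X rule: finite_psubset_induct)
  case (psubset X)
  show ?case
  proof (cases "X = {}")
    case False
    from triangular_minimal[of X T v, OF psubset.hyps(1) False psubset.prems(2)]
    obtain z where z: "z \<in> X" "\<And>y. y \<in> X - {z} \<Longrightarrow> T z y = 0" by auto
    have "\<exists>a. \<forall>y\<in>X - {z}. (\<Sum>x\<in>X - {z}. a x * T x y) = q y"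
      by (rule psubset.IH) (use psubset.prems z(1) in auto)
    then obtain a where a: "\<forall>y\<in>X - {z}. (\<Sum>x\<in>X - {z}. a x * T x y) = q y" by blast
    \<comment> \<open>The value forced by the equation at \<open>z\<close>; the diagonal entry is
      nonzero.\<close>
    define c where "c = (q z - (\<Sum>x\<in>X - {z}. a x * T x z)) / T z z"
    have "(\<Sum>x\<in>X. (a(z := c)) x * T x y) = c * T z y + (\<Sum>x\<in>X - {z}. a x * T x y)" for y
      using psubset.hyps z(1) by (simp add: sum.remove[of X z])
    moreover have "c * T z z + (\<Sum>x\<in>X - {z}. a x * T x z) = q z"
      using psubset.prems(1)[OF z(1)] by (simp add: c_def)
    moreover have "c * T z y + (\<Sum>x\<in>X - {z}. a x * T x y) = q y" if "y \<in> X" "y \<noteq> z" for y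
      using a z(2)[of y] that by simp
    ultimately have "\<forall>y\<in>X. (\<Sum>x\<in>X. (a(z := c)) x * T x y) = q y" by metis
    then show ?thesis by blast
  qed auto
qed

text \<open>The equations other than the one at a minimal \<open>z\<close> do not see
  \<open>z\<close>, so the other unknowns vanish by induction; the equation at \<open>z\<close> then
  leaves only its diagonal term.\<close>

lemma triangular_injective:
  fixes T :: "'a \<Rightarrow> 'a \<Rightarrow> real" and v :: "'a \<Rightarrow> nat"
  assumes "finite X" "\<And>x. x \<in> X \<Longrightarrow> T x x \<noteq> 0"
    and "\<And>x y. x \<in> X \<Longrightarrow> y \<in> X \<Longrightarrow> x \<noteq> y \<Longrightarrow> T x y \<noteq> 0 \<Longrightarrow> v y < v x"
    and "\<And>y. y \<in> X \<Longrightarrow> (\<Sum>x\<in>X. a x * T x y) = 0" and "x \<in> X"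
  shows "a x = 0"
  using assms
proof (induction X arbitrary: x rule: finite_psubset_induct)
  case (psubset X)
  have "X \<noteq> {}" using psubset.prems(4) by auto
  from triangular_minimal[of X T v, OF psubset.hyps(1) this psubset.prems(2)]
  obtain z where z: "z \<in> X" "\<And>y. y \<in> X - {z} \<Longrightarrow> T z y = 0" by auto
  have sum: "(\<Sum>x\<in>X. a x * T x y) = a z * T z y + (\<Sum>x\<in>X - {z}. a x * T x y)" for y
    using psubset.hyps z(1) by (simp add: sum.remove[of X z])
  have zero: "a y = 0" if y: "y \<in> X - {z}" for y
  proof (rule psubset.IH[of "X - {z}"])
    show "(\<Sum>x\<in>X - {z}. a x * T x y) = 0" if "y \<in> X - {z}" for y
      using psubset.prems(3)[of y] sum[of y] z(2) that by simp
  qed (use psubset.prems z y in auto)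
  then have "a z * T z z = 0" using psubset.prems(3)[OF z(1)] sum[of z] by simp
  then show ?case using zero psubset.prems(1,4) z(1) by (cases "x = z") auto
qed

lemma bij_betw_extend_permutation:
  assumes "finite B" "A \<subseteq> B" "A' \<subseteq> B" "bij_betw f A A'"
  shows "\<exists>g. bij_betw g B B \<and> (\<forall>x\<in>A. g x = f x)"
proof -
  have fin: "finite A" "finite A'" using assms finite_subset by blast+
  have "card (B - A) = card (B - A')"
    using assms fin by (simp add: card_Diff_subset bij_betw_same_card)
  then obtain h where h: "bij_betw h (B - A) (B - A')"
    using finite_same_card_bij[of "B - A" "B - A'"] assms(1) by auto
  define g where "g x = (if x \<in> A then f x else h x)" for x
  have "bij_betw g A A'" "bij_betw g (B - A) (B - A')"
    using assms(4) h bij_betw_cong[of A g f A'] bij_betw_cong[of "B - A" g h "B - A'"]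
    by (auto simp: g_def)
  from bij_betw_combine[OF this] have "bij_betw g (A \<union> (B - A)) (A' \<union> (B - A'))" by auto
  moreover have "A \<union> (B - A) = B" "A' \<union> (B - A') = B" using assms by auto
  ultimately show ?thesis by (intro exI[of _ g]) (auto simp: g_def)
qed

section \<open>Multigraphs, isomorphism classes and edge multisets on numbered blocks\<close>

definition graphs_with :: "nat \<Rightarrow> multigraph set" where
  "graphs_with m = {(V, E) \<in> multigraphs. size E = m \<and> (\<forall>v\<in>V. \<exists>e\<in>#E. v \<in> e)}"

definition edges :: "nat \<Rightarrow> nat set set" where
  "edges p = {e. e \<subseteq> {1..p} \<and> card e = 2}"

definition edge_multisets :: "nat \<Rightarrow> nat \<Rightarrow> nat set multiset set" where
  "edge_multisets p m = {\<alpha>. size \<alpha> = m \<and> (\<forall>e\<in>#\<alpha>. e \<subseteq> {1..p} \<and> card e = 2)}"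

text \<open>The vertices are the covered ones only, so no vertex is isolated.\<close>

definition graph_of :: "nat set multiset \<Rightarrow> multigraph" where
  "graph_of \<alpha> = (\<Union>(set_mset \<alpha>), \<alpha>)"

text \<open>The map may fail to be injective: vertices can merge, and a collapsed edge becomes a
  singleton, which no edge multiset contains.\<close>

definition push :: "(nat \<Rightarrow> nat) \<Rightarrow> nat set multiset \<Rightarrow> nat set multiset" where
  "push \<phi> E = image_mset (\<lambda>e. \<phi> ` e) E"

text \<open>Extensional maps, so that a map is counted by its values on the vertices alone and the
  set is finite.\<close>

definition hom_count :: "nat \<Rightarrow> multigraph \<Rightarrow> nat set multiset \<Rightarrow> nat" where
  "hom_count p G \<alpha> = card {\<phi> \<in> fst G \<rightarrow>\<^sub>E {1..p}. push \<phi> (snd G) = \<alpha>}"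

lemma finite_edges: "finite (edges p)"
  unfolding edges_def by (rule finite_subset[of _ "Pow {1..p}"]) auto

lemma finite_edge_multisets: "finite (edge_multisets p m)"
proof (rule finite_subset)
  let ?S = "{e. e \<subseteq> {1..p} \<and> card e = (2::nat)}"
  show "finite (mset ` {xs. set xs \<subseteq> ?S \<and> length xs = m})"
    by (intro finite_imageI finite_lists_length_eq finite_edges[unfolded edges_def])
  show "edge_multisets p m \<subseteq> mset ` {xs. set xs \<subseteq> ?S \<and> length xs = m}"
  proof
    fix \<alpha> assume "\<alpha> \<in> edge_multisets p m"
    moreover obtain xs where "mset xs = \<alpha>" using ex_mset by blast
    ultimately show "\<alpha> \<in> mset ` {xs. set xs \<subseteq> ?S \<and> length xs = m}"
      by (auto simp: edge_multisets_def intro!: image_eqI[of _ _ xs])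
  qed
qed

lemma push_cong: "(\<And>v. v \<in> \<Union>(set_mset E) \<Longrightarrow> \<phi> v = \<phi>' v) \<Longrightarrow> push \<phi> E = push \<phi>' E"
  unfolding push_def by (rule image_mset_cong) (auto intro!: image_cong)

lemma push_push: "push \<psi> (push \<phi> E) = push (\<psi> \<circ> \<phi>) E"
  by (simp add: push_def image_mset.compositionality comp_def image_image)

lemma push_id: "(\<And>v. v \<in> \<Union>(set_mset E) \<Longrightarrow> \<phi> v = v) \<Longrightarrow> push \<phi> E = E"
  using push_cong[of E \<phi> id] by (simp add: push_def)

lemma Union_push: "\<Union>(set_mset (push \<phi> E)) = \<phi> ` \<Union>(set_mset E)"
  by (auto simp: push_def)

lemma graphs_with_Union: "(V, E) \<in> graphs_with m \<Longrightarrow> V = \<Union>(set_mset E)"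
  by (auto simp: graphs_with_def multigraphs_def)

lemma multigraphs_Union: "(V, E) \<in> multigraphs \<Longrightarrow> \<Union>(set_mset E) \<subseteq> V"
  by (auto simp: multigraphs_def)

lemma multigraph_iso_iff:
  "((V, E), (V', E')) \<in> multigraph_iso \<longleftrightarrow> (V, E) \<in> multigraphs \<and> (V', E') \<in> multigraphs
     \<and> (\<exists>\<phi>. bij_betw \<phi> V V' \<and> E' = push \<phi> E)"
  by (simp add: multigraph_iso_def push_def)

lemma equiv_multigraph_iso: "equiv multigraphs multigraph_iso"
proof (rule equivI)
  show "multigraph_iso \<subseteq> multigraphs \<times> multigraphs" unfolding multigraph_iso_def by blast
  show "refl_on multigraphs multigraph_iso"
  proof (rule refl_onI)
    fix G assume "G \<in> multigraphs"
    then show "(G, G) \<in> multigraph_iso"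
      by (cases G) (auto simp: multigraph_iso_iff push_id intro!: exI[of _ id])
  qed
  show "sym multigraph_iso"
  proof (rule symI)
    fix G G' assume "(G, G') \<in> multigraph_iso"
    then obtain V E V' E' \<phi> where G: "G = (V, E)" "G' = (V', E')" "(V, E) \<in> multigraphs"
      "(V', E') \<in> multigraphs" "bij_betw \<phi> V V'" "E' = push \<phi> E"
      by (cases G; cases G') (auto simp: multigraph_iso_iff)
    have "push (inv_into V \<phi>) E' = E"
      using G multigraphs_Union[OF G(3)] unfolding G(6) push_push
      by (intro push_id) (auto simp: bij_betw_def intro!: inv_into_f_f)
    then show "(G', G) \<in> multigraph_iso"
      using G bij_betw_inv_into by (auto simp: multigraph_iso_iff intro!: exI[of _ "inv_into V \<phi>"])
  qed
  show "trans multigraph_iso"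
  proof (rule transI)
    fix G1 G2 G3 assume "(G1, G2) \<in> multigraph_iso" "(G2, G3) \<in> multigraph_iso"
    then show "(G1, G3) \<in> multigraph_iso"
      by (cases G1; cases G2; cases G3)
         (fastforce simp: multigraph_iso_iff push_push intro: bij_betw_trans)
  qed
qed

lemma graphs_with_subset: "graphs_with m \<subseteq> multigraphs"
  by (auto simp: graphs_with_def)

lemma iso_classes_eq: "iso_classes m = graphs_with m // multigraph_iso"
  by (simp add: iso_classes_def graphs_with_def)

lemma graphs_with_iso:
  assumes "(G, G') \<in> multigraph_iso" "G \<in> graphs_with m"
  shows "G' \<in> graphs_with m"
proof -
  obtain V E V' E' \<phi> where G: "G = (V, E)" "G' = (V', E')" "(V', E') \<in> multigraphs"
      "bij_betw \<phi> V V'" "E' = push \<phi> E"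
    using assms(1) by (cases G; cases G') (auto simp: multigraph_iso_iff)
  have "V' = \<Union>(set_mset E')" unfolding G(5) Union_push
    using graphs_with_Union[of V E m] assms(2) G(1,4) by (simp add: bij_betw_def)
  then show ?thesis using G assms(2) by (auto simp: graphs_with_def push_def)
qed

text \<open>The same choice as in \<open>hom_density\<close>, so that statements about
  \<open>rep H\<close> apply to the density of the class.\<close>

definition rep :: "multigraph set \<Rightarrow> multigraph" where
  "rep H = (SOME G. G \<in> H)"

lemma rep_iso_class:
  assumes "H \<in> iso_classes m"
  shows "rep H \<in> graphs_with m" "H = multigraph_iso `` {rep H}"
proof -
  obtain G where G: "G \<in> graphs_with m" "H = multigraph_iso `` {G}"
    using assms unfolding iso_classes_eq by (auto elim: quotientE)
  then have "G \<in> H" using equiv_multigraph_iso graphs_with_subset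
    by (meson equiv_class_self subsetD)
  then have "rep H \<in> H" unfolding rep_def by (rule someI)
  then have iso: "(G, rep H) \<in> multigraph_iso" using G by auto
  show "rep H \<in> graphs_with m" using graphs_with_iso[OF iso G(1)] .
  show "H = multigraph_iso `` {rep H}"
    using G(2) equiv_class_eq[OF equiv_multigraph_iso iso] by simp
qed

lemma hom_density_eq_rep: "hom_density H f = hom_density_rep (rep H) f"
  by (simp add: hom_density_def rep_def)

lemma graph_of_graphs_with: "\<alpha> \<in> edge_multisets p m \<Longrightarrow> graph_of \<alpha> \<in> graphs_with m"
  by (auto simp: graph_of_def graphs_with_def multigraphs_def edge_multisets_def
           intro: finite_subset)

lemma graph_of_multigraph: "\<alpha> \<in> edge_multisets p m \<Longrightarrow> graph_of \<alpha> \<in> multigraphs"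
  using graph_of_graphs_with graphs_with_subset by blast

lemma card_Union_edges:
  "(\<And>e. e \<in># E \<Longrightarrow> card e = 2) \<Longrightarrow> card (\<Union>(set_mset E)) \<le> 2 * size (E :: 'a set multiset)"
proof (induction E)
  case (add e E)
  have "card (e \<union> \<Union>(set_mset E)) \<le> card e + card (\<Union>(set_mset E))" by (rule card_Un_le)
  then show ?case using add by fastforce
qed simp

text \<open>Without isolated vertices, m edges cover at most \<open>2 * m\<close> vertices, which
  therefore fit injectively into the blocks.\<close>

lemma graphs_with_embed:
  assumes "G \<in> graphs_with m" "2 * m \<le> p"
  shows "\<exists>\<alpha>\<in>edge_multisets p m. (G, graph_of \<alpha>) \<in> multigraph_iso"
proof -
  obtain V E where G: "G = (V, E)" by fastforce
  have fin: "finite V" and edges: "\<And>e. e \<in># E \<Longrightarrow> card e = 2 \<and> e \<subseteq> V"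
    and size: "size E = m" and mg: "(V, E) \<in> multigraphs"
    using assms(1) by (auto simp: G graphs_with_def multigraphs_def)
  have V: "V = \<Union>(set_mset E)" using graphs_with_Union assms(1) G by blast
  have "card V \<le> card {1..p}" using card_Union_edges[of E] edges size assms(2) V by fastforce
  then obtain \<iota> where \<iota>: "inj_on \<iota> V" "\<iota> ` V \<subseteq> {1..p}"
    using card_le_inj[OF fin, of "{1..p}"] by auto
  have "push \<iota> E \<in> edge_multisets p m"
    using \<iota> edges size by (fastforce simp: edge_multisets_def push_def card_image inj_on_subset)
  moreover from this have "(G, graph_of (push \<iota> E)) \<in> multigraph_iso"
    using graph_of_multigraph[of "push \<iota> E"] mg \<iota>(1) V
    by (auto simp: G graph_of_def multigraph_iso_iff Union_push bij_betw_def)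
  ultimately show ?thesis by blast
qed

lemma finite_iso_classes: "finite (iso_classes m)"
proof (rule finite_surj[OF finite_edge_multisets])
  show "iso_classes m \<subseteq> (\<lambda>\<alpha>. multigraph_iso `` {graph_of \<alpha>}) ` edge_multisets (2 * m) m"
  proof
    fix H assume H: "H \<in> iso_classes m"
    from graphs_with_embed[OF rep_iso_class(1)[OF this], of "2 * m"]
    obtain \<alpha> where "\<alpha> \<in> edge_multisets (2 * m) m" "(rep H, graph_of \<alpha>) \<in> multigraph_iso" by auto
    then show "H \<in> (\<lambda>\<alpha>. multigraph_iso `` {graph_of \<alpha>}) ` edge_multisets (2 * m) m"
      using rep_iso_class(2)[OF H] equiv_class_eq[OF equiv_multigraph_iso] by blast
  qed
qed

section \<open>Counting vertex maps and the triangular expansion\<close>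

lemma finite_maps: "G \<in> graphs_with m \<Longrightarrow> finite (fst G \<rightarrow>\<^sub>E {1..p::nat})"
  by (auto simp: graphs_with_def multigraphs_def intro!: finite_PiE)

text \<open>A map carrying the edges onto \<alpha> carries the vertices onto those of \<alpha>. It
  is an isomorphism if injective and loses vertices otherwise.\<close>

lemma hom_count_nonzero:
  assumes G: "G \<in> graphs_with m" and \<alpha>: "\<alpha> \<in> edge_multisets p m" and nz: "hom_count p G \<alpha> \<noteq> 0"
  shows "(G, graph_of \<alpha>) \<in> multigraph_iso \<or> card (fst (graph_of \<alpha>)) < card (fst G)"
proof -
  obtain V E where VE: "G = (V, E)" by fastforce
  have fin: "finite V" and mg: "(V, E) \<in> multigraphs"
    using G by (auto simp: VE graphs_with_def multigraphs_def)
  have V: "V = \<Union>(set_mset E)" using graphs_with_Union G VE by blast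
  obtain \<phi> where \<phi>: "push \<phi> E = \<alpha>"
    using nz unfolding hom_count_def by (metis (mono_tags, lifting) VE card.empty empty_Collect_eq snd_conv)
  have im: "\<Union>(set_mset \<alpha>) = \<phi> ` V" using \<phi> V Union_push by metis
  show ?thesis
  proof (cases "inj_on \<phi> V")
    case True
    then show ?thesis using \<phi> im mg graph_of_multigraph[OF \<alpha>]
      by (auto simp: VE graph_of_def multigraph_iso_iff bij_betw_def)
  next
    case False
    then have "card (\<phi> ` V) < card V"
      using fin by (metis card_image_le eq_card_imp_inj_on le_neq_implies_less)
    then show ?thesis by (simp add: VE graph_of_def im)
  qed
qed

lemma hom_count_pos:
  assumes G: "G \<in> graphs_with m" and \<alpha>: "\<alpha> \<in> edge_multisets p m"
    and iso: "(G, graph_of \<alpha>) \<in> multigraph_iso"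
  shows "hom_count p G \<alpha> > 0"
proof -
  obtain V E where VE: "G = (V, E)" by fastforce
  have V: "V = \<Union>(set_mset E)" using graphs_with_Union G VE by blast
  obtain \<phi> where \<phi>: "bij_betw \<phi> V (\<Union>(set_mset \<alpha>))" "\<alpha> = push \<phi> E"
    using iso by (auto simp: VE graph_of_def multigraph_iso_iff)
  have "\<Union>(set_mset \<alpha>) \<subseteq> {1..p}" using \<alpha> by (auto simp: edge_multisets_def)
  then have "restrict \<phi> V \<in> V \<rightarrow>\<^sub>E {1..p}" unfolding restrict_PiE_iff using bij_betwE[OF \<phi>(1)] by blast
  moreover have "push (restrict \<phi> V) E = \<alpha>" unfolding \<phi>(2) by (rule push_cong) (simp add: V)
  ultimately have "restrict \<phi> V \<in> {\<phi> \<in> fst G \<rightarrow>\<^sub>E {1..p}. push \<phi> (snd G) = \<alpha>}" by (simp add: VE)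
  then show ?thesis unfolding hom_count_def using finite_maps[OF G] by (subst card_gt_0_iff) auto
qed

text \<open>An isomorphism concerns covered vertices only; extended to a permutation of all blocks,
  it becomes something under which Taylor coefficients are known to be invariant.\<close>

lemma edge_multisets_iso_permutation:
  assumes \<alpha>: "\<alpha> \<in> edge_multisets p m" and \<beta>: "\<beta> \<in> edge_multisets p m"
    and iso: "(graph_of \<alpha>, graph_of \<beta>) \<in> multigraph_iso"
  shows "\<exists>\<pi>. bij_betw \<pi> {1..p} {1..p} \<and> \<beta> = push \<pi> \<alpha>"
proof -
  obtain \<phi> where \<phi>: "bij_betw \<phi> (\<Union>(set_mset \<alpha>)) (\<Union>(set_mset \<beta>))" "\<beta> = push \<phi> \<alpha>"
    using iso by (auto simp: graph_of_def multigraph_iso_iff)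
  have "\<Union>(set_mset \<alpha>) \<subseteq> {1..p}" "\<Union>(set_mset \<beta>) \<subseteq> {1..p}"
    using \<alpha> \<beta> by (auto simp: edge_multisets_def)
  from bij_betw_extend_permutation[OF _ this \<phi>(1)] obtain \<pi> where
    "bij_betw \<pi> {1..p} {1..p}" "\<forall>x\<in>\<Union>(set_mset \<alpha>). \<pi> x = \<phi> x" by auto
  moreover from this(2) have "push \<pi> \<alpha> = push \<phi> \<alpha>" by (intro push_cong) auto
  ultimately show ?thesis using \<phi>(2) by auto
qed

lemma push_edge_multisets:
  assumes "\<alpha> \<in> edge_multisets p m" "bij_betw \<pi> {1..p} {1..p}"
  shows "push \<pi> \<alpha> \<in> edge_multisets p m"
proof -
  have "\<pi> ` e \<subseteq> {1..p} \<and> card (\<pi> ` e) = 2" if "e \<in># \<alpha>" for e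
  proof -
    have "e \<subseteq> {1..p}" "card e = 2" using assms(1) that by (auto simp: edge_multisets_def)
    then show ?thesis using assms(2)
      by (metis bij_betw_def card_image image_mono inj_on_subset)
  qed
  then show ?thesis using assms(1) by (auto simp: edge_multisets_def push_def)
qed

lemma push_inv:
  assumes "\<alpha> \<in> edge_multisets p m" "bij_betw \<pi> {1..p} {1..p}"
  shows "push (inv_into {1..p} \<pi>) (push \<pi> \<alpha>) = \<alpha>" "push \<pi> (push (inv_into {1..p} \<pi>) \<alpha>) = \<alpha>"
  unfolding push_push using assms
  by (auto intro!: push_id simp: edge_multisets_def bij_betw_inv_into_left bij_betw_inv_into_right
        subset_eq)

lemma hom_count_push:
  assumes G: "G \<in> graphs_with m" and \<alpha>: "\<alpha> \<in> edge_multisets p m"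
    and \<pi>: "bij_betw \<pi> {1..p} {1..p}"
  shows "hom_count p G (push \<pi> \<alpha>) = hom_count p G \<alpha>"
proof -
  obtain V E where VE: "G = (V, E)" by fastforce
  have V: "V = \<Union>(set_mset E)" using graphs_with_Union G VE by blast
  \<comment> \<open>Composition with a permutation is injective on vertex maps. The inequality is
    proved for every permutation because its instance at the inverse is the reverse
    inequality.\<close>
  have le: "hom_count p G \<beta> \<le> hom_count p G (push \<rho> \<beta>)"
    if \<beta>: "\<beta> \<in> edge_multisets p m" and \<rho>: "bij_betw \<rho> {1..p} {1..p}" for \<beta> \<rho>
    unfolding hom_count_def
  proof (rule card_inj_on_le)
    let ?A = "{\<phi> \<in> fst G \<rightarrow>\<^sub>E {1..p}. push \<phi> (snd G) = \<beta>}"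
    let ?B = "{\<phi> \<in> fst G \<rightarrow>\<^sub>E {1..p}. push \<phi> (snd G) = push \<rho> \<beta>}"
    let ?h = "\<lambda>\<phi>. restrict (\<rho> \<circ> \<phi>) V"
    show "finite ?B" using finite_maps[OF G] by auto
    show "inj_on ?h ?A"
    proof (rule inj_onI)
      fix \<phi> \<psi> assume A: "\<phi> \<in> ?A" "\<psi> \<in> ?A" and eq: "?h \<phi> = ?h \<psi>"
      show "\<phi> = \<psi>"
      proof (rule PiE_ext)
        show "\<phi> \<in> V \<rightarrow>\<^sub>E {1..p}" "\<psi> \<in> V \<rightarrow>\<^sub>E {1..p}" using A by (auto simp: VE)
        fix v assume v: "v \<in> V"
        then have "\<rho> (\<phi> v) = \<rho> (\<psi> v)" using fun_cong[OF eq, of v] by simp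
        moreover have "\<phi> v \<in> {1..p}" "\<psi> v \<in> {1..p}" using A v by (auto simp: VE)
        ultimately show "\<phi> v = \<psi> v" using \<rho> by (metis bij_betw_def inj_on_def)
      qed
    qed
    show "?h ` ?A \<subseteq> ?B"
    proof
      fix \<psi> assume "\<psi> \<in> ?h ` ?A"
      then obtain \<phi> where \<phi>: "\<phi> \<in> V \<rightarrow>\<^sub>E {1..p}" "push \<phi> E = \<beta>" "\<psi> = ?h \<phi>" by (auto simp: VE)
      have "\<psi> \<in> V \<rightarrow>\<^sub>E {1..p}" unfolding \<phi>(3)
      proof (rule restrict_PiE_iff[THEN iffD2], rule ballI)
        fix v assume "v \<in> V"
        then have "\<phi> v \<in> {1..p}" using \<phi>(1) by auto
        then show "(\<rho> \<circ> \<phi>) v \<in> {1..p}" using \<rho> by (auto simp: bij_betw_def)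
      qed
      moreover have "push \<psi> E = push \<rho> \<beta>" unfolding \<phi>(2)[symmetric] push_push
        by (rule push_cong) (simp add: \<phi>(3) V)
      ultimately show "\<psi> \<in> ?B" by (simp add: VE)
    qed
  qed
  show ?thesis
  proof (rule antisym)
    show "hom_count p G \<alpha> \<le> hom_count p G (push \<pi> \<alpha>)" by (rule le[OF \<alpha> \<pi>])
    show "hom_count p G (push \<pi> \<alpha>) \<le> hom_count p G \<alpha>"
      using le[OF push_edge_multisets[OF \<alpha> \<pi>] bij_betw_inv_into[OF \<pi>]] push_inv(1)[OF \<alpha> \<pi>] by simp
  qed
qed

lemma class_representatives:
  assumes "2 * m \<le> p"
  obtains \<alpha> where "\<And>H. H \<in> iso_classes m \<Longrightarrow> \<alpha> H \<in> edge_multisets p m"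
    "\<And>H. H \<in> iso_classes m \<Longrightarrow> (rep H, graph_of (\<alpha> H)) \<in> multigraph_iso"
  using graphs_with_embed[OF rep_iso_class(1) assms] by metis

text \<open>For distinct classes the isomorphic alternative in \<open>hom_count_nonzero\<close> is
  excluded, which leaves the drop in the number of vertices.\<close>

lemma hom_count_triangular:
  assumes \<alpha>: "\<And>H. H \<in> iso_classes m \<Longrightarrow> \<alpha> H \<in> edge_multisets p m"
    "\<And>H. H \<in> iso_classes m \<Longrightarrow> (rep H, graph_of (\<alpha> H)) \<in> multigraph_iso"
    and H: "H \<in> iso_classes m" "H' \<in> iso_classes m" "H \<noteq> H'"
    and nz: "hom_count p (rep H) (\<alpha> H') \<noteq> 0"
  shows "card (fst (rep H')) < card (fst (rep H))"
proof -
  have sym: "sym multigraph_iso" and tr: "trans multigraph_iso"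
    using equiv_multigraph_iso by (auto simp: equiv_def)
  have "(rep H, graph_of (\<alpha> H')) \<notin> multigraph_iso"
  proof
    assume "(rep H, graph_of (\<alpha> H')) \<in> multigraph_iso"
    then have "(rep H, rep H') \<in> multigraph_iso"
      using \<alpha>(2)[OF H(2)] sym tr by (meson symD transD)
    then have "H = H'"
      using rep_iso_class(2)[OF H(1)] rep_iso_class(2)[OF H(2)] equiv_class_eq[OF equiv_multigraph_iso]
      by metis
    then show False using H(3) by simp
  qed
  then have "card (fst (graph_of (\<alpha> H'))) < card (fst (rep H))"
    using hom_count_nonzero[OF rep_iso_class(1)[OF H(1)] \<alpha>(1)[OF H(2)] nz] by blast
  moreover have "card (fst (rep H')) = card (fst (graph_of (\<alpha> H')))"
    using \<alpha>(2)[OF H(2)] by (cases "rep H'") (auto simp: graph_of_def multigraph_iso_iff bij_betw_same_card)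
  ultimately show ?thesis by simp
qed

text \<open>The triangular system has one equation per class, at a chosen edge multiset. Both sides
  are invariant under permutations of the blocks, so the equation spreads to every edge multiset.
  The factor \<open>w\<close> will be the power of \<open>1 / p\<close> from the measures of the
  blocks.\<close>

lemma invariant_coefficients_expand:
  fixes q :: "nat set multiset \<Rightarrow> real"
  assumes p: "2 * m \<le> p" and w: "\<And>H. H \<in> iso_classes m \<Longrightarrow> w H \<noteq> 0"
    and q: "\<And>\<pi> \<alpha>. bij_betw \<pi> {1..p} {1..p} \<Longrightarrow> \<alpha> \<in> edge_multisets p m \<Longrightarrow> q (push \<pi> \<alpha>) = q \<alpha>"
  shows "\<exists>a. \<forall>\<alpha>\<in>edge_multisets p m. (\<Sum>H\<in>iso_classes m. a H * (w H * real (hom_count p (rep H) \<alpha>))) = q \<alpha>"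
proof -
  obtain \<alpha> where \<alpha>: "\<And>H. H \<in> iso_classes m \<Longrightarrow> \<alpha> H \<in> edge_multisets p m"
    "\<And>H. H \<in> iso_classes m \<Longrightarrow> (rep H, graph_of (\<alpha> H)) \<in> multigraph_iso"
    using class_representatives[OF p] by blast
  have "\<exists>a. \<forall>K\<in>iso_classes m. (\<Sum>H\<in>iso_classes m. a H * (w H * real (hom_count p (rep H) (\<alpha> K)))) = q (\<alpha> K)"
  proof (rule triangular_solvable[where v = "\<lambda>H. card (fst (rep H))"])
    show "w H * real (hom_count p (rep H) (\<alpha> H)) \<noteq> 0" if "H \<in> iso_classes m" for H
      using hom_count_pos[OF rep_iso_class(1) \<alpha>(1) \<alpha>(2)] w that by force
  qed (use hom_count_triangular[OF \<alpha>] in \<open>auto simp: finite_iso_classes\<close>)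
  then obtain a where a: "\<And>K. K \<in> iso_classes m \<Longrightarrow>
      (\<Sum>H\<in>iso_classes m. a H * (w H * real (hom_count p (rep H) (\<alpha> K)))) = q (\<alpha> K)" by blast
  show ?thesis
  proof (intro exI ballI)
    fix \<beta> assume \<beta>: "\<beta> \<in> edge_multisets p m"
    \<comment> \<open>The class of an arbitrary edge multiset; it is moved to the representative of
      its class by a permutation.\<close>
    define K where "K = multigraph_iso `` {graph_of \<beta>}"
    have K: "K \<in> iso_classes m"
      unfolding iso_classes_eq K_def by (intro quotientI graph_of_graphs_with[OF \<beta>])
    have "graph_of \<beta> \<in> K" unfolding K_def
      using equiv_multigraph_iso graph_of_graphs_with[OF \<beta>] graphs_with_subset
      by (meson equiv_class_self subsetD)
    then have "(rep K, graph_of \<beta>) \<in> multigraph_iso" using rep_iso_class(2)[OF K] by blast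
    then have "(graph_of (\<alpha> K), graph_of \<beta>) \<in> multigraph_iso"
      using \<alpha>(2)[OF K] equiv_multigraph_iso unfolding equiv_def by (meson symD transD)
    from edge_multisets_iso_permutation[OF \<alpha>(1)[OF K] \<beta> this] obtain \<pi> where
      \<pi>: "bij_betw \<pi> {1..p} {1..p}" "\<beta> = push \<pi> (\<alpha> K)" by blast
    show "(\<Sum>H\<in>iso_classes m. a H * (w H * real (hom_count p (rep H) \<beta>))) = q \<beta>"
      unfolding \<pi>(2) q[OF \<pi>(1) \<alpha>(1)[OF K]] a[OF K, symmetric]
      by (intro sum.cong refl) (simp add: hom_count_push[OF rep_iso_class(1) \<alpha>(1)[OF K] \<pi>(1)])
  qed
qed

lemma hom_counts_independent:
  assumes p: "2 * m \<le> p" and w: "\<And>H. H \<in> iso_classes m \<Longrightarrow> w H \<noteq> (0::real)"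
    and zero: "\<And>\<alpha>. \<alpha> \<in> edge_multisets p m \<Longrightarrow>
      (\<Sum>H\<in>iso_classes m. a H * (w H * real (hom_count p (rep H) \<alpha>))) = 0"
    and H: "H \<in> iso_classes m"
  shows "a H = 0"
proof -
  obtain \<alpha> where \<alpha>: "\<And>H. H \<in> iso_classes m \<Longrightarrow> \<alpha> H \<in> edge_multisets p m"
    "\<And>H. H \<in> iso_classes m \<Longrightarrow> (rep H, graph_of (\<alpha> H)) \<in> multigraph_iso"
    using class_representatives[OF p] by blast
  show ?thesis
  proof (rule triangular_injective[where v = "\<lambda>H. card (fst (rep H))" and X = "iso_classes m"
          and T = "\<lambda>H K. w H * real (hom_count p (rep H) (\<alpha> K))"])
    show "w H * real (hom_count p (rep H) (\<alpha> H)) \<noteq> 0" if "H \<in> iso_classes m" for H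
      using hom_count_pos[OF rep_iso_class(1) \<alpha>(1) \<alpha>(2)] w that by force
  qed (use hom_count_triangular[OF \<alpha>] zero \<alpha> H in \<open>auto simp: finite_iso_classes\<close>)
qed

text \<open>Group the maps by the image of the edge multiset. A map that collapses an edge has a
  vanishing factor by the condition on singletons.\<close>

lemma sum_over_maps:
  fixes C :: "nat set \<Rightarrow> real"
  assumes G: "G \<in> graphs_with m" and C: "\<And>a. C {a} = 0"
  shows "(\<Sum>\<phi>\<in>fst G \<rightarrow>\<^sub>E {1..p}. \<Prod>e\<in>#snd G. C (\<phi> ` e))
    = (\<Sum>\<alpha>\<in>edge_multisets p m. real (hom_count p G \<alpha>) * (\<Prod>e\<in>#\<alpha>. C e))"
proof -
  let ?M = "fst G \<rightarrow>\<^sub>E {1..p}"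
  let ?h = "\<lambda>\<alpha>. \<Prod>e\<in>#\<alpha>. C e"
  have fin: "finite ?M" by (rule finite_maps[OF G])
  have edges: "\<And>e. e \<in># snd G \<Longrightarrow> card e = 2 \<and> e \<subseteq> fst G" and size: "size (snd G) = m"
    using G by (fastforce simp: graphs_with_def multigraphs_def)+
  have "(\<Sum>\<phi>\<in>?M. \<Prod>e\<in>#snd G. C (\<phi> ` e)) = (\<Sum>\<phi>\<in>?M. ?h (push \<phi> (snd G)))"
    by (simp add: push_def image_mset.compositionality comp_def)
  also have "\<dots> = (\<Sum>\<phi> | \<phi> \<in> ?M \<and> push \<phi> (snd G) \<in> edge_multisets p m. ?h (push \<phi> (snd G)))"
  proof (rule sum.mono_neutral_right[OF fin])
    \<comment> \<open>The image fails to be an edge multiset only when some edge collapses to a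
      single block, where \<open>C\<close> is zero.\<close>
    show "\<forall>\<phi>\<in>?M - {\<phi> \<in> ?M. push \<phi> (snd G) \<in> edge_multisets p m}. ?h (push \<phi> (snd G)) = 0"
    proof
      fix \<phi> assume \<phi>: "\<phi> \<in> ?M - {\<phi> \<in> ?M. push \<phi> (snd G) \<in> edge_multisets p m}"
      have sub: "\<phi> ` e \<subseteq> {1..p}" if "e \<in># snd G" for e
        using \<phi> edges[OF that] by (auto simp: PiE_iff)
      obtain e where e: "e \<in># snd G" "card (\<phi> ` e) \<noteq> 2"
        using \<phi> size sub by (auto simp: edge_multisets_def push_def)
      obtain u v where uv: "e = {u, v}" using edges[OF e(1)] by (metis card_2_iff)
      then have "C (\<phi> ` e) = 0" using e(2) C[of "\<phi> u"] by (cases "\<phi> u = \<phi> v") auto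
      then show "?h (push \<phi> (snd G)) = 0"
        using e(1) by (auto simp: prod_mset_zero_iff push_def intro!: image_eqI[of _ _ e])
    qed
  qed auto
  also have "\<dots> = (\<Sum>\<alpha>\<in>edge_multisets p m. \<Sum>\<phi> | \<phi> \<in> {\<phi> \<in> ?M. push \<phi> (snd G) \<in> edge_multisets p m}
      \<and> push \<phi> (snd G) = \<alpha>. ?h (push \<phi> (snd G)))"
    using fin by (intro sum.group[symmetric]) (auto simp: finite_edge_multisets)
  also have "\<dots> = (\<Sum>\<alpha>\<in>edge_multisets p m. real (hom_count p G \<alpha>) * ?h \<alpha>)"
  proof (rule sum.cong[OF refl])
    fix \<alpha> assume \<alpha>: "\<alpha> \<in> edge_multisets p m"
    have "{\<phi>. \<phi> \<in> {\<phi> \<in> ?M. push \<phi> (snd G) \<in> edge_multisets p m} \<and> push \<phi> (snd G) = \<alpha>}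
        = {\<phi> \<in> ?M. push \<phi> (snd G) = \<alpha>}" using \<alpha> by auto
    then show "(\<Sum>\<phi> | \<phi> \<in> {\<phi> \<in> ?M. push \<phi> (snd G) \<in> edge_multisets p m} \<and> push \<phi> (snd G) = \<alpha>.
        ?h (push \<phi> (snd G))) = real (hom_count p G \<alpha>) * ?h \<alpha>"
      by (simp add: hom_count_def)
  qed
  finally show ?thesis .
qed

section \<open>Block kernels\<close>

abbreviation unit_lebesgue :: "real measure" where
  "unit_lebesgue \<equiv> lebesgue_on {0..1}"

text \<open>The ceiling matches the half-open blocks, closed on the right, in
  \<open>edge_kernel\<close>; \<open>nat\<close> sends every point up to 0 to the label 0.\<close>

definition grid :: "nat \<Rightarrow> real \<Rightarrow> nat" where
  "grid p x = nat \<lceil>real p * x\<rceil>"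

lemma grid_eq_iff_mult: "a \<ge> 1 \<Longrightarrow> grid p x = a \<longleftrightarrow> real a - 1 < real p * x \<and> real p * x \<le> real a"
proof -
  assume "a \<ge> 1"
  then have "grid p x = a \<longleftrightarrow> \<lceil>real p * x\<rceil> = int a" by (auto simp: grid_def)
  then show ?thesis by (simp add: ceiling_eq_iff)
qed

lemma grid_eq_iff:
  assumes "p \<ge> 1" "a \<ge> 1"
  shows "grid p x = a \<longleftrightarrow> x \<in> {(real a - 1) / real p<..real a / real p}"
proof -
  have "grid p x = a \<longleftrightarrow> real a - 1 < real p * x \<and> real p * x \<le> real a"
    using assms by (intro grid_eq_iff_mult)
  also have "\<dots> \<longleftrightarrow> x \<in> {(real a - 1) / real p<..real a / real p}"
    using assms by (auto simp: field_simps)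
  finally show ?thesis .
qed

lemma grid_pos_iff:
  assumes "p \<ge> 1" shows "grid p x \<in> {1..p} \<longleftrightarrow> 0 < x \<and> x \<le> 1"
proof -
  have "grid p x \<ge> 1 \<longleftrightarrow> 0 < real p * x" by (auto simp: grid_def) linarith+
  moreover have "grid p x \<le> p \<longleftrightarrow> real p * x \<le> real p" by (auto simp: grid_def nat_le_iff ceiling_le_iff)
  moreover have "0 < real p * x \<longleftrightarrow> 0 < x" "real p * x \<le> real p \<longleftrightarrow> x \<le> 1"
    using assms by (auto simp: zero_less_mult_iff)
  ultimately show ?thesis by auto
qed

lemma grid_0: "grid p 0 = 0" by (simp add: grid_def)

lemma grid_le: "p \<ge> 1 \<Longrightarrow> x \<in> {0..1} \<Longrightarrow> grid p x \<le> p"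
  using grid_pos_iff[of p x] grid_0[of p] by (cases "x = 0") auto

text \<open>A block map of order \<open>p\<close> cuts the unit interval into \<open>p\<close> blocks of measure \<open>1/p\<close>,
  labelled \<open>1, \<dots>, p\<close>; the label \<open>0\<close> collects a null set, as the half-open blocks of the
  partition leave out the point \<open>0\<close>.\<close>
definition block_map :: "nat \<Rightarrow> (real \<Rightarrow> nat) \<Rightarrow> bool" where
  "block_map p \<beta> \<longleftrightarrow> \<beta> \<in> unit_lebesgue \<rightarrow>\<^sub>M count_space UNIV \<and> (\<forall>x\<in>{0..1}. \<beta> x \<le> p)
     \<and> (\<forall>a\<le>p. measure unit_lebesgue {x \<in> {0..1}. \<beta> x = a} = (if a = 0 then 0 else 1 / real p))"

lemma grid_measurable: "grid p \<in> unit_lebesgue \<rightarrow>\<^sub>M count_space UNIV"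
proof -
  have "grid p \<in> borel \<rightarrow>\<^sub>M count_space UNIV" unfolding grid_def by measurable
  then show ?thesis
    by (intro measurable_restrict_space1 measurable_completion) (simp add: measurable_lborel1)
qed

lemma block_map_grid:
  assumes "p \<ge> 1" shows "block_map p (grid p)"
  unfolding block_map_def
proof (intro conjI ballI allI impI)
  show "grid p \<in> unit_lebesgue \<rightarrow>\<^sub>M count_space UNIV" by (rule grid_measurable)
  show "grid p x \<le> p" if "x \<in> {0..1}" for x using grid_le assms that by blast
  fix a assume a: "a \<le> p"
  show "measure unit_lebesgue {x \<in> {0..1}. grid p x = a} = (if a = 0 then 0 else 1 / real p)"
  proof (cases "a = 0")
    case True
    have "{x \<in> {0..1}. grid p x = 0} = {0}"
    proof (intro subset_antisym subsetI)
      fix x assume x: "x \<in> {x \<in> {0..1}. grid p x = 0}"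
      then have "\<not> (0 < x \<and> x \<le> 1)" using grid_pos_iff[OF assms, of x] by auto
      then show "x \<in> {0}" using x by auto
    qed (simp add: grid_0)
    then show ?thesis using True by (simp add: measure_restrict_space)
  next
    case False
    have sub: "{(real a - 1) / real p<..real a / real p} \<subseteq> {0..1}"
    proof
      fix x assume "x \<in> {(real a - 1) / real p<..real a / real p}"
      then have "grid p x = a" using grid_eq_iff[OF assms, of a x] False by auto
      then show "x \<in> {0..1}" using grid_pos_iff[OF assms, of x] False a by auto
    qed
    then have "{x \<in> {0..1}. grid p x = a} = {(real a - 1) / real p<..real a / real p}"
      using grid_eq_iff[OF assms, of a] False by auto
    then show ?thesis using False sub assms
      by (simp add: measure_restrict_space diff_divide_distrib)
  qed
qed

text \<open>Preimages of blocks keep their measure. Hence a relabelled step kernel is again given by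
  a block map, and densities on whole orbits follow from one computation.\<close>

lemma block_map_comp:
  assumes \<beta>: "block_map p \<beta>" and \<sigma>: "\<sigma> \<in> mp_group"
  shows "block_map p (\<beta> \<circ> \<sigma>)"
proof -
  have m: "\<sigma> \<in> unit_lebesgue \<rightarrow>\<^sub>M unit_lebesgue" and d: "distr unit_lebesgue unit_lebesgue \<sigma> = unit_lebesgue"
    and b: "\<sigma> ` {0..1} = {0..1}"
    using \<sigma> by (auto simp: mp_group_def bij_betw_def)
  have bm: "\<beta> \<in> unit_lebesgue \<rightarrow>\<^sub>M count_space UNIV" using \<beta> by (simp add: block_map_def)
  have "measure unit_lebesgue {x \<in> {0..1}. (\<beta> \<circ> \<sigma>) x = a} = measure unit_lebesgue {x \<in> {0..1}. \<beta> x = a}" for a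
  proof -
    have s: "{x \<in> {0..1}. \<beta> x = a} \<in> sets unit_lebesgue"
      using measurable_sets[OF bm, of "{a}"] by (simp add: vimage_def Int_def conj_commute)
    have "measure (distr unit_lebesgue unit_lebesgue \<sigma>) {x \<in> {0..1}. \<beta> x = a}
      = measure unit_lebesgue (\<sigma> -` {x \<in> {0..1}. \<beta> x = a} \<inter> space unit_lebesgue)"
      by (rule measure_distr[OF m s])
    moreover have "\<sigma> -` {x \<in> {0..1}. \<beta> x = a} \<inter> space unit_lebesgue = {x \<in> {0..1}. (\<beta> \<circ> \<sigma>) x = a}"
      using b by auto
    ultimately show ?thesis by (simp add: d)
  qed
  moreover have "\<beta> \<circ> \<sigma> \<in> unit_lebesgue \<rightarrow>\<^sub>M count_space UNIV" by (rule measurable_comp[OF m bm])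
  moreover have "(\<beta> \<circ> \<sigma>) x \<le> p" if "x \<in> {0..1}" for x
    using that b \<beta> by (auto simp: block_map_def)
  ultimately show ?thesis using \<beta> by (simp add: block_map_def)
qed

section \<open>Measurability on the square and densities of block kernels\<close>

lemma unit_square_sets: "unit_square \<in> sets lebesgue"
proof -
  have "closed unit_square" by (intro closed_Times closed_atLeastAtMost)
  then show ?thesis by auto
qed

text \<open>Between completed measures, Borel measurability is not enough: preimages of null sets
  must be null too, which holds because a strip over a null set is null in the plane.\<close>

lemma fst_lebesgue: "fst \<in> (lebesgue :: (real \<times> real) measure) \<rightarrow>\<^sub>M (lebesgue :: real measure)"
  and snd_lebesgue: "snd \<in> (lebesgue :: (real \<times> real) measure) \<rightarrow>\<^sub>M (lebesgue :: real measure)"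
proof -
  have f: "fst \<in> (lebesgue :: (real \<times> real) measure) \<rightarrow>\<^sub>M lborel"
    and s: "snd \<in> (lebesgue :: (real \<times> real) measure) \<rightarrow>\<^sub>M lborel"
    by (intro measurable_completion; simp add: measurable_lborel1 borel_prod[symmetric])+
  show "fst \<in> (lebesgue :: (real \<times> real) measure) \<rightarrow>\<^sub>M (lebesgue :: real measure)"
  proof (rule completion.measurable_completion2[OF f], rule subsetI)
    fix N :: "real set" assume N: "N \<in> null_sets lborel"
    have "N \<times> UNIV \<in> null_sets (lborel \<Otimes>\<^sub>M (lborel :: real measure))"
      using N by (intro lborel.times_in_null_sets1) auto
    then have "fst -` N \<in> null_sets (lebesgue :: (real \<times> real) measure)"
      by (intro null_sets_completionI) (simp add: lborel_prod vimage_fst)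
    then show "N \<in> null_sets (distr (lebesgue :: (real \<times> real) measure) lborel fst)"
      using N null_sets_distr_iff[OF f, of N] by (auto dest: null_setsD2)
  qed
  show "snd \<in> (lebesgue :: (real \<times> real) measure) \<rightarrow>\<^sub>M (lebesgue :: real measure)"
  proof (rule completion.measurable_completion2[OF s], rule subsetI)
    fix N :: "real set" assume N: "N \<in> null_sets lborel"
    have "UNIV \<times> N \<in> null_sets ((lborel :: real measure) \<Otimes>\<^sub>M lborel)"
      using N by (intro lborel.times_in_null_sets2) auto
    then have "snd -` N \<in> null_sets (lebesgue :: (real \<times> real) measure)"
      by (intro null_sets_completionI) (simp add: lborel_prod vimage_snd)
    then show "N \<in> null_sets (distr (lebesgue :: (real \<times> real) measure) lborel snd)"
      using N null_sets_distr_iff[OF s, of N] by (auto dest: null_setsD2)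
  qed
qed

lemma fst_unit_square: "fst \<in> lebesgue_on unit_square \<rightarrow>\<^sub>M unit_lebesgue"
  and snd_unit_square: "snd \<in> lebesgue_on unit_square \<rightarrow>\<^sub>M unit_lebesgue"
  by (auto intro!: measurable_restrict_space3 fst_lebesgue snd_lebesgue)

lemma sets_lebesgue_Times:
  fixes S T :: "real set"
  assumes "S \<in> sets lebesgue" "T \<in> sets lebesgue" shows "S \<times> T \<in> sets lebesgue"
proof -
  have "S \<times> T = (fst -` S \<inter> space lebesgue) \<inter> (snd -` T \<inter> space lebesgue)" by auto
  then show ?thesis using assms fst_lebesgue snd_lebesgue by (metis measurable_sets sets.Int)
qed

text \<open>The weight depends on the unordered pair of labels, which builds in symmetry; a point
  with two equal labels reads the weight of a singleton.\<close>

definition block_kernel :: "(real \<Rightarrow> nat) \<Rightarrow> (nat set \<Rightarrow> real) \<Rightarrow> kernel" where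
  "block_kernel \<beta> C = (\<lambda>(x, y). if (x, y) \<in> unit_square then C {\<beta> x, \<beta> y} else 0)"

lemma block_kernel_graphon:
  assumes \<beta>: "\<beta> \<in> unit_lebesgue \<rightarrow>\<^sub>M count_space UNIV" and C: "\<And>s. 0 \<le> C s \<and> C s \<le> 1"
  shows "block_kernel \<beta> C \<in> graphons"
proof -
  have "(\<lambda>z. C {\<beta> (fst z), \<beta> (snd z)}) \<in> borel_measurable (lebesgue_on unit_square)"
    by (rule measurable_compose_countable[where g = "\<lambda>z. \<beta> (fst z)"],
        rule measurable_compose_countable[where g = "\<lambda>z. \<beta> (snd z)"])
       (auto intro: measurable_compose[OF fst_unit_square \<beta>] measurable_compose[OF snd_unit_square \<beta>])
  then have "block_kernel \<beta> C \<in> borel_measurable (lebesgue_on unit_square)"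
    by (rule measurable_cong[THEN iffD1, rotated]) (auto simp: block_kernel_def)
  moreover have "\<bar>block_kernel \<beta> C z\<bar> \<le> 1" for z
    using C by (auto simp: block_kernel_def split: prod.splits)
  moreover have "block_kernel \<beta> C (x, y) = block_kernel \<beta> C (y, x)" for x y
    by (auto simp: block_kernel_def insert_commute)
  moreover have "z \<notin> unit_square \<Longrightarrow> block_kernel \<beta> C z = 0" for z
    by (auto simp: block_kernel_def split: prod.splits)
  moreover have "0 \<le> block_kernel \<beta> C z" "block_kernel \<beta> C z \<le> 1" for z
    using C by (auto simp: block_kernel_def split: prod.splits)
  ultimately show ?thesis unfolding graphons_def kernels_def by blast
qed

lemma relabel_block_kernel:
  assumes "\<sigma> \<in> mp_group" shows "relabel (block_kernel \<beta> C) \<sigma> = block_kernel (\<beta> \<circ> \<sigma>) C"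
proof -
  have "\<sigma> x \<in> {0..1}" if "x \<in> {0..1}" for x
    using assms that by (auto simp: mp_group_def bij_betw_def)
  then show ?thesis by (auto simp: relabel_def block_kernel_def fun_eq_iff)
qed

lemma emeasure_unit_lebesgue: "emeasure unit_lebesgue (space unit_lebesgue) = 1"
  by (simp add: emeasure_restrict_space)

lemma finite_measure_unit_lebesgue: "finite_measure unit_lebesgue"
  by (rule finite_measureI) (simp add: emeasure_restrict_space)

lemma product_sigma_finite_unit_lebesgue: "product_sigma_finite (\<lambda>_. unit_lebesgue)"
proof -
  interpret finite_measure unit_lebesgue by (rule finite_measure_unit_lebesgue)
  show ?thesis by unfold_locales
qed

text \<open>The integrand is constant on products of blocks, so the integral is a sum over
  labellings of the vertices, each weighted by the product of the measures of its blocks.\<close>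

lemma block_kernel_density:
  assumes \<beta>: "block_map p \<beta>" and G: "G \<in> multigraphs"
  shows "hom_density_rep G (block_kernel \<beta> C)
    = (1 / real p) ^ card (fst G) * (\<Sum>\<phi>\<in>fst G \<rightarrow>\<^sub>E {1..p}. \<Prod>e\<in>#snd G. C (\<phi> ` e))"
proof -
  obtain V E where VE: "G = (V, E)" by fastforce
  have fin: "finite V" and E: "\<And>e. e \<in># E \<Longrightarrow> e \<subseteq> V \<and> card e = 2"
    using G by (auto simp: VE multigraphs_def)
  have bm: "\<beta> \<in> unit_lebesgue \<rightarrow>\<^sub>M count_space UNIV"
    and le: "\<And>x. x \<in> {0..1} \<Longrightarrow> \<beta> x \<le> p"
    and meas: "\<And>a. a \<le> p \<Longrightarrow> measure unit_lebesgue {x \<in> {0..1}. \<beta> x = a} = (if a = 0 then 0 else 1 / real p)"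
    using \<beta> by (auto simp: block_map_def)
  interpret product_sigma_finite "\<lambda>_::nat. unit_lebesgue" by (rule product_sigma_finite_unit_lebesgue)
  let ?P = "PiM V (\<lambda>_. unit_lebesgue)"
  let ?M = "V \<rightarrow>\<^sub>E {0..p}"
  define A where "A a = {x \<in> {0..1}. \<beta> x = a}" for a
  have A: "A a \<in> sets unit_lebesgue" for a
    using measurable_sets[OF bm, of "{a}"] by (simp add: A_def vimage_def Int_def conj_commute)
  have finM: "finite ?M" using fin by (simp add: finite_PiE)
  have int_A: "integrable unit_lebesgue (indicator (A a) :: real \<Rightarrow> real)" for a
    using A finite_measure.emeasure_finite[OF finite_measure_unit_lebesgue]
    by (intro integrable_real_indicator) (auto simp: less_top[symmetric])
  have intg: "integrable ?P (\<lambda>x. \<Prod>v\<in>V. indicator (A (\<phi> v)) (x v) :: real)" for \<phi>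
    using fin int_A by (intro product_integrable_prod) auto
  \<comment> \<open>Exactly one labelling has all its indicators equal to 1 at a given
    point.\<close>
  have f: "(\<Prod>e\<in>#E. block_kernel \<beta> C (x (Min e), x (Max e)))
      = (\<Sum>\<phi>\<in>?M. (\<Prod>e\<in>#E. C (\<phi> ` e)) * (\<Prod>v\<in>V. indicator (A (\<phi> v)) (x v)))"
    if x: "x \<in> space ?P" for x
  proof -
    have x1: "x v \<in> {0..1}" if "v \<in> V" for v using x that by (auto simp: space_PiM)
    define \<phi> where "\<phi> = restrict (\<lambda>v. \<beta> (x v)) V"
    have \<phi>: "\<phi> \<in> ?M" using le x1 by (auto simp: \<phi>_def)
    have ind: "(\<Prod>v\<in>V. indicator (A (\<psi> v)) (x v) :: real) = (if \<psi> = \<phi> then 1 else 0)"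
      if \<psi>: "\<psi> \<in> ?M" for \<psi>
    proof (cases "\<psi> = \<phi>")
      case True
      then show ?thesis using x1 by (auto simp: A_def \<phi>_def intro!: prod.neutral)
    next
      case False
      then obtain v where "v \<in> V" "\<psi> v \<noteq> \<phi> v" using PiE_ext[OF \<psi> \<phi>] by blast
      then have "indicator (A (\<psi> v)) (x v) = (0::real)" by (auto simp: A_def \<phi>_def)
      then show ?thesis using False fin \<open>v \<in> V\<close> by (auto simp: prod_zero_iff)
    qed
    have "(\<Sum>\<psi>\<in>?M. (\<Prod>e\<in>#E. C (\<psi> ` e)) * (\<Prod>v\<in>V. indicator (A (\<psi> v)) (x v)))
       = (\<Sum>\<psi>\<in>?M. if \<psi> = \<phi> then \<Prod>e\<in>#E. C (\<psi> ` e) else 0)"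
      using ind by (intro sum.cong refl) auto
    also have "\<dots> = (\<Prod>e\<in>#E. C (\<phi> ` e))" using finM \<phi> by simp
    also have "\<dots> = (\<Prod>e\<in>#E. block_kernel \<beta> C (x (Min e), x (Max e)))"
    proof (rule arg_cong[where f = prod_mset], rule image_mset_cong)
      fix e assume "e \<in># E"
      then have e: "e \<subseteq> V" "card e = 2" using E by auto
      then have fe: "finite e" "e \<noteq> {}" by (auto intro: card_ge_0_finite)
      then have mm: "Min e \<in> e" "Max e \<in> e" by auto
      obtain u v where "e = {u, v}" using e by (meson card_2_iff)
      then have "e = {Min e, Max e}" by (cases "u \<le> v") (auto simp: min_def max_def)
      from arg_cong[OF this, of "\<lambda>e. \<phi> ` e"]
      have im: "\<phi> ` e = {\<phi> (Min e), \<phi> (Max e)}" by simp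
      have "Min e \<in> V" "Max e \<in> V" using mm e(1) by auto
      then show "C (\<phi> ` e) = block_kernel \<beta> C (x (Min e), x (Max e))"
        using x1[of "Min e"] x1[of "Max e"] unfolding im by (auto simp: block_kernel_def \<phi>_def)
    qed
    finally show ?thesis ..
  qed
  have "hom_density_rep G (block_kernel \<beta> C)
    = (LINT x|completion ?P. (\<Sum>\<phi>\<in>?M. (\<Prod>e\<in>#E. C (\<phi> ` e)) * (\<Prod>v\<in>V. indicator (A (\<phi> v)) (x v))))"
    unfolding hom_density_rep_def VE fst_conv snd_conv
    by (rule Bochner_Integration.integral_cong[OF refl]) (simp add: f)
  also have "\<dots> = (LINT x|?P. (\<Sum>\<phi>\<in>?M. (\<Prod>e\<in>#E. C (\<phi> ` e)) * (\<Prod>v\<in>V. indicator (A (\<phi> v)) (x v))))"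
    using intg by (intro integral_completion borel_measurable_sum borel_measurable_times
        borel_measurable_const borel_measurable_integrable)
  also have "\<dots> = (\<Sum>\<phi>\<in>?M. (\<Prod>e\<in>#E. C (\<phi> ` e)) * (\<Prod>v\<in>V. measure unit_lebesgue (A (\<phi> v))))"
  proof (subst Bochner_Integration.integral_sum)
    show "integrable ?P (\<lambda>x. (\<Prod>e\<in>#E. C (\<phi> ` e)) * (\<Prod>v\<in>V. indicator (A (\<phi> v)) (x v)))" for \<phi>
      by (intro integrable_mult_right intg)
    have "(LINT x|?P. (\<Prod>v\<in>V. indicator (A (\<phi> v)) (x v) :: real)) = (\<Prod>v\<in>V. measure unit_lebesgue (A (\<phi> v)))" for \<phi>
    proof -
      have "A a \<inter> {0..1} = A a" for a by (auto simp: A_def)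
      then have "integral\<^sup>L unit_lebesgue (indicator (A a)) = measure unit_lebesgue (A a)" for a
        by simp
      then show ?thesis
        using product_integral_prod[OF fin, of "\<lambda>v. indicator (A (\<phi> v)) :: real \<Rightarrow> real"] int_A by simp
    qed
    then show "(\<Sum>\<phi>\<in>?M. LINT x|?P. (\<Prod>e\<in>#E. C (\<phi> ` e)) * (\<Prod>v\<in>V. indicator (A (\<phi> v)) (x v)))
      = (\<Sum>\<phi>\<in>?M. (\<Prod>e\<in>#E. C (\<phi> ` e)) * (\<Prod>v\<in>V. measure unit_lebesgue (A (\<phi> v))))"
      by simp
  qed
  \<comment> \<open>A labelling that uses 0 has a block of measure zero.\<close>
  also have "\<dots> = (\<Sum>\<phi>\<in>V \<rightarrow>\<^sub>E {1..p}. (\<Prod>e\<in>#E. C (\<phi> ` e)) * (\<Prod>v\<in>V. measure unit_lebesgue (A (\<phi> v))))"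
  proof (rule sum.mono_neutral_right[OF finM])
    show "V \<rightarrow>\<^sub>E {1..p} \<subseteq> ?M" by (intro PiE_mono) auto
    show "\<forall>\<phi>\<in>?M - (V \<rightarrow>\<^sub>E {1..p}). (\<Prod>e\<in>#E. C (\<phi> ` e)) * (\<Prod>v\<in>V. measure unit_lebesgue (A (\<phi> v))) = 0"
    proof
      fix \<phi> assume \<phi>: "\<phi> \<in> ?M - (V \<rightarrow>\<^sub>E {1..p})"
      then obtain v where "v \<in> V" "\<phi> v \<notin> {1..p}" "\<phi> v \<le> p" by (auto simp: PiE_iff)
      then have "\<phi> v = 0" by auto
      then have "measure unit_lebesgue (A (\<phi> v)) = 0" using meas[of 0] by (simp add: A_def)
      then show "(\<Prod>e\<in>#E. C (\<phi> ` e)) * (\<Prod>v\<in>V. measure unit_lebesgue (A (\<phi> v))) = 0"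
        using \<open>v \<in> V\<close> fin by (auto simp: prod_zero_iff)
    qed
  qed
  also have "\<dots> = (\<Sum>\<phi>\<in>V \<rightarrow>\<^sub>E {1..p}. (\<Prod>e\<in>#E. C (\<phi> ` e)) * (1 / real p) ^ card V)"
  proof (intro sum.cong refl arg_cong2[where f = "(*)"])
    fix \<phi> assume \<phi>: "\<phi> \<in> V \<rightarrow>\<^sub>E {1..p}"
    have "measure unit_lebesgue (A (\<phi> v)) = 1 / real p" if "v \<in> V" for v
    proof -
      have "\<phi> v \<in> {1..p}" using \<phi> that by auto
      then show ?thesis using meas[of "\<phi> v"] by (simp add: A_def)
    qed
    then show "(\<Prod>v\<in>V. measure unit_lebesgue (A (\<phi> v))) = (1 / real p) ^ card V" by simp
  qed
  finally show ?thesis by (simp add: VE sum_distrib_left mult.commute)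
qed

section \<open>Permutations of the blocks as measure-preserving maps\<close>

text \<open>Translates block \<open>a\<close> onto block \<open>\<pi> a\<close>. The point 0 lies in
  no block and stays fixed, which keeps the map a bijection of the closed interval.\<close>

definition shuffle :: "nat \<Rightarrow> (nat \<Rightarrow> nat) \<Rightarrow> real \<Rightarrow> real" where
  "shuffle p \<pi> x = (if 0 < x \<and> x \<le> 1
     then x + (real (\<pi> (grid p x)) - real (grid p x)) / real p else x)"

lemma grid_shuffle:
  assumes p: "p \<ge> 1" and \<pi>: "bij_betw \<pi> {1..p} {1..p}" and x: "0 < x" "x \<le> 1"
  shows "grid p (shuffle p \<pi> x) = \<pi> (grid p x)" "0 < shuffle p \<pi> x" "shuffle p \<pi> x \<le> 1"
proof -
  have g: "grid p x \<in> {1..p}" using grid_pos_iff[OF p] x by blast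
  then have \<pi>g: "\<pi> (grid p x) \<in> {1..p}" using \<pi> bij_betwE by blast
  have "real (grid p x) - 1 < real p * x \<and> real p * x \<le> real (grid p x)"
    using grid_eq_iff_mult[of "grid p x" p x] g by auto
  moreover have "real p * shuffle p \<pi> x = real p * x + (real (\<pi> (grid p x)) - real (grid p x))"
    using x p by (simp add: shuffle_def distrib_left)
  ultimately show "grid p (shuffle p \<pi> x) = \<pi> (grid p x)"
    using \<pi>g by (subst grid_eq_iff_mult) auto
  then have "0 < shuffle p \<pi> x \<and> shuffle p \<pi> x \<le> 1" using grid_pos_iff[OF p] \<pi>g by metis
  then show "0 < shuffle p \<pi> x" "shuffle p \<pi> x \<le> 1" by auto
qed

lemma shuffle_range:
  assumes "p \<ge> 1" "bij_betw \<pi> {1..p} {1..p}" "x \<in> {0..1}"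
  shows "shuffle p \<pi> x \<in> {0..1}"
  using grid_shuffle(2,3)[OF assms(1,2), of x] assms(3) by (cases "x = 0") (auto simp: shuffle_def)

lemma shuffle_inverse:
  assumes p: "p \<ge> 1" and \<pi>: "bij_betw \<pi> {1..p} {1..p}" and \<rho>: "\<And>a. a \<in> {1..p} \<Longrightarrow> \<rho> (\<pi> a) = a"
    and x: "x \<in> {0..1}"
  shows "shuffle p \<rho> (shuffle p \<pi> x) = x"
proof (cases "x = 0")
  case False
  then have x: "0 < x" "x \<le> 1" using x by auto
  note g = grid_shuffle[OF p \<pi> x]
  have "\<rho> (\<pi> (grid p x)) = grid p x" using \<rho> grid_pos_iff[OF p] x by blast
  then show ?thesis using g x by (simp add: shuffle_def[of p \<rho>]) (simp add: shuffle_def diff_divide_distrib)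
qed (simp add: shuffle_def)

text \<open>The preimage is cut into finitely many translates of pieces of \<open>A\<close>, so
  measurability and measure reduce to translation invariance.\<close>

lemma shuffle_preimage:
  assumes p: "p \<ge> 1" and \<pi>: "bij_betw \<pi> {1..p} {1..p}" and A: "A \<subseteq> {0..1}"
  shows "shuffle p \<pi> -` A \<inter> {0..1} = (A \<inter> {0}) \<union>
    (\<Union>a\<in>{1..p}. (\<lambda>x. x + (real a - real (\<pi> a)) / real p) ` {x \<in> A. grid p x = \<pi> a})" (is "?L = ?R")
proof (intro subset_antisym subsetI)
  fix x assume x: "x \<in> ?L"
  show "x \<in> ?R"
  proof (cases "x = 0")
    case True
    then show ?thesis using x by (simp add: shuffle_def)
  next
    case False
    then have x1: "0 < x" "x \<le> 1" using x by auto
    have "x = shuffle p \<pi> x + (real (grid p x) - real (\<pi> (grid p x))) / real p"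
      using x1 by (simp add: shuffle_def diff_divide_distrib)
    moreover have "grid p x \<in> {1..p}" using grid_pos_iff[OF p] x1 by blast
    ultimately show ?thesis using x grid_shuffle(1)[OF p \<pi> x1] by blast
  qed
next
  fix x assume "x \<in> ?R"
  then consider "x \<in> A \<inter> {0}" | a y where "a \<in> {1..p}" "y \<in> A" "grid p y = \<pi> a"
      "x = y + (real a - real (\<pi> a)) / real p" by blast
  then show "x \<in> ?L"
  proof cases
    case 1
    then have "x = 0" "0 \<in> A" by auto
    then show ?thesis by (simp add: shuffle_def)
  next
    case 2
    then have "\<pi> a \<in> {1..p}" using \<pi> bij_betwE by blast
    then have "y \<in> {(real (\<pi> a) - 1) / real p<..real (\<pi> a) / real p}"
      using grid_eq_iff[OF p, of "\<pi> a" y] 2 by auto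
    then have "x \<in> {(real a - 1) / real p<..real a / real p}"
      using 2(4) p by (auto simp: field_simps)
    then have "grid p x = a" using grid_eq_iff[OF p, of a x] 2(1) by auto
    then have "0 < x \<and> x \<le> 1" using grid_pos_iff[OF p, of x] 2(1) by auto
    then show ?thesis using 2 \<open>grid p x = a\<close> by (simp add: shuffle_def diff_divide_distrib)
  qed
qed

lemma grid_level_sets: "{x. grid p x = a} \<in> sets lebesgue"
proof -
  have "grid p \<in> borel \<rightarrow>\<^sub>M count_space UNIV" unfolding grid_def by measurable
  from measurable_sets[OF this, of "{a}"] have "{x. grid p x = a} \<in> sets borel" by (simp add: vimage_def)
  then show ?thesis by auto
qed

lemma shuffle_preimage_measure:
  assumes p: "p \<ge> 1" and \<pi>: "bij_betw \<pi> {1..p} {1..p}" and A: "A \<in> sets lebesgue" "A \<subseteq> {0..1}"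
  shows "shuffle p \<pi> -` A \<inter> {0..1} \<in> sets lebesgue"
    and "emeasure lebesgue (shuffle p \<pi> -` A \<inter> {0..1}) = emeasure lebesgue A"
proof -
  let ?T = "\<lambda>a. (\<lambda>x. x + (real a - real (\<pi> a)) / real p) ` {x \<in> A. grid p x = \<pi> a}"
  have lev: "{x \<in> A. grid p x = b} \<in> sets lebesgue" for b
    using sets.Int[OF A(1) grid_level_sets[of p b]] by (simp add: Int_def)
  have T: "?T a \<in> sets lebesgue" for a
    using lebesgue_sets_translation[OF lev, of "(real a - real (\<pi> a)) / real p" "\<pi> a"] by (simp add: add.commute)
  have eT: "emeasure lebesgue (?T a) = emeasure lebesgue {x \<in> A. grid p x = \<pi> a}" for a
    using emeasure_lebesgue_affine[of 1 "(real a - real (\<pi> a)) / real p" "{x \<in> A. grid p x = \<pi> a}"] by simp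
  note pre = shuffle_preimage[OF p \<pi> A(2)]
  have z: "A \<inter> {0} \<in> null_sets lebesgue"
    by (rule null_sets_completion_subset[of _ "{0}"]) (auto intro: null_sets_completionI)
  show "shuffle p \<pi> -` A \<inter> {0..1} \<in> sets lebesgue"
    unfolding pre using T z by (auto intro!: sets.Un sets.finite_UN)
  \<comment> \<open>The translated pieces lie in different blocks and are therefore
    disjoint.\<close>
  have level: "x \<in> ?T a \<Longrightarrow> a \<in> {1..p} \<Longrightarrow> grid p x = a" for x a
  proof -
    assume x: "x \<in> ?T a" and a: "a \<in> {1..p}"
    then obtain y where y: "y \<in> A" "grid p y = \<pi> a" "x = y + (real a - real (\<pi> a)) / real p" by blast
    have "\<pi> a \<in> {1..p}" using \<pi> a bij_betwE by blast
    then have "y \<in> {(real (\<pi> a) - 1) / real p<..real (\<pi> a) / real p}"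
      using grid_eq_iff[OF p, of "\<pi> a" y] y by auto
    then have "x \<in> {(real a - 1) / real p<..real a / real p}"
      using y(3) p by (auto simp: field_simps)
    then show "grid p x = a" using grid_eq_iff[OF p, of a x] a by auto
  qed
  have "emeasure lebesgue (shuffle p \<pi> -` A \<inter> {0..1}) = emeasure lebesgue (\<Union>a\<in>{1..p}. ?T a)"
    unfolding pre using z T by (subst Un_commute, intro emeasure_Un_null_set) auto
  also have "\<dots> = (\<Sum>a\<in>{1..p}. emeasure lebesgue (?T a))"
  proof (rule sum_emeasure[symmetric])
    show "disjoint_family_on ?T {1..p}" unfolding disjoint_family_on_def
    proof (intro ballI impI equals0I)
      fix a b x assume ab: "a \<in> {1..p}" "b \<in> {1..p}" "a \<noteq> b" and x: "x \<in> ?T a \<inter> ?T b"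
      have "grid p x = a" by (rule level[OF IntD1[OF x] ab(1)])
      moreover have "grid p x = b" by (rule level[OF IntD2[OF x] ab(2)])
      ultimately show False using ab(3) by simp
    qed
    show "?T ` {1..p} \<subseteq> sets lebesgue" using T by blast
  qed simp
  also have "\<dots> = (\<Sum>b\<in>{1..p}. emeasure lebesgue {x \<in> A. grid p x = b})"
    unfolding eT by (rule sum.reindex_bij_betw[OF \<pi>])
  also have "\<dots> = emeasure lebesgue (\<Union>b\<in>{1..p}. {x \<in> A. grid p x = b})"
    by (rule sum_emeasure) (use lev in \<open>auto simp: disjoint_family_on_def\<close>)
  also have "\<dots> = emeasure lebesgue ((\<Union>b\<in>{1..p}. {x \<in> A. grid p x = b}) \<union> (A \<inter> {0}))"
    using z lev by (intro emeasure_Un_null_set[symmetric]) auto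
  also have "(\<Union>b\<in>{1..p}. {x \<in> A. grid p x = b}) \<union> (A \<inter> {0}) = A"
  proof -
    have "x \<in> (\<Union>b\<in>{1..p}. {x \<in> A. grid p x = b}) \<union> (A \<inter> {0})" if "x \<in> A" for x
      using grid_pos_iff[OF p, of x] A(2) that by (cases "x = 0") (auto simp: subset_eq)
    then show ?thesis by blast
  qed
  finally show "emeasure lebesgue (shuffle p \<pi> -` A \<inter> {0..1}) = emeasure lebesgue A" .
qed

lemma shuffle_measurable:
  assumes p: "p \<ge> 1" and \<pi>: "bij_betw \<pi> {1..p} {1..p}"
  shows "shuffle p \<pi> \<in> unit_lebesgue \<rightarrow>\<^sub>M unit_lebesgue"
  using shuffle_preimage_measure(1)[OF assms] shuffle_range[OF assms]
  by (intro measurableI) (auto simp: sets_restrict_space_iff)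

text \<open>The inverse is the shuffle by the inverse permutation, hence measurable as well.\<close>

lemma shuffle_mp_group:
  assumes p: "p \<ge> 1" and \<pi>: "bij_betw \<pi> {1..p} {1..p}"
  shows "shuffle p \<pi> \<in> mp_group"
proof -
  define \<rho> where "\<rho> = inv_into {1..p} \<pi>"
  have \<rho>: "bij_betw \<rho> {1..p} {1..p}" unfolding \<rho>_def by (rule bij_betw_inv_into[OF \<pi>])
  have inv1: "shuffle p \<rho> (shuffle p \<pi> x) = x" if "x \<in> {0..1}" for x
    by (rule shuffle_inverse[OF p \<pi> _ that]) (simp only: \<rho>_def bij_betw_inv_into_left[OF \<pi>])
  have inv2: "shuffle p \<pi> (shuffle p \<rho> x) = x" if "x \<in> {0..1}" for x
    by (rule shuffle_inverse[OF p \<rho> _ that]) (simp only: \<rho>_def bij_betw_inv_into_right[OF \<pi>])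
  have bij: "bij_betw (shuffle p \<pi>) {0..1} {0..1}"
    by (rule bij_betw_byWitness[of _ "shuffle p \<rho>"])
       (use inv1 inv2 shuffle_range[OF p \<pi>] shuffle_range[OF p \<rho>] in auto)
  have "inv_into {0..1} (shuffle p \<pi>) x = shuffle p \<rho> x" if "x \<in> {0..1}" for x
    using bij_betw_inv_into_left[OF bij shuffle_range[OF p \<rho> that]] inv2[OF that] by simp
  then have "inv_into {0..1} (shuffle p \<pi>) \<in> unit_lebesgue \<rightarrow>\<^sub>M unit_lebesgue"
    by (intro measurable_cong[THEN iffD2, OF _ shuffle_measurable[OF p \<rho>]]) auto
  moreover have "distr unit_lebesgue unit_lebesgue (shuffle p \<pi>) = unit_lebesgue"
  proof (rule measure_eqI)
    fix A assume "A \<in> sets (distr unit_lebesgue unit_lebesgue (shuffle p \<pi>))"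
    then have A: "A \<in> sets unit_lebesgue" "A \<in> sets lebesgue" "A \<subseteq> {0..1}"
      by (auto simp: sets_restrict_space_iff)
    show "emeasure (distr unit_lebesgue unit_lebesgue (shuffle p \<pi>)) A = emeasure unit_lebesgue A"
      using emeasure_distr[OF shuffle_measurable[OF p \<pi>] A(1)]
        shuffle_preimage_measure(2)[OF p \<pi> A(2,3)] A(3)
      by (simp add: emeasure_restrict_space)
  qed simp
  ultimately show ?thesis using bij shuffle_measurable[OF p \<pi>] by (simp add: mp_group_def)
qed

section \<open>Taylor terms of step graphons\<close>

lemma emeasure_unit_square: "emeasure lebesgue unit_square = 1"
proof -
  have "closed unit_square" by (intro closed_Times closed_atLeastAtMost)
  then have "emeasure lebesgue unit_square = emeasure lborel unit_square" by (simp add: borel_closed)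
  also have "\<dots> = 1"
    using lborel.emeasure_pair_measure_Times[of "{0..1::real}" lborel "{0..1::real}"]
    by (simp add: lborel_prod)
  finally show ?thesis .
qed

lemma abs_cut_integral_le_1:
  fixes g :: kernel
  assumes g: "\<And>z. \<bar>g z\<bar> \<le> 1" and S: "S \<in> sets lebesgue" "S \<subseteq> {0..1}" and T: "T \<in> sets lebesgue" "T \<subseteq> {0..1}"
  shows "\<bar>LINT z|lebesgue_on (S \<times> T). g z\<bar> \<le> (1::real)"
proof (cases "integrable (lebesgue_on (S \<times> T)) g")
  case True
  have ST: "S \<times> T \<in> sets lebesgue" by (rule sets_lebesgue_Times[OF S(1) T(1)])
  have "emeasure lebesgue (S \<times> T) \<le> emeasure lebesgue unit_square"
    using S T unit_square_sets by (intro emeasure_mono) auto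
  also have "\<dots> = 1" by (rule emeasure_unit_square)
  finally have e: "emeasure lebesgue (S \<times> T) \<le> 1" .
  then have m: "measure lebesgue (S \<times> T) \<le> 1" unfolding measure_def
    by (metis enn2real_mono enn2real_1 ennreal_one_less_top)
  have fin: "emeasure lebesgue (S \<times> T) < \<infinity>" using e by (metis ennreal_one_less_top infinity_ennreal_def order_le_less_trans)
  have c: "integrable (lebesgue_on (S \<times> T)) (\<lambda>_. 1::real)"
    using fin ST by (auto simp: emeasure_restrict_space intro!: integrable_const finite_measure.integrable_const finite_measureI)
  have "\<bar>LINT z|lebesgue_on (S \<times> T). g z\<bar> \<le> (LINT z|lebesgue_on (S \<times> T). \<bar>g z\<bar>)"
    by (rule integral_abs_bound)
  also have "\<dots> \<le> (LINT z|lebesgue_on (S \<times> T). 1)"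
    using True c g by (intro integral_mono) auto
  also have "\<dots> \<le> 1" using m ST by (simp add: measure_restrict_space)
  finally show ?thesis .
\<comment> \<open>A function that is not integrable has integral 0 by convention.\<close>
qed (simp add: not_integrable_integral_eq)

text \<open>The empty rectangle contributes 0, and the bound by 1 ensures that the supremum is one
  of a bounded set.\<close>

lemma cut_norm_nonneg:
  assumes "\<And>z. \<bar>g z\<bar> \<le> 1" shows "0 \<le> cut_norm g"
proof -
  let ?I = "{S \<in> sets lebesgue. S \<subseteq> {0..1::real}} \<times> {T \<in> sets lebesgue. T \<subseteq> {0..1::real}}"
  let ?h = "\<lambda>(S, T). \<bar>LINT z|lebesgue_on (S \<times> T). g z\<bar>"
  have "bdd_above (?h ` ?I)"
    using abs_cut_integral_le_1[OF assms] by (intro bdd_aboveI[of _ 1]) auto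
  then have "?h ({}, {}) \<le> (SUP i\<in>?I. ?h i)" by (intro cSUP_upper) auto
  then show ?thesis unfolding cut_norm_def by simp
qed

lemma cut_norm_zero: "cut_norm (\<lambda>_. 0) = 0"
  unfolding cut_norm_def by (simp add: case_prod_unfold) (intro cSUP_const, auto)

lemma relabel_bounds: "f \<in> graphons \<Longrightarrow> 0 \<le> relabel f \<sigma> z \<and> relabel f \<sigma> z \<le> 1"
  using graphon_bounds[of f] by (auto simp: relabel_def split: prod.splits)

text \<open>Taking \<sigma> itself in the infimum gives the zero function, and no term of the
  infimum is negative.\<close>

lemma cut_dist_relabel:
  assumes f: "f \<in> graphons" and \<sigma>: "\<sigma> \<in> mp_group"
  shows "cut_dist (relabel f \<sigma>) f = 0"
proof -
  have nonneg: "0 \<le> cut_norm (\<lambda>z. relabel f \<sigma> z - relabel f \<psi> z)" for \<psi>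
  proof (rule cut_norm_nonneg)
    fix z show "\<bar>relabel f \<sigma> z - relabel f \<psi> z\<bar> \<le> 1"
      using relabel_bounds[OF f, of \<sigma> z] relabel_bounds[OF f, of \<psi> z] by linarith
  qed
  have "cut_dist (relabel f \<sigma>) f \<le> cut_norm (\<lambda>z. relabel f \<sigma> z - relabel f \<sigma> z)"
    unfolding cut_dist_def using nonneg by (intro cINF_lower[OF _ \<sigma>] bdd_belowI[of _ 0]) auto
  moreover have "0 \<le> cut_dist (relabel f \<sigma>) f"
    unfolding cut_dist_def using nonneg \<sigma> by (intro cINF_greatest) auto
  ultimately show ?thesis by (simp add: cut_norm_zero)
qed

text \<open>Membership in the graphons is a pointwise bound on the values, and \<sigma> permutes the
  points at which they are taken.\<close>

lemma ray_relabel: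
  assumes f: "f \<in> graphons" and f\<sigma>: "relabel f \<sigma> \<in> graphons" and \<sigma>: "\<sigma> \<in> mp_group"
  shows "ray (relabel f \<sigma>) = ray f"
proof -
  have bij: "bij_betw \<sigma> {0..1} {0..1}" using \<sigma> by (simp add: mp_group_def)
  have k: "f \<in> kernels" "relabel f \<sigma> \<in> kernels" using f f\<sigma> by (auto simp: graphons_def)
  have "(\<forall>z\<in>unit_square. P (relabel f \<sigma> z)) \<longleftrightarrow> (\<forall>z\<in>unit_square. P (f z))" for P
  proof
    assume L: "\<forall>z\<in>unit_square. P (relabel f \<sigma> z)"
    show "\<forall>z\<in>unit_square. P (f z)"
    proof
      fix z assume "z \<in> unit_square"
      then obtain x y where z: "z = (x, y)" "x \<in> \<sigma> ` {0..1}" "y \<in> \<sigma> ` {0..1}"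
        using bij by (auto simp: bij_betw_def)
      then obtain x' y' where "z = (\<sigma> x', \<sigma> y')" "x' \<in> {0..1}" "y' \<in> {0..1}" by blast
      then show "P (f z)" using L by (force simp: relabel_def)
    qed
  next
    assume R: "\<forall>z\<in>unit_square. P (f z)"
    show "\<forall>z\<in>unit_square. P (relabel f \<sigma> z)"
      using R bij_betwE[OF bij] by (auto simp: relabel_def)
  qed
  from this[of "\<lambda>v. 0 \<le> l * v \<and> l * v \<le> 1" for l] show ?thesis
    using scaled_kernel[OF k(1)] scaled_kernel[OF k(2)] by (auto simp: ray_def graphons_def)
qed

lemma relabel_scale: "relabel (\<lambda>z. l * f z) \<sigma> = (\<lambda>z. l * relabel f \<sigma> z)"
  by (auto simp: relabel_def fun_eq_iff)

text \<open>A class function takes equal values along the two rays, so one function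
  \<open>\<psi>\<close> computes the Taylor terms of both graphons.\<close>

lemma taylor_term_relabel:
  assumes F: "class_function F" "Cn_function n F" and m: "m \<le> n"
    and f: "f \<in> graphons" and f\<sigma>: "relabel f \<sigma> \<in> graphons" and \<sigma>: "\<sigma> \<in> mp_group"
  shows "taylor_term F m (relabel f \<sigma>) = taylor_term F m f"
proof -
  obtain \<psi> where \<psi>: "\<And>l. l \<in> ray f \<Longrightarrow> \<psi> 0 l = F (\<lambda>z. l * f z)"
      "\<And>k t. k < n \<Longrightarrow> (\<psi> k has_real_derivative \<psi> (Suc k) t) (at t)"
    using ray_extension[OF F(2) f] by blast
  have "\<psi> 0 l = F (\<lambda>z. l * relabel f \<sigma> z)" if "l \<in> ray (relabel f \<sigma>)" for l
  proof -
    have l: "l \<in> ray f" using that ray_relabel[OF f f\<sigma> \<sigma>] by simp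
    have "F (relabel (\<lambda>z. l * f z) \<sigma>) = F (\<lambda>z. l * f z)"
      using F(1) that l cut_dist_relabel[OF _ \<sigma>, of "\<lambda>z. l * f z"]
      unfolding class_function_def ray_def relabel_scale by blast
    then show ?thesis using \<psi>(1)[OF l] by (simp add: relabel_scale)
  qed
  from taylor_term_ray[where \<psi> = \<psi>, OF f\<sigma> this \<psi>(2) m] taylor_term_ray[where \<psi> = \<psi>, OF f \<psi> m] show ?thesis by simp
qed

section \<open>Step graphons parametrised by edge weights\<close>

text \<open>Kills singletons, that is the diagonal blocks, and pairs with label 0, so the weights
  may be arbitrary off the edges.\<close>

definition cut_off :: "nat \<Rightarrow> (nat set \<Rightarrow> real) \<Rightarrow> nat set \<Rightarrow> real" where
  "cut_off p C s = (if s \<in> edges p then C s else 0)"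

definition step :: "nat \<Rightarrow> (nat set \<Rightarrow> real) \<Rightarrow> kernel" where
  "step p C = block_kernel (grid p) (cut_off p C)"

definition weights :: "(nat set \<Rightarrow> real) set" where
  "weights = {C. \<forall>s. 0 \<le> C s \<and> C s \<le> 1}"

lemma edge_multisets_edges: "\<alpha> \<in> edge_multisets p m \<longleftrightarrow> size \<alpha> = m \<and> set_mset \<alpha> \<subseteq> edges p"
  by (auto simp: edge_multisets_def edges_def)

lemma edges_insert_iff: "{a, b} \<in> edges p \<longleftrightarrow> a \<in> {1..p} \<and> b \<in> {1..p} \<and> a \<noteq> b"
  by (auto simp: edges_def card_insert_if)

lemma cut_off_weights: "C \<in> weights \<Longrightarrow> cut_off p C \<in> weights"
  by (auto simp: weights_def cut_off_def)

lemma cut_off_singleton: "cut_off p C {a} = 0"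
  by (simp add: cut_off_def edges_def)

lemma step_eq:
  assumes "p \<ge> 1" shows "step p C (x, y) = cut_off p C {grid p x, grid p y}"
proof (cases "(x, y) \<in> unit_square")
  case False
  then have "\<not> (grid p x \<in> {1..p} \<and> grid p y \<in> {1..p})"
    using grid_pos_iff[OF assms] by auto
  then have "cut_off p C {grid p x, grid p y} = 0" by (auto simp: cut_off_def edges_insert_iff)
  then show ?thesis using False by (simp add: step_def block_kernel_def)
qed (simp add: step_def block_kernel_def)

lemma step_graphon: "C \<in> weights \<Longrightarrow> step p C \<in> graphons"
  unfolding step_def using cut_off_weights[of C p] grid_measurable
  by (intro block_kernel_graphon) (auto simp: weights_def)

lemma edge_kernel_eq:
  assumes "1 \<le> a" "a < b" "b \<le> p"
  shows "edge_kernel p a b (x, y) = of_bool ({grid p x, grid p y} = {a, b})"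
proof -
  have "p \<ge> 1" "b \<ge> 1" using assms by auto
  then have g: "x \<in> {(real c - 1) / real p<..real c / real p} \<longleftrightarrow> grid p x = c" if "c \<ge> 1" for c x
    using grid_eq_iff that by blast
  show ?thesis unfolding edge_kernel_def
    by (simp only: indicator_def mem_Sigma_iff g[OF assms(1)] g[OF \<open>b \<ge> 1\<close>] doubleton_eq_iff)
       (use assms(2) in auto)
qed

lemma edges_pair: "e \<in> edges p \<Longrightarrow> 1 \<le> Min e \<and> Min e < Max e \<and> Max e \<le> p \<and> e = {Min e, Max e}"
proof -
  assume e: "e \<in> edges p"
  then obtain a b where ab: "e = {a, b}" "a \<noteq> b" unfolding edges_def by (auto simp: card_2_iff)
  then have "a \<in> {1..p}" "b \<in> {1..p}" using e edges_insert_iff by auto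
  then show ?thesis using ab by (cases "a \<le> b") (auto simp: min_def max_def)
qed

lemma sum_edge_kernels:
  assumes "p \<ge> 1"
  shows "(\<Sum>(a, b)\<in>{(a, b). 1 \<le> a \<and> a < b \<and> b \<le> p}. c (a, b) * edge_kernel p a b z)
    = step p (\<lambda>s. c (Min s, Max s)) z"
proof -
  obtain x y where z: "z = (x, y)" by fastforce
  let ?I = "{(a, b). 1 \<le> a \<and> a < b \<and> b \<le> p}"
  let ?s = "{grid p x, grid p y}"
  have fin: "finite ?I" by (rule finite_subset[of _ "{1..p} \<times> {1..p}"]) auto
  have "(\<Sum>(a, b)\<in>?I. c (a, b) * edge_kernel p a b z) = (\<Sum>(a, b)\<in>?I. c (a, b) * of_bool (?s = {a, b}))"
    unfolding z by (intro sum.cong refl) (auto simp: edge_kernel_eq)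
  also have "\<dots> = cut_off p (\<lambda>s. c (Min s, Max s)) ?s"
  proof (cases "?s \<in> edges p")
    case True
    define a b where "a = Min ?s" and "b = Max ?s"
    have ab: "1 \<le> a" "a < b" "b \<le> p" "?s = {a, b}" using edges_pair[OF True] by (auto simp: a_def b_def)
    have iff: "?s = {a', b'} \<longleftrightarrow> (a', b') = (a, b)" if "a' < b'" for a' b'
      unfolding ab(4) using that ab(2) by (auto simp: doubleton_eq_iff)
    have "(\<Sum>(a, b)\<in>?I. c (a, b) * of_bool (?s = {a, b})) = (\<Sum>i\<in>?I. if i = (a, b) then c (a, b) else 0)"
    proof (rule sum.cong[OF refl])
      fix i assume "i \<in> ?I"
      then obtain a' b' where i: "i = (a', b')" "a' < b'" by auto
      show "(case i of (a, b) \<Rightarrow> c (a, b) * of_bool (?s = {a, b})) = (if i = (a, b) then c (a, b) else 0)"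
        unfolding i(1) prod.case iff[OF i(2)] by simp
    qed
    also have "\<dots> = c (a, b)" using fin ab by simp
    finally show ?thesis using True by (simp add: cut_off_def a_def b_def)
  next
    case False
    have "c (a, b) * of_bool (?s = {a, b}) = 0" if "(a, b) \<in> ?I" for a b
      using False that edges_insert_iff[of a b p] by auto
    then show ?thesis using False by (simp add: cut_off_def sum.neutral case_prod_unfold)
  qed
  finally show ?thesis unfolding z step_eq[OF assms] .
qed

lemma step_cong: "(\<And>s. s \<in> edges p \<Longrightarrow> C s = C' s) \<Longrightarrow> step p C = step p C'"
proof -
  assume "\<And>s. s \<in> edges p \<Longrightarrow> C s = C' s"
  then have "cut_off p C = cut_off p C'" by (auto simp: cut_off_def fun_eq_iff)
  then show ?thesis by (simp add: step_def)
qed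

lemma step_corner:
  assumes "a \<in> {1..p}" "b \<in> {1..p}" shows "step p C (real a / real p, real b / real p) = cut_off p C {a, b}"
proof -
  have p: "p \<ge> 1" using assms by auto
  have "grid p (real c / real p) = c" if "c \<in> {1..p}" for c
    using that p by (subst grid_eq_iff) (auto simp: divide_strict_right_mono)
  then show ?thesis using assms by (simp add: step_eq[OF p])
qed

lemma step_graphons_eq:
  assumes p: "p \<ge> 1" shows "step_graphons p = step p ` weights"
proof (intro subset_antisym subsetI)
  fix f assume "f \<in> step_graphons p"
  then obtain c :: "nat \<times> nat \<Rightarrow> real" where f: "f \<in> graphons"
    "f = (\<lambda>z. \<Sum>(a, b)\<in>{(a, b). 1 \<le> a \<and> a < b \<and> b \<le> p}. c (a, b) * edge_kernel p a b z)"
    unfolding step_graphons_def by auto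
  \<comment> \<open>The coefficients are cut off because only their values on edges are constrained
    by \<open>f\<close>. Each of those is a value of \<open>f\<close>, at the upper right corner of
    its block, which belongs to the block.\<close>
  define C where "C = cut_off p (\<lambda>s. c (Min s, Max s))"
  have fC: "f = step p (\<lambda>s. c (Min s, Max s))" unfolding f(2) sum_edge_kernels[OF p] ..
  have "0 \<le> C s \<and> C s \<le> 1" for s
  proof (cases "s \<in> edges p")
    case True
    from edges_pair[OF this] have "Min s \<in> {1..p}" "Max s \<in> {1..p}" "s = {Min s, Max s}" by auto
    then have "f (real (Min s) / real p, real (Max s) / real p) = C s"
      unfolding fC C_def by (metis step_corner)
    then show ?thesis using graphon_bounds[OF f(1)] by metis
  qed (simp add: C_def cut_off_def)
  moreover have "f = step p C" unfolding fC by (rule step_cong) (simp add: C_def cut_off_def)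
  ultimately show "f \<in> step p ` weights" by (auto simp: weights_def)
next
  fix f assume "f \<in> step p ` weights"
  then obtain C where C: "C \<in> weights" "f = step p C" by auto
  have "f = (\<lambda>z. \<Sum>(a, b)\<in>{(a, b). 1 \<le> a \<and> a < b \<and> b \<le> p}. (\<lambda>(a, b). C {a, b}) (a, b) * edge_kernel p a b z)"
    unfolding sum_edge_kernels[OF p] C(2) using edges_pair by (intro step_cong) auto
  then have "f \<in> {\<lambda>z. \<Sum>(a, b)\<in>{(a, b). 1 \<le> a \<and> a < b \<and> b \<le> p}. c (a, b) * edge_kernel p a b z
       | c :: nat \<times> nat \<Rightarrow> real. True}"
    by (intro CollectI exI[of _ "\<lambda>(a, b). C {a, b}"] conjI TrueI)
  then show "f \<in> step_graphons p" unfolding step_graphons_def using step_graphon[OF C(1)] C(2) by simp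
qed

text \<open>Rounding up to multiples of \<open>1 / (p * q)\<close> and then to multiples of
  \<open>1 / p\<close> is the same as rounding up once.\<close>

lemma grid_refine: "q \<ge> 1 \<Longrightarrow> grid p x = nat \<lceil>real (grid (p * q) x) / real q\<rceil>"
proof (cases "0 \<le> x")
  case True
  assume q: "q \<ge> 1"
  have nn: "0 \<le> \<lceil>real (p * q) * x\<rceil>" using True by (simp add: order_less_le_trans[of _ 0])
  have "\<lceil>real_of_int \<lceil>real (p * q) * x\<rceil> / real q\<rceil> = \<lceil>real p * x\<rceil>"
  proof (rule ceiling_unique)
    have "real (p * q) * x \<le> of_int \<lceil>real (p * q) * x\<rceil>" by (rule le_of_int_ceiling)
    then have "real p * x \<le> of_int \<lceil>real (p * q) * x\<rceil> / real q" using q by (simp add: field_simps)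
    then show "of_int \<lceil>real p * x\<rceil> - 1 < real_of_int \<lceil>real (p * q) * x\<rceil> / real q" by linarith
    have "real (p * q) * x \<le> real_of_int (\<lceil>real p * x\<rceil> * int q)"
      using mult_right_mono[OF le_of_int_ceiling[of "real p * x"], of "real q"] by (simp add: ac_simps)
    then have "\<lceil>real (p * q) * x\<rceil> \<le> \<lceil>real p * x\<rceil> * int q" by (simp only: ceiling_le_iff)
    then have "real_of_int \<lceil>real (p * q) * x\<rceil> \<le> real_of_int (\<lceil>real p * x\<rceil> * int q)" by (simp only: of_int_le_iff)
    then show "real_of_int \<lceil>real (p * q) * x\<rceil> / real q \<le> of_int \<lceil>real p * x\<rceil>" using q by (simp add: field_simps)
  qed
  then show ?thesis using nn by (simp add: grid_def)
next
  case False
  then have "real r * x \<le> 0" for r by (simp add: mult_nonneg_nonpos)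
  then have "grid r x = 0" for r by (simp add: grid_def ceiling_le_iff)
  then show ?thesis by simp
qed

text \<open>Each coarse block is a union of fine blocks, and a fine edge takes the weight of its
  coarse image. Fine edges inside one coarse block get weight 0, as the diagonal block did.\<close>

lemma step_refine:
  assumes "C \<in> weights" "p \<ge> 1" "q \<ge> 1" shows "\<exists>C'\<in>weights. step p C = step (p * q) C'"
proof -
  define h where "h a = nat \<lceil>real a / real q\<rceil>" for a
  define C' where "C' s = cut_off p C (h ` s)" for s
  have pq: "p * q \<ge> 1" using assms by simp
  have "step p C (x, y) = step (p * q) C' (x, y)" for x y
  proof -
    have g: "grid p t = h (grid (p * q) t)" for t unfolding h_def using grid_refine[OF assms(3)] .
    \<comment> \<open>Equal fine labels give equal coarse labels, and a fine label outside the range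
      gives a coarse label outside the range.\<close>
    have "cut_off p C {grid p x, grid p y} = 0" if "{grid (p * q) x, grid (p * q) y} \<notin> edges (p * q)"
    proof -
      have "{grid p x, grid p y} \<notin> edges p"
        using that g[of x] g[of y] grid_pos_iff[OF assms(2)] grid_pos_iff[OF pq]
        unfolding edges_insert_iff by metis
      then show ?thesis by (simp add: cut_off_def)
    qed
    then show ?thesis unfolding step_eq[OF assms(2)] step_eq[OF pq]
      by (simp add: cut_off_def[of "p * q"] C'_def g)
  qed
  then have "step p C = step (p * q) C'" by auto
  moreover have "C' \<in> weights" using cut_off_weights[OF assms(1)] by (auto simp: C'_def weights_def)
  ultimately show ?thesis by blast
qed

lemma step_shuffle:
  assumes p: "p \<ge> 1" and \<pi>: "bij_betw \<pi> {1..p} {1..p}"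
  shows "relabel (step p C) (shuffle p \<pi>) = step p (\<lambda>s. C (\<pi> ` s))"
proof -
  have "cut_off p C {grid p (shuffle p \<pi> x), grid p (shuffle p \<pi> y)}
      = cut_off p (\<lambda>s. C (\<pi> ` s)) {grid p x, grid p y}" if xy: "x \<in> {0..1}" "y \<in> {0..1}" for x y
  proof (cases "0 < x \<and> 0 < y")
    case True
    then have g: "grid p (shuffle p \<pi> x) = \<pi> (grid p x)" "grid p (shuffle p \<pi> y) = \<pi> (grid p y)"
      using grid_shuffle(1)[OF p \<pi>] xy by auto
    have xy': "grid p x \<in> {1..p}" "grid p y \<in> {1..p}" using grid_pos_iff[OF p] True xy by auto
    then have "{\<pi> (grid p x), \<pi> (grid p y)} \<in> edges p \<longleftrightarrow> {grid p x, grid p y} \<in> edges p"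
      using bij_betwE[OF \<pi>] inj_on_eq_iff[OF bij_betw_imp_inj_on[OF \<pi>] xy']
      unfolding edges_insert_iff by simp
    then show ?thesis by (simp add: cut_off_def g)
  next
    case False
    then have "x = 0 \<or> y = 0" using xy by auto
    then show ?thesis by (auto simp: cut_off_def edges_insert_iff shuffle_def grid_0)
  qed
  then show ?thesis unfolding step_def relabel_block_kernel[OF shuffle_mp_group[OF p \<pi>]]
    by (auto simp: block_kernel_def fun_eq_iff)
qed

section \<open>Coefficients of the Taylor terms and their expansion in densities\<close>

text \<open>The directions are the step kernels of single edges; a step graphon is their combination
  with the edge weights as coordinates, and \<open>Cn_along_rays\<close> makes the m-th derivative
  at 0 polynomial in them.\<close>

lemma taylor_term_step_polynomial:
  assumes F: "Cn_function n F" and m: "m \<le> n" and p: "p \<ge> 1"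
  shows "\<exists>q. \<forall>C\<in>weights. taylor_term F m (step p C) = (\<Sum>\<alpha>\<in>edge_multisets p m. q \<alpha> * (\<Prod>e\<in>#\<alpha>. C e))"
proof -
  define N where "N = card (edges p)"
  obtain en where en: "bij_betw en {..<N} (edges p)"
    using ex_bij_betw_nat_finite[OF finite_edges[of p]] unfolding N_def atLeast0LessThan by blast
  define g where "g i = step p (\<lambda>s. of_bool (s = en i))" for i
  have g: "g i \<in> graphons" for i unfolding g_def by (intro step_graphon) (auto simp: weights_def)
  obtain d where d: "\<forall>c\<in>Rn N. (\<lambda>z. \<Sum>i<N. c i * g i z) \<in> graphons \<longrightarrow>
     (\<exists>\<psi>. (\<forall>l\<in>ray (\<lambda>z. \<Sum>i<N. c i * g i z). \<psi> 0 l = F (\<lambda>z. l * (\<Sum>i<N. c i * g i z)))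
       \<and> (\<forall>k<n. \<forall>t. (\<psi> k has_real_derivative \<psi> (Suc k) t) (at t))
       \<and> (\<forall>k\<le>n. continuous_on UNIV (\<psi> k))
       \<and> (\<forall>k\<le>n. \<psi> k 0 = (\<Sum>w\<in>words N k. prod_list (map c w) * d w)))"
    using Cn_along_rays[where g = g and N = N, OF F g] by blast
  define ms where "ms w = mset (map en w)" for w
  \<comment> \<open>Words with the same letters give the same monomial, so their coefficients are
    collected.\<close>
  define q where "q \<alpha> = (\<Sum>w | w \<in> words N m \<and> ms w = \<alpha>. d w) / fact m" for \<alpha>
  have ms: "ms w \<in> edge_multisets p m" if "w \<in> words N m" for w
    using that bij_betwE[OF en] by (auto simp: words_def ms_def edge_multisets_edges)
  show ?thesis
  proof (intro exI[of _ q] ballI)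
    fix C assume C: "C \<in> weights"
    define c where "c i = (if i < N then C (en i) else 0)" for i
    have c: "c \<in> Rn N" by (auto simp: c_def Rn_def)
    have sum: "(\<Sum>i<N. c i * g i z) = step p C z" for z
    proof -
      obtain x y where z: "z = (x, y)" by fastforce
      let ?s = "{grid p x, grid p y}"
      have "(\<Sum>i<N. c i * g i z) = (\<Sum>i<N. (\<lambda>e. C e * cut_off p (\<lambda>s. of_bool (s = e)) ?s) (en i))"
        by (intro sum.cong refl) (simp add: c_def g_def z step_eq[OF p])
      also have "\<dots> = (\<Sum>e\<in>edges p. C e * cut_off p (\<lambda>s. of_bool (s = e)) ?s)"
        by (rule sum.reindex_bij_betw[OF en])
      also have "\<dots> = (\<Sum>e\<in>edges p. if ?s = e then C e else 0)"
        by (intro sum.cong refl) (auto simp: cut_off_def)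
      also have "\<dots> = cut_off p C ?s" by (simp add: cut_off_def finite_edges)
      finally show ?thesis by (simp add: z step_eq[OF p])
    qed
    from mp[OF bspec[OF d c, unfolded sum] step_graphon[OF C]] obtain \<psi> where
      \<psi>': "(\<forall>l\<in>ray (step p C). \<psi> 0 l = F (\<lambda>z. l * step p C z))
       \<and> (\<forall>k<n. \<forall>t. (\<psi> k has_real_derivative \<psi> (Suc k) t) (at t))
       \<and> (\<forall>k\<le>n. continuous_on UNIV (\<psi> k))
       \<and> (\<forall>k\<le>n. \<psi> k 0 = (\<Sum>w\<in>words N k. prod_list (map c w) * d w))" ..
    have \<psi>: "\<And>l. l \<in> ray (step p C) \<Longrightarrow> \<psi> 0 l = F (\<lambda>z. l * step p C z)"
       "\<And>k t. k < n \<Longrightarrow> (\<psi> k has_real_derivative \<psi> (Suc k) t) (at t)"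
       "\<psi> m 0 = (\<Sum>w\<in>words N m. prod_list (map c w) * d w)" using \<psi>' m by auto
    have prod: "prod_list (map c w) = (\<Prod>e\<in>#ms w. C e)" if "w \<in> words N m" for w
    proof -
      have "map c w = map C (map en w)" using that by (auto simp: words_def c_def)
      moreover have "(\<Prod>e\<in>#ms w. C e) = prod_list (map C (map en w))"
        by (simp only: ms_def prod_mset_prod_list flip: mset_map)
      ultimately show ?thesis by (simp only:)
    qed
    have "taylor_term F m (step p C) = (\<Sum>w\<in>words N m. (\<Prod>e\<in>#ms w. C e) * d w) / fact m"
      using taylor_term_ray[where \<psi> = \<psi>, OF step_graphon[OF C] \<psi>(1,2) m] \<psi>(3) prod by simp
    also have "(\<Sum>w\<in>words N m. (\<Prod>e\<in>#ms w. C e) * d w)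
      = (\<Sum>\<alpha>\<in>edge_multisets p m. \<Sum>w | w \<in> words N m \<and> ms w = \<alpha>. (\<Prod>e\<in>#ms w. C e) * d w)"
      by (rule sum.group[symmetric]) (use ms finite_words finite_edge_multisets in auto)
    also have "\<dots> = (\<Sum>\<alpha>\<in>edge_multisets p m. (\<Prod>e\<in>#\<alpha>. C e) * (\<Sum>w | w \<in> words N m \<and> ms w = \<alpha>. d w))"
      by (intro sum.cong refl) (simp add: sum_distrib_left)
    also have "\<dots> / fact m = (\<Sum>\<alpha>\<in>edge_multisets p m. q \<alpha> * (\<Prod>e\<in>#\<alpha>. C e))"
      unfolding q_def sum_divide_distrib[of _ "edge_multisets p m"] by (intro sum.cong refl) simp
    finally show "taylor_term F m (step p C) = (\<Sum>\<alpha>\<in>edge_multisets p m. q \<alpha> * (\<Prod>e\<in>#\<alpha>. C e))" .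
  qed
qed

lemma edge_monomials_independent:
  assumes "\<And>C. C \<in> weights \<Longrightarrow> (\<Sum>\<alpha>\<in>edge_multisets p m. k \<alpha> * (\<Prod>e\<in>#\<alpha>. C e)) = (0::real)"
    and "\<alpha> \<in> edge_multisets p m"
  shows "k \<alpha> = 0"
  by (rule monomials_independent[OF finite_edges[of p] finite_edge_multisets[of p m]])
     (use assms in \<open>auto simp: edge_multisets_edges weights_def\<close>)

text \<open>Permuting the blocks leaves the Taylor term unchanged but permutes the monomials;
  independence of monomials then compares the coefficients.\<close>

lemma taylor_coefficients_invariant:
  assumes F: "class_function F" "Cn_function n F" and m: "m \<le> n" and p: "p \<ge> 1"
    and q: "\<And>C. C \<in> weights \<Longrightarrow> taylor_term F m (step p C) = (\<Sum>\<alpha>\<in>edge_multisets p m. q \<alpha> * (\<Prod>e\<in>#\<alpha>. C e))"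
    and \<pi>: "bij_betw \<pi> {1..p} {1..p}" and \<alpha>: "\<alpha> \<in> edge_multisets p m"
  shows "q (push \<pi> \<alpha>) = q \<alpha>"
proof -
  let ?X = "edge_multisets p m"
  define \<rho> where "\<rho> = inv_into {1..p} \<pi>"
  have \<rho>: "bij_betw \<rho> {1..p} {1..p}" unfolding \<rho>_def by (rule bij_betw_inv_into[OF \<pi>])
  \<comment> \<open>Substituting the permuted weights moves coefficients by the inverse permutation,
    hence \<rho>. The claim is the instance at \<open>push \<pi> \<alpha>\<close>.\<close>
  have "q (push \<rho> \<beta>) - q \<beta> = 0" if \<beta>: "\<beta> \<in> ?X" for \<beta>
  proof (rule edge_monomials_independent[OF _ \<beta>])
    fix C assume C: "C \<in> weights"
    then have C\<pi>: "(\<lambda>s. C (\<pi> ` s)) \<in> weights" by (auto simp: weights_def)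
    have "(\<Sum>\<beta>\<in>?X. q (push \<rho> \<beta>) * (\<Prod>e\<in>#\<beta>. C e)) = (\<Sum>\<alpha>\<in>?X. q \<alpha> * (\<Prod>e\<in>#\<alpha>. C (\<pi> ` e)))"
    proof (rule sum.reindex_bij_witness[of _ "push \<pi>" "push \<rho>"])
      fix \<beta> assume \<beta>: "\<beta> \<in> ?X"
      show inv: "push \<pi> (push \<rho> \<beta>) = \<beta>" "push \<rho> (push \<pi> \<beta>) = \<beta>"
        unfolding \<rho>_def by (rule push_inv[OF \<beta> \<pi>])+
      show "push \<rho> \<beta> \<in> ?X" "push \<pi> \<beta> \<in> ?X" by (rule push_edge_multisets[OF \<beta>], fact)+
      have "(\<Prod>e\<in>#push \<rho> \<beta>. C (\<pi> ` e)) = (\<Prod>e\<in>#push \<pi> (push \<rho> \<beta>). C e)"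
        by (simp only: push_def[of \<pi>] image_mset.compositionality comp_def)
      then show "q (push \<rho> \<beta>) * (\<Prod>e\<in>#push \<rho> \<beta>. C (\<pi> ` e)) = q (push \<rho> \<beta>) * (\<Prod>e\<in>#\<beta>. C e)"
        by (simp only: inv)
    qed
    also have "\<dots> = taylor_term F m (step p (\<lambda>s. C (\<pi> ` s)))" by (rule q[OF C\<pi>, symmetric])
    also have "\<dots> = taylor_term F m (step p C)"
      using taylor_term_relabel[OF F m step_graphon[OF C, of p] _ shuffle_mp_group[OF p \<pi>]]
        step_graphon[OF C\<pi>, of p]
      unfolding step_shuffle[OF p \<pi>] by simp
    finally show "(\<Sum>\<beta>\<in>?X. (q (push \<rho> \<beta>) - q \<beta>) * (\<Prod>e\<in>#\<beta>. C e)) = 0"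
      by (simp add: q[OF C] left_diff_distrib sum_subtractf)
  qed
  from this[OF push_edge_multisets[OF \<alpha> \<pi>]] show ?thesis
    using push_inv(1)[OF \<alpha> \<pi>] by (simp add: \<rho>_def)
qed

text \<open>The block map of the relabelled kernel is \<open>grid p \<circ> \<sigma>\<close>, with
  blocks of the same measures, so \<sigma> leaves no trace in the value.\<close>

lemma hom_density_step_orbit:
  assumes H: "H \<in> iso_classes m" and p: "p \<ge> 1" and C: "C \<in> weights"
    and \<sigma>: "\<sigma> \<in> mp_group"
  shows "hom_density H (relabel (step p C) \<sigma>) = (1 / real p) ^ card (fst (rep H)) *
    (\<Sum>\<alpha>\<in>edge_multisets p m. real (hom_count p (rep H) \<alpha>) * (\<Prod>e\<in>#\<alpha>. C e))"
proof -
  note rep = rep_iso_class(1)[OF H]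
  have "hom_density H (relabel (step p C) \<sigma>) = (1 / real p) ^ card (fst (rep H)) *
    (\<Sum>\<phi>\<in>fst (rep H) \<rightarrow>\<^sub>E {1..p}. \<Prod>e\<in>#snd (rep H). cut_off p C (\<phi> ` e))"
    unfolding hom_density_eq_rep step_def relabel_block_kernel[OF \<sigma>]
    using rep graphs_with_subset by (intro block_kernel_density block_map_comp block_map_grid p \<sigma>) blast
  also have "(\<Sum>\<phi>\<in>fst (rep H) \<rightarrow>\<^sub>E {1..p}. \<Prod>e\<in>#snd (rep H). cut_off p C (\<phi> ` e))
    = (\<Sum>\<alpha>\<in>edge_multisets p m. real (hom_count p (rep H) \<alpha>) * (\<Prod>e\<in>#\<alpha>. cut_off p C e))"
    by (rule sum_over_maps[where C = "cut_off p C", OF rep cut_off_singleton])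
  also have "\<dots> = (\<Sum>\<alpha>\<in>edge_multisets p m. real (hom_count p (rep H) \<alpha>) * (\<Prod>e\<in>#\<alpha>. C e))"
    by (intro sum.cong refl arg_cong2[where f = "(*)"] arg_cong[where f = prod_mset] image_mset_cong)
       (auto simp: edge_multisets_edges cut_off_def)
  finally show ?thesis .
qed

lemma id_mp_group: "(\<lambda>x. x) \<in> mp_group"
proof -
  have "inv_into {0..1} (\<lambda>x. x) x = x" if "x \<in> {0..1::real}" for x
    using that by (metis (no_types) f_inv_into_f image_ident)
  then have "inv_into {0..1} (\<lambda>x. x) \<in> unit_lebesgue \<rightarrow>\<^sub>M unit_lebesgue"
    by (intro measurable_cong[THEN iffD2, OF _ measurable_ident]) auto
  then show ?thesis by (auto simp: mp_group_def bij_betw_def distr_id)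
qed

lemma relabel_id: "f \<in> kernels \<Longrightarrow> relabel f (\<lambda>x. x) = f"
  unfolding kernels_def relabel_def by (auto simp: fun_eq_iff)

lemma hom_density_step:
  assumes "H \<in> iso_classes m" "p \<ge> 1" "C \<in> weights"
  shows "hom_density H (step p C) = (1 / real p) ^ card (fst (rep H)) *
    (\<Sum>\<alpha>\<in>edge_multisets p m. real (hom_count p (rep H) \<alpha>) * (\<Prod>e\<in>#\<alpha>. C e))"
proof -
  have "step p C \<in> kernels" using step_graphon[OF assms(3)] by (simp add: graphons_def)
  then show ?thesis using hom_density_step_orbit[OF assms id_mp_group] by (simp add: relabel_id)
qed

lemma sum_hom_density_step:
  assumes "p \<ge> 1" "C \<in> weights"
  shows "(\<Sum>H\<in>iso_classes m. a H * hom_density H (step p C)) =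
    (\<Sum>\<alpha>\<in>edge_multisets p m. (\<Sum>H\<in>iso_classes m. a H *
       ((1 / real p) ^ card (fst (rep H)) * real (hom_count p (rep H) \<alpha>))) * (\<Prod>e\<in>#\<alpha>. C e))"
proof -
  have "(\<Sum>H\<in>iso_classes m. a H * hom_density H (step p C)) =
    (\<Sum>H\<in>iso_classes m. \<Sum>\<alpha>\<in>edge_multisets p m. a H *
       ((1 / real p) ^ card (fst (rep H)) * real (hom_count p (rep H) \<alpha>)) * (\<Prod>e\<in>#\<alpha>. C e))"
    using assms by (intro sum.cong refl) (simp add: hom_density_step sum_distrib_left mult.assoc)
  then show ?thesis by (subst (asm) sum.swap) (simp add: sum_distrib_right)
qed

lemma expansion_on_steps:
  assumes F: "class_function F" "Cn_function n F" and m: "m \<le> n" and p: "p \<ge> 1" "2 * m \<le> p"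
  shows "\<exists>a. \<forall>C\<in>weights. taylor_term F m (step p C) = (\<Sum>H\<in>iso_classes m. a H * hom_density H (step p C))"
proof -
  obtain q where q: "\<And>C. C \<in> weights \<Longrightarrow> taylor_term F m (step p C) = (\<Sum>\<alpha>\<in>edge_multisets p m. q \<alpha> * (\<Prod>e\<in>#\<alpha>. C e))"
    using taylor_term_step_polynomial[OF F(2) m p(1)] by blast
  have "\<exists>a. \<forall>\<alpha>\<in>edge_multisets p m. (\<Sum>H\<in>iso_classes m. a H *
      ((1 / real p) ^ card (fst (rep H)) * real (hom_count p (rep H) \<alpha>))) = q \<alpha>"
    using p taylor_coefficients_invariant[OF F m p(1) q]
    by (intro invariant_coefficients_expand) auto
  then obtain a where a: "\<And>\<alpha>. \<alpha> \<in> edge_multisets p m \<Longrightarrow> (\<Sum>H\<in>iso_classes m. a H *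
      ((1 / real p) ^ card (fst (rep H)) * real (hom_count p (rep H) \<alpha>))) = q \<alpha>" by blast
  show ?thesis
    using q p a by (intro exI[of _ a] ballI) (simp add: sum_hom_density_step)
qed

text \<open>Equality as functions of the weights gives equality of the coefficients of all edge
  monomials, and the triangular system has trivial kernel.\<close>

lemma expansion_unique_on_steps:
  assumes p: "p \<ge> 1" "2 * m \<le> p"
    and eq: "\<And>C. C \<in> weights \<Longrightarrow> (\<Sum>H\<in>iso_classes m. a H * hom_density H (step p C))
        = (\<Sum>H\<in>iso_classes m. b H * hom_density H (step p C))"
    and H: "H \<in> iso_classes m"
  shows "a H = b H"
proof -
  have "(\<lambda>H. a H - b H) H = 0"
  proof (rule hom_counts_independent[OF p(2) _ _ H, where w = "\<lambda>H. (1 / real p) ^ card (fst (rep H))"])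
    fix \<alpha> assume \<alpha>: "\<alpha> \<in> edge_multisets p m"
    show "(\<Sum>H\<in>iso_classes m. (a H - b H) * ((1 / real p) ^ card (fst (rep H)) * real (hom_count p (rep H) \<alpha>))) = 0"
    proof (rule edge_monomials_independent[OF _ \<alpha>])
      fix C assume C: "C \<in> weights"
      have "(\<Sum>H\<in>iso_classes m. (a H - b H) * hom_density H (step p C)) = 0"
        using eq[OF C] by (simp add: left_diff_distrib sum_subtractf)
      then show "(\<Sum>\<alpha>\<in>edge_multisets p m. (\<Sum>H\<in>iso_classes m. (a H - b H) *
         ((1 / real p) ^ card (fst (rep H)) * real (hom_count p (rep H) \<alpha>))) * (\<Prod>e\<in>#\<alpha>. C e)) = 0"
        unfolding sum_hom_density_step[OF p(1) C] .
    qed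
  qed (use p in auto)
  then show ?thesis by simp
qed

lemma step_orbit_cases:
  assumes "f \<in> step_graphon_orbits"
  obtains p C \<sigma> where "p \<ge> 1" "C \<in> weights" "\<sigma> \<in> mp_group" "f = relabel (step p C) \<sigma>"
  using assms that by (fastforce simp: step_graphon_orbits_def all_step_graphons_def step_graphons_eq)

lemma step_in_orbits:
  assumes "p \<ge> 1" "C \<in> weights" shows "step p C \<in> step_graphon_orbits"
proof -
  have "step p C \<in> all_step_graphons"
    using assms by (auto simp: all_step_graphons_def step_graphons_eq)
  moreover have "relabel (step p C) (\<lambda>x. x) = step p C"
    using step_graphon[OF assms(2)] by (intro relabel_id) (simp add: graphons_def)
  ultimately show ?thesis unfolding step_graphon_orbits_def using id_mp_group by force
qed

text \<open>The coefficients found on two partitions agree, since both are determined by their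
  values on a common coarsening with at least \<open>2m\<close> blocks.\<close>
lemma expansion_on_orbits:
  assumes F: "class_function F" "Cn_function n F" and m: "m \<le> n"
  shows "\<exists>a. \<forall>f\<in>step_graphon_orbits. taylor_term F m f = (\<Sum>H\<in>iso_classes m. a H * hom_density H f)"
proof -
  \<comment> \<open>At least \<open>2 * m\<close> blocks, and still a block when
    \<open>m = 0\<close>.\<close>
  define P where "P = 2 * m + 1"
  have P: "P \<ge> 1" "2 * m \<le> P" by (auto simp: P_def)
  obtain a where a: "\<And>C. C \<in> weights \<Longrightarrow>
      taylor_term F m (step P C) = (\<Sum>H\<in>iso_classes m. a H * hom_density H (step P C))"
    using expansion_on_steps[OF F m P] by blast
  show ?thesis
  proof (intro exI[of _ a] ballI)
    fix f assume "f \<in> step_graphon_orbits"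
    then obtain p C \<sigma> where p: "p \<ge> 1" and C: "C \<in> weights" and \<sigma>: "\<sigma> \<in> mp_group"
      and f: "f = relabel (step p C) \<sigma>" by (rule step_orbit_cases)
    have "p * P \<ge> 1" using p P by simp
    moreover have "P \<le> p * P" using p by simp
    then have "2 * m \<le> p * P" using P by linarith
    ultimately obtain b where b: "\<And>C. C \<in> weights \<Longrightarrow>
        taylor_term F m (step (p * P) C) = (\<Sum>H\<in>iso_classes m. b H * hom_density H (step (p * P) C))"
      using expansion_on_steps[OF F m] by blast
    have ab: "a H = b H" if "H \<in> iso_classes m" for H
    proof (rule expansion_unique_on_steps[OF P _ that])
      fix C assume C: "C \<in> weights"
      \<comment> \<open>A step graphon of order \<open>P\<close> is also one of order
        \<open>P * p\<close>, so both expansions describe its Taylor term.\<close>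
      obtain C' where "C' \<in> weights" "step P C = step (P * p) C'" using step_refine[OF C P(1) p] by blast
      then show "(\<Sum>H\<in>iso_classes m. a H * hom_density H (step P C))
          = (\<Sum>H\<in>iso_classes m. b H * hom_density H (step P C))"
        using a[OF C] b[of C'] by (simp add: mult.commute)
    qed
    have "relabel (step p C) \<sigma> \<in> graphons"
    proof -
      have "block_map p (grid p \<circ> \<sigma>)" by (intro block_map_comp block_map_grid p \<sigma>)
      then show ?thesis unfolding step_def relabel_block_kernel[OF \<sigma>]
        using cut_off_weights[OF C, of p]
        by (intro block_kernel_graphon) (auto simp: weights_def block_map_def)
    qed
    then have "taylor_term F m f = taylor_term F m (step p C)"
      unfolding f by (intro taylor_term_relabel[OF F m] step_graphon C \<sigma>)
    also obtain C' where "C' \<in> weights" "step p C = step (p * P) C'" using step_refine[OF C p P(1)] by blast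
    then have "taylor_term F m (step p C) = (\<Sum>H\<in>iso_classes m. b H * hom_density H (step p C))"
      using b by simp
    also have "\<dots> = (\<Sum>H\<in>iso_classes m. a H * hom_density H f)"
      unfolding f using ab hom_density_step_orbit[OF _ p C \<sigma>] hom_density_step[OF _ p C]
      by (intro sum.cong refl) simp
    finally show "taylor_term F m f = (\<Sum>H\<in>iso_classes m. a H * hom_density H f)" .
  qed
qed

section \<open>Approximation of graphons by step graphons\<close>

lemma sigma_finite_unit_lebesgue: "sigma_finite_measure unit_lebesgue"
  using finite_measure_unit_lebesgue by (rule finite_measure.axioms(1))

text \<open>The remaining coordinates have total mass 1, so rectangles get the right measure, and
  rectangles determine the product measure.\<close>

lemma distr_two_coordinates:
  assumes V: "finite V" "u \<in> V" "v \<in> V" "u \<noteq> v"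
  shows "distr (PiM V (\<lambda>_. unit_lebesgue)) (unit_lebesgue \<Otimes>\<^sub>M unit_lebesgue) (\<lambda>x. (x u, x v))
    = unit_lebesgue \<Otimes>\<^sub>M unit_lebesgue"
proof (rule pair_measure_eqI[symmetric])
  interpret product_sigma_finite "\<lambda>_. unit_lebesgue" by (rule product_sigma_finite_unit_lebesgue)
  let ?P = "PiM V (\<lambda>_. unit_lebesgue)"
  have meas: "(\<lambda>x. (x u, x v)) \<in> ?P \<rightarrow>\<^sub>M unit_lebesgue \<Otimes>\<^sub>M unit_lebesgue"
    using V by (intro measurable_Pair measurable_component_singleton)
  fix A B assume A: "A \<in> sets unit_lebesgue" and B: "B \<in> sets unit_lebesgue"
  then have sub: "A \<subseteq> {0..1}" "B \<subseteq> {0..1}"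
    using sets.sets_into_space[OF A] sets.sets_into_space[OF B] by simp_all
  define S where "S i = (if i = u then A else if i = v then B else {0..1::real})" for i
  have S: "S i \<in> sets unit_lebesgue" for i
    using A B sets.top[of unit_lebesgue] by (auto simp: S_def)
  have "emeasure (distr ?P (unit_lebesgue \<Otimes>\<^sub>M unit_lebesgue) (\<lambda>x. (x u, x v))) (A \<times> B)
      = emeasure ?P ((\<lambda>x. (x u, x v)) -` (A \<times> B) \<inter> space ?P)"
    using A B by (intro emeasure_distr meas) auto
  also have "(\<lambda>x. (x u, x v)) -` (A \<times> B) \<inter> space ?P = Pi\<^sub>E V S"
  proof (intro subset_antisym subsetI)
    fix x assume "x \<in> (\<lambda>x. (x u, x v)) -` (A \<times> B) \<inter> space ?P"
    then show "x \<in> Pi\<^sub>E V S" by (auto simp: space_PiM PiE_iff S_def)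
  next
    fix x assume x: "x \<in> Pi\<^sub>E V S"
    have "S i \<subseteq> {0..1}" for i using sub by (simp add: S_def)
    then have "x \<in> V \<rightarrow>\<^sub>E {0..1}" using x by (meson PiE_mono subsetD)
    moreover have "x u \<in> S u" "x v \<in> S v" using PiE_mem[OF x] V by auto
    ultimately show "x \<in> (\<lambda>x. (x u, x v)) -` (A \<times> B) \<inter> space ?P"
      using V(4) by (simp add: space_PiM S_def)
  qed
  also have "emeasure ?P (Pi\<^sub>E V S) = (\<Prod>i\<in>V. emeasure unit_lebesgue (S i))"
    by (rule emeasure_PiM[OF V(1)]) (rule S)
  also have "\<dots> = (\<Prod>i\<in>{u, v}. emeasure unit_lebesgue (S i))"
    using V emeasure_unit_lebesgue by (intro prod.mono_neutral_right) (auto simp: S_def)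
  also have "\<dots> = emeasure unit_lebesgue A * emeasure unit_lebesgue B"
    using V(4) by (simp add: S_def)
  finally show "emeasure unit_lebesgue A * emeasure unit_lebesgue B =
    emeasure (distr ?P (unit_lebesgue \<Otimes>\<^sub>M unit_lebesgue) (\<lambda>x. (x u, x v))) (A \<times> B)" ..
qed (auto intro: sigma_finite_unit_lebesgue)

lemma unit_lebesgue_borel: "(\<lambda>x. x) \<in> unit_lebesgue \<rightarrow>\<^sub>M borel"
  by (intro measurable_restrict_space1 measurable_completion) simp

text \<open>Almost every section of a planar null set is null, and this passes from the Borel
  measures to the interval. It links null sets of the square to the measure under the density
  integral.\<close>

lemma AE_two_coordinates:
  assumes V: "finite V" "u \<in> V" "v \<in> V" "u \<noteq> v" and N: "N \<in> null_sets (lborel :: (real \<times> real) measure)"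
  shows "AE x in PiM V (\<lambda>_. unit_lebesgue). (x u, x v) \<notin> N"
proof -
  let ?P = "PiM V (\<lambda>_. unit_lebesgue)"
  let ?Q = "unit_lebesgue \<Otimes>\<^sub>M unit_lebesgue"
  interpret pair_sigma_finite unit_lebesgue unit_lebesgue
    using sigma_finite_unit_lebesgue by (simp add: pair_sigma_finite_def)
  have meas: "(\<lambda>x. (x u, x v)) \<in> ?P \<rightarrow>\<^sub>M ?Q"
    using V by (intro measurable_Pair measurable_component_singleton)
  have lift: "AE x in unit_lebesgue. R x" if "AE x in lborel. R x" for R :: "real \<Rightarrow> bool"
    using AE_completion[OF that] by (subst AE_restrict_space_iff) (auto elim: eventually_mono)
  have "(\<lambda>z. (fst z, snd z)) \<in> ?Q \<rightarrow>\<^sub>M borel \<Otimes>\<^sub>M borel"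
    by (intro measurable_Pair measurable_compose[OF measurable_fst unit_lebesgue_borel]
        measurable_compose[OF measurable_snd unit_lebesgue_borel])
  then have id: "(\<lambda>z. z) \<in> ?Q \<rightarrow>\<^sub>M borel" by (simp add: borel_prod)
  have "- N \<in> sets borel" using N by (auto dest: null_setsD2 intro: borel_comp)
  from measurable_sets[OF id this] have set: "{z \<in> space ?Q. z \<notin> N} \<in> sets ?Q"
    by (simp add: vimage_def Int_def conj_commute)
  have "AE z in lborel \<Otimes>\<^sub>M lborel. z \<notin> N" using AE_not_in[OF N] unfolding lborel_prod[symmetric] .
  then have "AE x in lborel. AE y in lborel. (x, y) \<notin> N" by (rule lborel_pair.AE_pair)
  then have "AE x in unit_lebesgue. AE y in unit_lebesgue. (x, y) \<notin> N"
    by (intro lift) (auto intro: lift elim: eventually_mono)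
  then have "AE z in ?Q. z \<notin> N" by (intro AE_pair_measure set)
  then have "AE z in distr ?P ?Q (\<lambda>x. (x u, x v)). z \<notin> N" unfolding distr_two_coordinates[OF V] .
  then show ?thesis using AE_distr_iff[OF meas set] by simp
qed

text \<open>Preimages of planar null sets are null by \<open>AE_two_coordinates\<close>, but
  preimages of their subsets are measurable only after completion.\<close>

lemma two_coordinates_measurable:
  assumes V: "finite V" "u \<in> V" "v \<in> V" "u \<noteq> v"
  shows "(\<lambda>x. (x u, x v)) \<in> completion (PiM V (\<lambda>_. unit_lebesgue)) \<rightarrow>\<^sub>M lebesgue_on unit_square"
proof (rule measurable_restrict_space2)
  let ?P = "PiM V (\<lambda>_. unit_lebesgue)"
  show "(\<lambda>x. (x u, x v)) \<in> space (completion ?P) \<rightarrow> unit_square"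
    using V by (auto simp: space_PiM PiE_iff)
  have m: "(\<lambda>x. (x u, x v)) \<in> completion ?P \<rightarrow>\<^sub>M lborel"
  proof (rule measurable_completion)
    have "(\<lambda>x. (x u, x v)) \<in> ?P \<rightarrow>\<^sub>M borel \<Otimes>\<^sub>M borel"
      by (intro measurable_Pair
          measurable_compose[OF measurable_component_singleton[of _ V "\<lambda>_. unit_lebesgue"] unit_lebesgue_borel] V)
    then show "(\<lambda>x. (x u, x v)) \<in> ?P \<rightarrow>\<^sub>M lborel" by (simp add: borel_prod measurable_lborel1)
  qed
  show "(\<lambda>x. (x u, x v)) \<in> completion ?P \<rightarrow>\<^sub>M lebesgue"
  proof (rule completion.measurable_completion2[OF m], rule subsetI)
    fix N :: "(real \<times> real) set" assume N: "N \<in> null_sets lborel"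
    have "AE x in completion ?P. (x u, x v) \<notin> N" by (intro AE_completion AE_two_coordinates V N)
    then have "AE z in distr (completion ?P) lborel (\<lambda>x. (x u, x v)). z \<notin> N"
      using N by (subst AE_distr_iff[OF m]) (auto dest: null_setsD2)
    then show "N \<in> null_sets (distr (completion ?P) lborel (\<lambda>x. (x u, x v)))"
      using N by (subst AE_iff_null_sets) (auto dest: null_setsD2)
  qed
qed

section \<open>Passing densities and expansions to almost everywhere limits\<close>

lemma borel_measurable_prod_mset:
  "(\<And>e. e \<in># E \<Longrightarrow> h e \<in> borel_measurable M) \<Longrightarrow> (\<lambda>x. \<Prod>e\<in>#E. h e x :: real) \<in> borel_measurable M"
  by (induction E) auto

lemma tendsto_prod_mset_real:
  "(\<And>e. e \<in># E \<Longrightarrow> (\<lambda>k. h e k) \<longlonglongrightarrow> (l e :: real)) \<Longrightarrow> (\<lambda>k. \<Prod>e\<in>#E. h e k) \<longlonglongrightarrow> (\<Prod>e\<in>#E. l e)"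
  by (induction E) (auto intro!: tendsto_mult)

lemma prod_mset_unit_interval:
  "(\<And>e. e \<in># E \<Longrightarrow> 0 \<le> h e \<and> h e \<le> (1::real)) \<Longrightarrow> 0 \<le> (\<Prod>e\<in>#E. h e) \<and> (\<Prod>e\<in>#E. h e) \<le> 1"
  by (induction E) (auto intro!: mult_le_one)

text \<open>Dominated convergence with bound 1. Edges have two distinct endpoints, so for almost
  every point all the finitely many edge pairs avoid the exceptional set.\<close>

lemma hom_density_rep_tendsto:
  assumes G: "G \<in> multigraphs" and g: "\<And>k. g k \<in> graphons" and f: "f \<in> graphons"
    and N: "negligible N" and lim: "\<And>z. z \<notin> N \<Longrightarrow> (\<lambda>k. g k z) \<longlonglongrightarrow> f z"
  shows "(\<lambda>k. hom_density_rep G (g k)) \<longlonglongrightarrow> hom_density_rep G f"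
proof -
  obtain V E where VE: "G = (V, E)" by fastforce
  have fin: "finite V" and E: "\<And>e. e \<in># E \<Longrightarrow> e \<subseteq> V \<and> card e = 2"
    using G by (auto simp: VE multigraphs_def)
  have mm: "Min e \<in> V \<and> Max e \<in> V \<and> Min e \<noteq> Max e" if e': "e \<in># E" for e
  proof -
    obtain u v where e: "e = {u, v}" "u \<noteq> v" using E[OF e'] by (auto simp: card_2_iff)
    then show ?thesis using E[OF e'] by (cases "u \<le> v") (auto simp: min_def max_def)
  qed
  \<comment> \<open>Enlarged to a Borel null set, as \<open>AE_two_coordinates\<close>
    requires.\<close>
  obtain N' where N': "N' \<in> null_sets lborel" "N \<subseteq> N'"
    using N unfolding negligible_iff_null_sets null_sets_completion_iff2 by blast
  let ?P = "PiM V (\<lambda>_. unit_lebesgue)"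
  let ?h = "\<lambda>f x. \<Prod>e\<in>#E. f (x (Min e), x (Max e)) :: real"
  have meas: "?h f \<in> borel_measurable (completion ?P)" if "f \<in> graphons" for f
  proof (rule borel_measurable_prod_mset)
    fix e assume "e \<in># E"
    moreover have "f \<in> borel_measurable (lebesgue_on unit_square)"
      using that by (simp add: graphons_def kernels_def)
    ultimately show "(\<lambda>x. f (x (Min e), x (Max e))) \<in> borel_measurable (completion ?P)"
      using mm fin by (intro measurable_compose[OF two_coordinates_measurable]) auto
  qed
  interpret product_sigma_finite "\<lambda>_. unit_lebesgue" by (rule product_sigma_finite_unit_lebesgue)
  have "emeasure ?P (space ?P) = (\<Prod>i\<in>V. emeasure unit_lebesgue (space unit_lebesgue))"
    unfolding space_PiM by (rule emeasure_PiM[OF fin]) (rule sets.top)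
  then have "emeasure (completion ?P) (space (completion ?P)) = 1"
    by (simp only: emeasure_unit_lebesgue emeasure_completion space_completion main_part_sets sets.top) simp
  then interpret C: finite_measure "completion ?P" by (intro finite_measureI) simp
  have ae: "AE x in completion ?P. \<forall>e\<in>set_mset E. (x (Min e), x (Max e)) \<notin> N'"
    using mm fin N'(1) by (intro AE_finite_allI AE_completion AE_two_coordinates) auto
  have "(\<lambda>k. LINT x|completion ?P. ?h (g k) x) \<longlonglongrightarrow> (LINT x|completion ?P. ?h f x)"
  proof (rule integral_dominated_convergence[where w = "\<lambda>_. 1"])
    show "AE x in completion ?P. (\<lambda>k. ?h (g k) x) \<longlonglongrightarrow> ?h f x"
      using ae by eventually_elim (use lim N'(2) in \<open>auto intro!: tendsto_prod_mset_real\<close>)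
    show "AE x in completion ?P. norm (?h (g k) x) \<le> 1" for k
    proof (rule AE_I2)
      fix x show "norm (?h (g k) x) \<le> 1"
        using prod_mset_unit_interval[of E "\<lambda>e. g k (x (Min e), x (Max e))"] graphon_bounds[OF g] by auto
    qed
  qed (use meas f g in auto)
  then show ?thesis by (simp add: hom_density_rep_def VE)
qed

lemma L1_dist_tendsto:
  assumes g: "\<And>k. g k \<in> graphons" and f: "f \<in> graphons"
    and N: "negligible N" and lim: "\<And>z. z \<notin> N \<Longrightarrow> (\<lambda>k. g k z) \<longlonglongrightarrow> f z"
  shows "(\<lambda>k. L1_dist f (g k)) \<longlonglongrightarrow> 0"
proof -
  have ms: "h \<in> borel_measurable (lebesgue_on unit_square)" if "h \<in> graphons" for h
    using that by (simp add: graphons_def kernels_def)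
  interpret C: finite_measure "lebesgue_on unit_square"
    using unit_square_sets
    by (intro finite_measureI) (simp add: emeasure_restrict_space emeasure_unit_square del: emeasure_completion)
  have "AE z in lebesgue. z \<notin> N" using N by (intro AE_not_in) (simp add: negligible_iff_null_sets)
  then have ae: "AE z in lebesgue_on unit_square. z \<notin> N"
    using unit_square_sets by (subst AE_restrict_space_iff) auto
  have "(\<lambda>k. LINT z|lebesgue_on unit_square. \<bar>f z - g k z\<bar>) \<longlonglongrightarrow> (LINT z|lebesgue_on unit_square. 0)"
  proof (rule integral_dominated_convergence[where w = "\<lambda>_. 1"])
    show "AE z in lebesgue_on unit_square. (\<lambda>k. \<bar>f z - g k z\<bar>) \<longlonglongrightarrow> 0"
      using ae
    proof eventually_elim
      case (elim z)
      have "(\<lambda>k. \<bar>f z - g k z\<bar>) \<longlonglongrightarrow> \<bar>f z - f z\<bar>" by (intro tendsto_intros lim[OF elim])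
      then show ?case by simp
    qed
    show "AE z in lebesgue_on unit_square. norm \<bar>f z - g k z\<bar> \<le> 1" for k
    proof (rule AE_I2)
      fix z show "norm \<bar>f z - g k z\<bar> \<le> 1"
        using graphon_bounds[OF f, of z] graphon_bounds[OF g, of k z] by simp
    qed
  qed (use ms[OF f] ms[OF g] in auto)
  then show ?thesis by (simp add: L1_dist_def)
qed

lemma L1_continuous_tendsto:
  assumes "L1_continuous \<Phi>" "f \<in> graphons" "\<And>k. g k \<in> graphons" "(\<lambda>k. L1_dist f (g k)) \<longlonglongrightarrow> 0"
  shows "(\<lambda>k. \<Phi> (g k)) \<longlonglongrightarrow> \<Phi> f"
proof (rule LIMSEQ_I)
  fix \<epsilon> :: real assume "\<epsilon> > 0"
  then obtain \<delta> where \<delta>: "\<delta> > 0" "\<And>g. g \<in> graphons \<Longrightarrow> L1_dist f g < \<delta> \<Longrightarrow> \<bar>\<Phi> g - \<Phi> f\<bar> < \<epsilon>"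
    using assms(1,2) unfolding L1_continuous_def by blast
  obtain K where "\<And>k. k \<ge> K \<Longrightarrow> norm (L1_dist f (g k) - 0) < \<delta>" using LIMSEQ_D[OF assms(4) \<delta>(1)] by blast
  then have "norm (\<Phi> (g k) - \<Phi> f) < \<epsilon>" if "k \<ge> K" for k
    using \<delta>(2)[OF assms(3)[of k]] that by fastforce
  then show "\<exists>K. \<forall>k\<ge>K. norm (\<Phi> (g k) - \<Phi> f) < \<epsilon>" by blast
qed

text \<open>Almost everywhere convergence of graphons implies L1 convergence, which controls the
  left side, and convergence of the densities on the right.\<close>

lemma expansion_limit:
  assumes \<Phi>: "L1_continuous \<Phi>" and g: "\<And>k. g k \<in> graphons" and f: "f \<in> graphons"
    and N: "negligible N" and lim: "\<And>z. z \<notin> N \<Longrightarrow> (\<lambda>k. g k z) \<longlonglongrightarrow> f z"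
    and eq: "\<And>k. \<Phi> (g k) = (\<Sum>H\<in>iso_classes m. a H * hom_density H (g k))"
  shows "\<Phi> f = (\<Sum>H\<in>iso_classes m. a H * hom_density H f)"
proof (rule LIMSEQ_unique)
  show "(\<lambda>k. \<Phi> (g k)) \<longlonglongrightarrow> \<Phi> f"
    by (intro L1_continuous_tendsto[OF \<Phi> f g] L1_dist_tendsto[OF g f N lim])
  show "(\<lambda>k. \<Phi> (g k)) \<longlonglongrightarrow> (\<Sum>H\<in>iso_classes m. a H * hom_density H f)"
    unfolding eq hom_density_eq_rep
    using rep_iso_class(1) graphs_with_subset
    by (intro tendsto_sum tendsto_mult tendsto_const hom_density_rep_tendsto[OF _ g f N lim]) blast
qed

section \<open>Continuous and step approximations of graphons\<close>

text \<open>Clipping forces values in the unit interval, and reading \<open>g\<close> only on the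
  triangle where the first coordinate is the smaller one forces symmetry; both preserve continuity
  on the square.\<close>

definition truncated :: "kernel \<Rightarrow> kernel" where
  "truncated g = (\<lambda>(x, y). if (x, y) \<in> unit_square then max 0 (min 1 (g (min x y, max x y))) else 0)"

lemma truncated_graphon:
  assumes "continuous_on UNIV g" shows "truncated g \<in> graphons"
proof -
  have "continuous_on UNIV (\<lambda>z. max 0 (min 1 (g (min (fst z) (snd z), max (fst z) (snd z)))))"
    by (intro continuous_intros continuous_on_compose2[OF assms]) auto
  then have "(\<lambda>z. max 0 (min 1 (g (min (fst z) (snd z), max (fst z) (snd z))))) \<in> borel_measurable borel"
    by (rule borel_measurable_continuous_onI)
  then have "(\<lambda>z. max 0 (min 1 (g (min (fst z) (snd z), max (fst z) (snd z)))))
      \<in> borel_measurable (lebesgue_on unit_square)"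
    by (intro measurable_restrict_space1 measurable_completion) (simp add: measurable_lborel1)
  then have "truncated g \<in> borel_measurable (lebesgue_on unit_square)"
    by (rule measurable_cong[THEN iffD1, rotated]) (auto simp: truncated_def)
  moreover have "0 \<le> truncated g z \<and> truncated g z \<le> 1" for z
    by (auto simp: truncated_def split: prod.splits)
  moreover have "\<forall>z. \<bar>truncated g z\<bar> \<le> 1" by (auto simp: truncated_def split: prod.splits)
  moreover have "truncated g (x, y) = truncated g (y, x)" for x y
    by (auto simp: truncated_def min.commute max.commute)
  moreover have "z \<notin> unit_square \<Longrightarrow> truncated g z = 0" for z
    by (auto simp: truncated_def split: prod.splits)
  ultimately show ?thesis unfolding graphons_def kernels_def by blast
qed

text \<open>The quotient is the right end of the block containing \<open>x\<close>, hence within one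
  block length of it.\<close>

lemma grid_scaled_tendsto: "0 < x \<Longrightarrow> (\<lambda>k. real (grid (Suc k) x) / real (Suc k)) \<longlonglongrightarrow> x"
proof -
  assume x: "0 < x"
  have b: "real (Suc k) * x \<le> real (grid (Suc k) x) \<and> real (grid (Suc k) x) \<le> real (Suc k) * x + 1" for k
  proof -
    have "0 \<le> \<lceil>real (Suc k) * x\<rceil>" using x by (simp add: order_less_le_trans[of "- 1" 0])
    then have "real (grid (Suc k) x) = of_int \<lceil>real (Suc k) * x\<rceil>" by (simp add: grid_def)
    then show ?thesis by linarith
  qed
  show ?thesis
  proof (rule real_tendsto_sandwich[where f = "\<lambda>_. x" and h = "\<lambda>k. x + inverse (real (Suc k))"])
    show "\<forall>\<^sub>F k in sequentially. x \<le> real (grid (Suc k) x) / real (Suc k)"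
      using b by (intro always_eventually allI) (simp add: pos_le_divide_eq mult.commute)
    show "\<forall>\<^sub>F k in sequentially. real (grid (Suc k) x) / real (Suc k) \<le> x + inverse (real (Suc k))"
    proof (intro always_eventually allI)
      fix k
      have "real (grid (Suc k) x) / real (Suc k) \<le> (real (Suc k) * x + 1) / real (Suc k)"
        using b by (intro divide_right_mono) auto
      also have "\<dots> = x + inverse (real (Suc k))" by (simp add: add_divide_distrib inverse_eq_divide)
      finally show "real (grid (Suc k) x) / real (Suc k) \<le> x + inverse (real (Suc k))" .
    qed
    show "(\<lambda>k. x + inverse (real (Suc k))) \<longlonglongrightarrow> x"
      using tendsto_add[OF tendsto_const LIMSEQ_inverse_real_of_nat, of x] by simp
  qed simp
qed

text \<open>The value at the corner of the block; taking the smaller label first agrees with the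
  triangle read by \<open>truncated\<close>.\<close>

definition sampled :: "kernel \<Rightarrow> nat \<Rightarrow> nat set \<Rightarrow> real" where
  "sampled g p s = max 0 (min 1 (g (real (Min s) / real p, real (Max s) / real p)))"

lemma sampled_weights: "sampled g p \<in> weights"
  by (auto simp: weights_def sampled_def)

text \<open>Where sampling may fail: step graphons vanish on the diagonal, and on the axes a label
  is 0.\<close>

definition null_lines :: "(real \<times> real) set" where
  "null_lines = {z. fst z = snd z} \<union> {z. fst z = 0} \<union> {z. snd z = 0}"

lemma negligible_null_lines: "negligible null_lines"
proof -
  have "negligible {z::real \<times> real. (1, -1) \<bullet> z = 0}" "negligible {z::real \<times> real. (1, 0) \<bullet> z = 0}"
    "negligible {z::real \<times> real. (0, 1) \<bullet> z = 0}"
    by (intro negligible_hyperplane; simp add: zero_prod_def)+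
  moreover have "{z::real \<times> real. (1, -1) \<bullet> z = 0} = {z. fst z = snd z}"
    "{z::real \<times> real. (1, 0) \<bullet> z = 0} = {z. fst z = 0}" "{z::real \<times> real. (0, 1) \<bullet> z = 0} = {z. snd z = 0}"
    by (auto simp: inner_prod_def)
  ultimately show ?thesis unfolding null_lines_def by (simp add: negligible_Un)
qed

lemma step_sampled_tendsto:
  assumes g: "continuous_on UNIV g" and z: "z \<notin> null_lines"
  shows "(\<lambda>k. step (Suc k) (sampled g (Suc k)) z) \<longlonglongrightarrow> truncated g z"
proof -
  obtain x y where xy: "z = (x, y)" by fastforce
  show ?thesis
  proof (cases "z \<in> unit_square")
    case False
    then have "step (Suc k) (sampled g (Suc k)) z = 0" for k by (auto simp: step_def block_kernel_def xy)
    moreover have "truncated g z = 0" using False by (auto simp: truncated_def xy)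
    ultimately show ?thesis by simp
  next
    case True
    then have r: "0 < x" "x \<le> 1" "0 < y" "y \<le> 1" "x \<noteq> y" using z by (auto simp: xy null_lines_def)
    let ?X = "\<lambda>k. real (grid (Suc k) x) / real (Suc k)"
    let ?Y = "\<lambda>k. real (grid (Suc k) y) / real (Suc k)"
    have lim: "?X \<longlonglongrightarrow> x" "?Y \<longlonglongrightarrow> y" by (rule grid_scaled_tendsto[OF r(1)], rule grid_scaled_tendsto[OF r(3)])
    \<comment> \<open>Off the diagonal the two labels eventually differ, so the pair is an edge and
      its weight is not cut off.\<close>
    have "(\<lambda>k. ?X k - ?Y k) \<longlonglongrightarrow> x - y" by (intro tendsto_diff lim)
    then have "\<forall>\<^sub>F k in sequentially. ?X k - ?Y k \<noteq> 0"
      using r by (intro tendsto_imp_eventually_ne) auto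
    then have ev: "\<forall>\<^sub>F k in sequentially. max 0 (min 1 (g (min (?X k) (?Y k), max (?X k) (?Y k))))
        = step (Suc k) (sampled g (Suc k)) z"
    proof eventually_elim
      case (elim k)
      let ?a = "grid (Suc k) x" and ?b = "grid (Suc k) y"
      have ne: "?a \<noteq> ?b" using elim by auto
      have "{?a, ?b} \<in> edges (Suc k)"
        using grid_pos_iff[of "Suc k"] r ne unfolding edges_insert_iff by auto
      then have "step (Suc k) (sampled g (Suc k)) z = sampled g (Suc k) {?a, ?b}"
        unfolding xy by (subst step_eq) (auto simp: cut_off_def)
      also have "\<dots> = max 0 (min 1 (g (real (min ?a ?b) / real (Suc k), real (max ?a ?b) / real (Suc k))))"
        by (simp add: sampled_def)
      also have "real (min ?a ?b) / real (Suc k) = min (?X k) (?Y k)"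
        by (auto simp: min_def divide_right_mono divide_le_cancel)
      also have "real (max ?a ?b) / real (Suc k) = max (?X k) (?Y k)"
        by (auto simp: max_def divide_right_mono divide_le_cancel)
      finally show ?case ..
    qed
    have "(\<lambda>k. (min (?X k) (?Y k), max (?X k) (?Y k))) \<longlonglongrightarrow> (min x y, max x y)"
      by (intro tendsto_intros lim)
    then have "(\<lambda>k. g (min (?X k) (?Y k), max (?X k) (?Y k))) \<longlonglongrightarrow> g (min x y, max x y)"
      by (intro continuous_on_tendsto_compose[OF g]) auto
    then have "(\<lambda>k. max 0 (min 1 (g (min (?X k) (?Y k), max (?X k) (?Y k))))) \<longlonglongrightarrow> max 0 (min 1 (g (min x y, max x y)))"
      by (intro tendsto_intros)
    then have "(\<lambda>k. step (Suc k) (sampled g (Suc k)) z) \<longlonglongrightarrow> max 0 (min 1 (g (min x y, max x y)))"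
      by (rule Lim_transform_eventually[OF _ ev])
    then show ?thesis using True by (simp add: truncated_def xy)
  qed
qed

lemma graphon_limit_of_continuous:
  assumes f: "f \<in> graphons"
  obtains g N where "negligible N" "\<And>k. continuous_on UNIV (g k)"
    "\<And>z. z \<notin> N \<Longrightarrow> (\<lambda>k. truncated (g k) z) \<longlonglongrightarrow> f z"
proof -
  have fm: "f \<in> borel_measurable (lebesgue_on unit_square)" and out: "\<And>z. z \<notin> unit_square \<Longrightarrow> f z = 0"
    and sym: "\<And>x y. f (x, y) = f (y, x)"
    using f unfolding graphons_def kernels_def by blast+
  have "(\<lambda>z. if z \<in> unit_square then f z else 0) \<in> borel_measurable lebesgue"
    using fm unit_square_sets by (subst (asm) measurable_restrict_space_iff[where c = 0]) auto
  moreover have "(\<lambda>z. if z \<in> unit_square then f z else 0) = f" using out by auto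
  ultimately have "f measurable_on UNIV" by (intro lebesgue_measurable_imp_measurable_on_real) auto
  then obtain N g where N: "negligible N" and g: "\<And>k. continuous_on UNIV (g k)"
    and lim: "\<And>z. z \<notin> N \<Longrightarrow> (\<lambda>k. g k z) \<longlonglongrightarrow> f z"
    unfolding measurable_on_def by auto
  \<comment> \<open>\<open>truncated\<close> may read \<open>g\<close> at the mirror image of the
    point, so the mirror image of the exceptional set has to be excluded as well.\<close>
  have "negligible (prod.swap ` N)"
  proof (rule negligible_differentiable_image_negligible[OF _ N])
    have "bounded_linear (prod.swap :: real \<times> real \<Rightarrow> real \<times> real)"
      unfolding prod.swap_def by (intro bounded_linear_Pair bounded_linear_fst bounded_linear_snd)
    then show "(prod.swap :: real \<times> real \<Rightarrow> real \<times> real) differentiable_on N"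
      by (intro linear_imp_differentiable_on bounded_linear.linear)
  qed simp
  then have N2: "negligible (N \<union> prod.swap ` N)" using N by (rule negligible_Un[rotated])
  have L: "(\<lambda>k. truncated (g k) z) \<longlonglongrightarrow> f z" if z: "z \<notin> N \<union> prod.swap ` N" for z
  proof -
    obtain x y where xy: "z = (x, y)" by fastforce
    have "(y, x) \<notin> N"
    proof
      assume "(y, x) \<in> N"
      then have "prod.swap (y, x) \<in> prod.swap ` N" by (rule imageI)
      then show False using z by (simp add: xy)
    qed
    then have "(min x y, max x y) \<notin> N" using z by (auto simp: xy min_def max_def)
    then have "(\<lambda>k. g k (min x y, max x y)) \<longlonglongrightarrow> f (min x y, max x y)" by (rule lim)
    also have "f (min x y, max x y) = f z" using sym by (auto simp: xy min_def max_def)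
    finally have "(\<lambda>k. max 0 (min 1 (g k (min x y, max x y)))) \<longlonglongrightarrow> max 0 (min 1 (f z))"
      by (intro tendsto_intros)
    then show ?thesis
      using graphon_bounds[OF f, of z] out[of z] by (cases "z \<in> unit_square") (auto simp: truncated_def xy)
  qed
  show ?thesis by (rule that[OF N2 g L])
qed

text \<open>\<open>expansion_limit\<close> is applied twice, from step graphons to truncated
  continuous functions and from these to \<open>f\<close>, with a different exceptional set each
  time.\<close>

lemma expansion_on_graphons:
  assumes \<Phi>: "L1_continuous \<Phi>"
    and eq: "\<And>p C. p \<ge> 1 \<Longrightarrow> C \<in> weights \<Longrightarrow>
       \<Phi> (step p C) = (\<Sum>H\<in>iso_classes m. a H * hom_density H (step p C))"
    and f: "f \<in> graphons"
  shows "\<Phi> f = (\<Sum>H\<in>iso_classes m. a H * hom_density H f)"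
proof -
  have cont: "\<Phi> (truncated g) = (\<Sum>H\<in>iso_classes m. a H * hom_density H (truncated g))"
    if g: "continuous_on UNIV g" for g
    by (rule expansion_limit[OF \<Phi> _ truncated_graphon[OF g] negligible_null_lines step_sampled_tendsto[OF g]])
       (auto intro: step_graphon sampled_weights eq)
  obtain N g where N: "negligible N" and g: "\<And>k. continuous_on UNIV (g k)"
    and lim: "\<And>z. z \<notin> N \<Longrightarrow> (\<lambda>k. truncated (g k) z) \<longlonglongrightarrow> f z"
    using graphon_limit_of_continuous[OF f] by metis
  show ?thesis by (rule expansion_limit[OF \<Phi> truncated_graphon[OF g] f N lim cont[OF g]])
qed

theorem theorem4p27:
  fixes F :: "kernel \<Rightarrow> real" and n :: nat
  assumes "class_function F"
    and "Cn_function n F"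
  shows
    "(\<forall>f\<in>graphons.
        (\<forall>m\<le>n. gateaux_exists F m (\<lambda>_. f) (\<lambda>_. 0))
      \<and> ((\<forall>c\<in>{0<..<1}. gateaux_exists F (n + 1) (\<lambda>_. f) (\<lambda>z. c * f z)) \<longrightarrow>
           (\<exists>c\<in>{0..1}. gateaux_exists F (n + 1) (\<lambda>_. f) (\<lambda>z. c * f z)
              \<and> F f - taylor_poly F n f
                  = gateaux F (n + 1) (\<lambda>_. f) (\<lambda>z. c * f z) / fact (n + 1))))
   \<and> (\<exists>a. hom_expansion_on F n a step_graphon_orbits
        \<and> (\<forall>b. hom_expansion_on F n b step_graphon_orbits \<longrightarrow>
              (\<forall>H\<in>iso_classes_upto n. b H = a H))
        \<and> ((\<forall>m\<le>n. L1_continuous (taylor_term F m)) \<longrightarrow>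
              hom_expansion_on F n a graphons))"
proof (intro conjI ballI allI impI)
  fix f assume f: "f \<in> graphons"
  show "gateaux_exists F m (\<lambda>_. f) (\<lambda>_. 0)" if "m \<le> n" for m
    using gateaux_exists_at_zero[OF assms(2) f that] .
  show "\<exists>c\<in>{0..1}. gateaux_exists F (n + 1) (\<lambda>_. f) (\<lambda>z. c * f z)
      \<and> F f - taylor_poly F n f = gateaux F (n + 1) (\<lambda>_. f) (\<lambda>z. c * f z) / fact (n + 1)"
    if "\<forall>c\<in>{0<..<1}. gateaux_exists F (n + 1) (\<lambda>_. f) (\<lambda>z. c * f z)"
    using taylor_remainder[OF assms(2) f that] .
next
  have "\<forall>m. \<exists>a. m \<le> n \<longrightarrow> (\<forall>f\<in>step_graphon_orbits. taylor_term F m f = (\<Sum>H\<in>iso_classes m. a H * hom_density H f))"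
    using expansion_on_orbits[OF assms] by blast
  from choice[OF this] obtain A where A: "\<And>m f. m \<le> n \<Longrightarrow> f \<in> step_graphon_orbits \<Longrightarrow>
      taylor_term F m f = (\<Sum>H\<in>iso_classes m. A m H * hom_density H f)" by blast
  \<comment> \<open>Coefficients were found separately for each number of edges; a class determines
    its number of edges through its representative, so they glue to one function.\<close>
  define a where "a H = A (size (snd (rep H))) H" for H
  have a: "a H = A m H" if "H \<in> iso_classes m" for m H
    using rep_iso_class(1)[OF that] by (auto simp: a_def graphs_with_def)
  have exp: "taylor_term F m f = (\<Sum>H\<in>iso_classes m. a H * hom_density H f)"
    if "m \<le> n" "f \<in> step_graphon_orbits" for m f
    using A[OF that] a by simp
  show "\<exists>a. hom_expansion_on F n a step_graphon_orbits
        \<and> (\<forall>b. hom_expansion_on F n b step_graphon_orbits \<longrightarrow>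
              (\<forall>H\<in>iso_classes_upto n. b H = a H))
        \<and> ((\<forall>m\<le>n. L1_continuous (taylor_term F m)) \<longrightarrow>
              hom_expansion_on F n a graphons)"
  proof (intro exI[of _ a] conjI allI impI ballI)
    show "hom_expansion_on F n a step_graphon_orbits"
      using exp by (simp add: hom_expansion_on_def)
    fix b H assume b: "hom_expansion_on F n b step_graphon_orbits" and "H \<in> iso_classes_upto n"
    then obtain m where m: "m \<le> n" "H \<in> iso_classes m" by (auto simp: iso_classes_upto_def)
    show "b H = a H"
    \<comment> \<open>Uniqueness is already decided by the step graphons with this single number of
      blocks.\<close>
    proof (rule expansion_unique_on_steps[of "2 * m + 1", OF _ _ _ m(2)])
      fix C assume "C \<in> weights"
      then have "step (2 * m + 1) C \<in> step_graphon_orbits" by (intro step_in_orbits) auto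
      then show "(\<Sum>H\<in>iso_classes m. b H * hom_density H (step (2 * m + 1) C)) =
          (\<Sum>H\<in>iso_classes m. a H * hom_density H (step (2 * m + 1) C))"
        using b exp m(1) by (simp add: hom_expansion_on_def)
    qed auto
  next
    assume cont: "\<forall>m\<le>n. L1_continuous (taylor_term F m)"
    show "hom_expansion_on F n a graphons"
      unfolding hom_expansion_on_def
    proof (intro ballI allI impI)
      fix f m assume f: "f \<in> graphons" and m: "m \<le> n"
      show "taylor_term F m f = (\<Sum>H\<in>iso_classes m. a H * hom_density H f)"
        by (rule expansion_on_graphons[OF cont[rule_format, OF m] exp[OF m step_in_orbits] f])
    qed
  qed
qed

end
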